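(* Let $n\ge1$ and let $\alpha,\beta\in\mathbb C^n$ satisfy $\Re\alpha_j+\Re\beta_j>-1$ and $\alpha_j,\beta_j\notin\{-1,-2,\ldots\}$ for all $1\le j\le n$. Let $u$ be separately $(\alpha,\beta)$-harmonic in $\mathbb D^n$. Then $$u(z)=\sum_{(p,q)\in H}\frac{\partial^{(p,q)}u(0)}{p!\,q!}\,\mathcal F_{p,q}(z)\,z^p\,\overline z^{\,q},\qquad z\in\mathbb D^n,$$ and the convergence is in the topology of the space $C^\infty(\mathbb D^n)$.
   Context: $\mathbb D$ is the open unit disc. For $1\le j\le n$, $$L_{\alpha_j,\beta_j}=(1-|z_j|^2)\frac{\partial^2}{\partial z_j\partial\overline{z_j}}+\alpha_jz_j\frac{\partial}{\partial z_j}+\beta_j\overline{z_j}\frac{\partial}{\partial\overline{z_j}}-\alpha_j\beta_j .$$ A function $u\in C^2(\mathbb D^n)$ (complex valued) is separately $(\alpha,\beta)$-harmonic if $L_{\alpha_j,\beta_j}u=0$ on $\mathbb D^n$ for all $1\le j\le n$ (such a function is automatically $C^\infty$). $\mathbb Z_+=\{0,1,2,\ldots\}$ and $H=\{(p,q)\in\mathbb Z_+^n\times\mathbb Z_+^n: p_jq_j=0 \text{ for all } j\}$. For $p\in\mathbb Z_+^n$, $p!=p_1!\cdots p_n!$, $z^p=\prod_jz_j^{p_j}$, $\overline z^{\,p}=\prod_j\overline{z_j}^{\,p_j}$; $\partial^{(p,q)}=\prod_j\frac{\partial^{p_j}}{\partial z_j^{p_j}}\prod_j\frac{\partial^{q_j}}{\partial\overline{z_j}^{\,q_j}}$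 (Wirtinger derivatives). For $(p,q)\in H$, $$\mathcal F_{p,q}(z)=\prod_{j=1}^nF(p_j-\beta_j,\,q_j-\alpha_j;\,p_j+q_j+1;\,|z_j|^2),$$ where $F(a,b;c;x)=\sum_{k\ge0}\frac{(a)_k(b)_k}{(c)_k}\frac{x^k}{k!}$ is the Gauss hypergeometric function, $(a)_0=1$, $(a)_k=a(a+1)\cdots(a+k-1)$. The topology of $C^\infty(\mathbb D^n)$ is given by the seminorms $\max_{z\in K}|\partial^{(p,q)}u(z)|$, $K\subset\mathbb D^n$ compact, $p,q\in\mathbb Z_+^n$. *)

theory Defs
  imports "HOL-Analysis.Analysis"
begin

definition polydisc :: "(complex ^ 'n::finite) set" where
  "polydisc = {z. \<forall>j. cmod (z $ j) < 1}"

text \<open>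
  The class \<open>C\<^sup>k(S)\<close> in the real sense, for open \<open>S\<close>: \<open>f\<close> is continuous, or
  (\<open>k > 0\<close>) differentiable with all its directional derivatives in \<open>C\<^sup>k\<^sup>-\<^sup>1(S)\<close>.
  Since \<open>S\<close> is open, only the values of \<open>f\<close> on \<open>S\<close> matter, here and for the
  differential operators below.
\<close>

primrec Ck_on ::
  "nat \<Rightarrow> 'a::real_normed_vector set \<Rightarrow> ('a \<Rightarrow> 'b::real_normed_vector) \<Rightarrow> bool" where
  "Ck_on 0 S f \<longleftrightarrow> continuous_on S f"
| "Ck_on (Suc k) S f \<longleftrightarrow>
     (\<forall>x\<in>S. f differentiable (at x)) \<and>
     (\<forall>v. Ck_on k S (\<lambda>x. frechet_derivative f (at x) v))"

definition Cinf_on ::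
  "'a::real_normed_vector set \<Rightarrow> ('a \<Rightarrow> 'b::real_normed_vector) \<Rightarrow> bool" where
  "Cinf_on S f \<longleftrightarrow> (\<forall>k. Ck_on k S f)"

text \<open>
  Wirtinger derivatives. With \<open>z\<^sub>j = x\<^sub>j + \<i> y\<^sub>j\<close>, the vectors \<open>axis j 1\<close> and
  \<open>axis j \<i>\<close> are the directions of \<open>\<partial>/\<partial>x\<^sub>j\<close> and \<open>\<partial>/\<partial>y\<^sub>j\<close>.
\<close>

definition wirtinger ::
  "'n::finite \<Rightarrow> (complex ^ 'n \<Rightarrow> complex) \<Rightarrow> complex ^ 'n \<Rightarrow> complex" where
  "wirtinger j f z =
     (frechet_derivative f (at z) (axis j 1) - \<i> * frechet_derivative f (at z) (axis j \<i>)) / 2"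

definition wirtinger_bar ::
  "'n::finite \<Rightarrow> (complex ^ 'n \<Rightarrow> complex) \<Rightarrow> complex ^ 'n \<Rightarrow> complex" where
  "wirtinger_bar j f z =
     (frechet_derivative f (at z) (axis j 1) + \<i> * frechet_derivative f (at z) (axis j \<i>)) / 2"

text \<open>
  A fixed enumeration of the coordinates, giving the order in which the iterated
  derivatives are taken; for smooth functions this order is immaterial.
\<close>

definition coords :: "'n::finite list" where
  "coords = (SOME js. distinct js \<and> set js = UNIV)"

lemma distinct_coords: "distinct (coords :: 'n::finite list)"
  and set_coords: "set (coords :: 'n::finite list) = UNIV"
proof -
  have "\<exists>js :: 'n list. distinct js \<and> set js = UNIV"
    using finite_distinct_list[OF finite_class.finite_UNIV] by blast
  from someI_ex[OF this] show "distinct (coords :: 'n list)" "set (coords :: 'n list) = UNIV"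
    unfolding coords_def by auto
qed

definition wirtinger_multi ::
  "nat ^ 'n::finite \<Rightarrow> nat ^ 'n \<Rightarrow> (complex ^ 'n \<Rightarrow> complex) \<Rightarrow> complex ^ 'n \<Rightarrow> complex" where
  "wirtinger_multi p q f =
     foldr (\<lambda>j. wirtinger j ^^ (p $ j)) coords
       (foldr (\<lambda>j. wirtinger_bar j ^^ (q $ j)) coords f)"

definition L_op ::
  "complex ^ 'n::finite \<Rightarrow> complex ^ 'n \<Rightarrow> 'n \<Rightarrow> (complex ^ 'n \<Rightarrow> complex) \<Rightarrow> complex ^ 'n \<Rightarrow> complex"
  where
  "L_op \<alpha> \<beta> j u z =
     (1 - of_real ((cmod (z $ j))\<^sup>2)) * wirtinger j (wirtinger_bar j u) z
     + \<alpha> $ j * z $ j * wirtinger j u z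
     + \<beta> $ j * cnj (z $ j) * wirtinger_bar j u z
     - \<alpha> $ j * \<beta> $ j * u z"

definition separately_harmonic ::
  "complex ^ 'n::finite \<Rightarrow> complex ^ 'n \<Rightarrow> (complex ^ 'n \<Rightarrow> complex) \<Rightarrow> bool" where
  "separately_harmonic \<alpha> \<beta> u \<longleftrightarrow>
     Ck_on 2 polydisc u \<and> (\<forall>j. \<forall>z\<in>polydisc. L_op \<alpha> \<beta> j u z = 0)"

definition index_H :: "((nat ^ 'n::finite) \<times> (nat ^ 'n)) set" where
  "index_H = {(p, q). \<forall>j. p $ j * q $ j = 0}"

definition multi_fact :: "nat ^ 'n::finite \<Rightarrow> nat" where
  "multi_fact p = (\<Prod>j\<in>UNIV. fact (p $ j))"

definition multi_power :: "complex ^ 'n::finite \<Rightarrow> nat ^ 'n \<Rightarrow> complex" where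
  "multi_power z p = (\<Prod>j\<in>UNIV. (z $ j) ^ (p $ j))"

definition multi_power_cnj :: "complex ^ 'n::finite \<Rightarrow> nat ^ 'n \<Rightarrow> complex" where
  "multi_power_cnj z p = (\<Prod>j\<in>UNIV. (cnj (z $ j)) ^ (p $ j))"

definition gauss_F :: "complex \<Rightarrow> complex \<Rightarrow> complex \<Rightarrow> complex \<Rightarrow> complex" where
  "gauss_F a b c x =
     (\<Sum>k. pochhammer a k * pochhammer b k / pochhammer c k * (x ^ k / fact k))"

definition F_pq ::
  "complex ^ 'n::finite \<Rightarrow> complex ^ 'n \<Rightarrow> nat ^ 'n \<Rightarrow> nat ^ 'n \<Rightarrow> complex ^ 'n \<Rightarrow> complex" where
  "F_pq \<alpha> \<beta> p q z =
     (\<Prod>j\<in>UNIV. gauss_F (of_nat (p $ j) - \<beta> $ j) (of_nat (q $ j) - \<alpha> $ j)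
        (of_nat (p $ j + q $ j + 1)) (of_real ((cmod (z $ j))\<^sup>2)))"

definition Cinf_seminorm ::
  "(complex ^ 'n::finite) set \<Rightarrow> nat ^ 'n \<Rightarrow> nat ^ 'n \<Rightarrow> (complex ^ 'n \<Rightarrow> complex) \<Rightarrow> real" where
  "Cinf_seminorm K p q f = (SUP z\<in>K. cmod (wirtinger_multi p q f z))"

text \<open>
  Unordered summation over \<open>I\<close> in the topology of \<open>C\<^sup>\<infinity>\<close> of the polydisc: all terms
  and the sum belong to the space, and the net of finite partial sums converges to the
  sum in each seminorm. (\<open>K \<noteq> {}\<close> only because the real supremum of the empty
  set is unspecified.)
\<close>

definition has_sum_Cinf ::
  "('i \<Rightarrow> complex ^ 'n::finite \<Rightarrow> complex) \<Rightarrow> (complex ^ 'n \<Rightarrow> complex) \<Rightarrow> 'i set \<Rightarrow> bool" where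
  "has_sum_Cinf g f I \<longleftrightarrow>
     (\<forall>i\<in>I. Cinf_on polydisc (g i)) \<and> Cinf_on polydisc f \<and>
     (\<forall>K p q. compact K \<and> K \<noteq> {} \<and> K \<subseteq> polydisc \<longrightarrow>
        ((\<lambda>A. Cinf_seminorm K p q (\<lambda>z. (\<Sum>i\<in>A. g i z) - f z)) \<longlongrightarrow> 0)
          (finite_subsets_at_top I))"

definition series_term ::
  "complex ^ 'n::finite \<Rightarrow> complex ^ 'n \<Rightarrow> (complex ^ 'n \<Rightarrow> complex)
     \<Rightarrow> (nat ^ 'n) \<times> (nat ^ 'n) \<Rightarrow> complex ^ 'n \<Rightarrow> complex" where
  "series_term \<alpha> \<beta> u = (\<lambda>(p, q) z.
     wirtinger_multi p q u 0 / (of_nat (multi_fact p) * of_nat (multi_fact q))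
       * F_pq \<alpha> \<beta> p q z * multi_power z p * multi_power_cnj z q)"

end

theory Submission
  imports Defs
begin

text \<open>
  Fix one coordinate and write it as \<open>r e\<^sup>i\<^sup>t\<close>. Taking the \<open>k\<close>-th Fourier coefficient in \<open>t\<close>
  turns the equation \<open>L u = 0\<close> into a second order ordinary differential equation in \<open>r\<close> that is
  singular at \<open>0\<close>. Only one of its solutions, up to a factor, stays regular at \<open>0\<close>: with
  \<open>p - q = k\<close> and \<open>p q = 0\<close> it is \<open>\<phi>(r) = r\<^sup>p\<^sup>+\<^sup>q F(p - \<beta>, q - \<alpha>; p + q + 1; r\<^sup>2)\<close>. This is shown by a
  Wronskian argument (\<open>radial_solution_proportional\<close>).
  Hence the \<open>k\<close>-th coefficient at radius \<open>r\<close> is its value at any other radius \<open>s\<close>, multiplied by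
  \<open>\<phi>(r) / \<phi>(s)\<close>.

  To sum over \<open>k\<close> one needs the Cauchy type bound \<open>|\<phi>(s)| \<ge> \<delta> r\<^sub>0\<^sup>p\<^sup>+\<^sup>q\<close>, uniformly in \<open>(p, q)\<close>, for
  some \<open>s \<le> r\<^sub>0\<close> (\<open>hg_radial_lower_bound\<close>). For large \<open>p\<close> one takes \<open>s = r\<^sub>0\<close>, because the hypergeometric
  factor tends to the nonzero number \<open>(1 - r\<^sub>0\<^sup>2)\<^sup>\<alpha>\<close> (for large \<open>q\<close>: to \<open>(1 - r\<^sub>0\<^sup>2)\<^sup>\<beta>\<close>); the finitely many
  remaining pairs use a small \<open>s\<close>, where that factor is near \<open>1\<close>. As a continuous function on a
  circle is determined by its Fourier coefficients, this gives an absolutely convergent expansion in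
  powers of \<open>z\<close> and its conjugate whose coefficients are Fourier coefficients of the function on
  circles of radius at most \<open>r\<^sub>0\<close> (\<open>one_variable_expansion\<close>). They are integrals, so the
  expansion can be iterated through the coordinates (\<open>polydisc_expansion\<close>), and
  \<open>u(z) = \<Sum> a(P, Q) z\<^sup>P w\<^sup>Q\<close> with \<open>|a(P, Q)| \<le> C r\<^sub>0\<^sup>-\<^sup>|\<^sup>P\<^sup>|\<^sup>-\<^sup>|\<^sup>Q\<^sup>|\<close>, where \<open>w\<close> is the
  conjugate of \<open>z\<close>.

  Such a series can be differentiated term by term, so \<open>u\<close> is smooth and \<open>P! Q! a(P, Q)\<close> is the
  derivative of \<open>u\<close> at \<open>0\<close>. The coefficients therefore do not depend on \<open>r\<^sub>0 < 1\<close>, and the series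
  converges in the whole polydisc (\<open>harmonic_represented\<close>). By the recursion
  \<open>(P\<^sub>j + 1) (Q\<^sub>j + 1) a(P + e\<^sub>j, Q + e\<^sub>j) = (P\<^sub>j - \<beta>\<^sub>j) (Q\<^sub>j - \<alpha>\<^sub>j) a(P, Q)\<close> the terms with a given
  reduced index \<open>(p, q) \<in> H\<close>, that is those with \<open>(P, Q) = (p + m, q + m)\<close>, add up to the term of the
  theorem (\<open>represented_series_term\<close>). So the theorem is a grouping of an absolutely convergent
  series, and for every derivative and every compact set the remainder is at most the tail of a
  convergent series of nonnegative numbers (\<open>infsum_outside_finite_tendsto\<close>).
\<close>

section \<open>Uniqueness for linear differential equations and for Fourier coefficients\<close>

text \<open>
  Gronwall's inequality in the form of a uniqueness statement: \<open>|y|\<^sup>2 e\<^sup>-\<^sup>2\<^sup>C\<^sup>t\<close> decreases and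
  \<open>|y|\<^sup>2 e\<^sup>2\<^sup>C\<^sup>t\<close> increases, so a zero spreads to both sides.
\<close>

lemma linear_ode_zero:
  fixes y :: "real \<Rightarrow> 'a::real_inner"
  assumes cont: "continuous_on {a..b} y" 
    and der: "\<And>t. t \<in> {a<..<b} \<Longrightarrow> (y has_vector_derivative y' t) (at t)"
    and bd: "\<And>t. t \<in> {a<..<b} \<Longrightarrow> norm (y' t) \<le> C * norm (y t)"
    and c: "c \<in> {a..b}" "y c = 0" and t: "t \<in> {a..b}"
  shows "y t = 0"
proof -
  define E where "E = (\<lambda>t. y t \<bullet> y t)"
  have E_cont: "continuous_on {a..b} E"
    unfolding E_def by (intro continuous_intros cont)
  have E_der: "(E has_real_derivative 2 * (y t \<bullet> y' t)) (at t)" if "t \<in> {a<..<b}" for t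
    using der[OF that] unfolding E_def has_vector_derivative_def has_field_derivative_def
    by (auto intro!: derivative_eq_intros simp: inner_commute algebra_simps)
  have E_bd: "\<bar>2 * (y t \<bullet> y' t)\<bar> \<le> 2 * C * E t" if "t \<in> {a<..<b}" for t
  proof -
    have "\<bar>y t \<bullet> y' t\<bar> \<le> norm (y t) * norm (y' t)" by (rule Cauchy_Schwarz_ineq2)
    also have "\<dots> \<le> norm (y t) * (C * norm (y t))"
      by (intro mult_left_mono bd that norm_ge_zero)
    also have "\<dots> = C * E t" by (simp add: E_def dot_square_norm power2_eq_square)
    finally show ?thesis by simp
  qed
  have E_nonneg: "E t \<ge> 0" for t by (simp add: E_def)
  have "E t \<le> 0"
  proof (cases "c \<le> t")
    case True
    have "E t * exp (- (2 * C) * t) \<le> E c * exp (- (2 * C) * c)"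
    proof (rule DERIV_nonpos_imp_decreasing_open[OF True, of "\<lambda>t. E t * exp (- (2 * C) * t)"])
      fix x assume x: "c < x" "x < t"
      then have x': "x \<in> {a<..<b}" using c t by auto
      have "((\<lambda>t. E t * exp (- (2 * C) * t)) has_real_derivative
              (2 * (y x \<bullet> y' x) - 2 * C * E x) * exp (- (2 * C) * x)) (at x)"
        using E_der[OF x'] by (auto intro!: derivative_eq_intros simp: algebra_simps)
      moreover have "(2 * (y x \<bullet> y' x) - 2 * C * E x) * exp (- (2 * C) * x) \<le> 0"
        using E_bd[OF x'] by (intro mult_nonpos_nonneg) auto
      ultimately show "\<exists>d. ((\<lambda>t. E t * exp (- (2 * C) * t)) has_real_derivative d) (at x) \<and> d \<le> 0"
        by blast
    next
      show "continuous_on {c..t} (\<lambda>t. E t * exp (- (2 * C) * t))"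
        using c t by (intro continuous_intros continuous_on_subset[OF E_cont]) auto
    qed
    moreover have "E c = 0" using c by (simp add: E_def)
    ultimately have "E t * exp (- (2 * C) * t) \<le> 0" by simp
    then show ?thesis by (simp add: mult_le_0_iff)
  next
    case False
    have "E t * exp (2 * C * t) \<le> E c * exp (2 * C * c)"
    proof (rule DERIV_nonneg_imp_increasing_open[of t c "\<lambda>t. E t * exp (2 * C * t)"])
      show "t \<le> c" using False by simp
    next
      fix x assume x: "t < x" "x < c"
      then have x': "x \<in> {a<..<b}" using c t by auto
      have "((\<lambda>t. E t * exp (2 * C * t)) has_real_derivative
              (2 * (y x \<bullet> y' x) + 2 * C * E x) * exp (2 * C * x)) (at x)"
        using E_der[OF x'] by (auto intro!: derivative_eq_intros simp: algebra_simps)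
      moreover have "(2 * (y x \<bullet> y' x) + 2 * C * E x) * exp (2 * C * x) \<ge> 0"
        using E_bd[OF x'] by (intro mult_nonneg_nonneg) auto
      ultimately show "\<exists>d. ((\<lambda>t. E t * exp (2 * C * t)) has_real_derivative d) (at x) \<and> d \<ge> 0"
        by blast
    next
      show "continuous_on {t..c} (\<lambda>t. E t * exp (2 * C * t))"
        using c t by (intro continuous_intros continuous_on_subset[OF E_cont]) auto
    qed
    moreover have "E c = 0" using c by (simp add: E_def)
    ultimately have "E t * exp (2 * C * t) \<le> 0" by simp
    then show ?thesis by (simp add: mult_le_0_iff)
  qed
  with E_nonneg[of t] have "E t = 0" by simp
  then show ?thesis by (simp add: E_def)
qed

definition circle_coeff :: "int \<Rightarrow> (complex \<Rightarrow> complex) \<Rightarrow> real \<Rightarrow> complex" where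
  "circle_coeff k f r =
     integral {0..2*pi} (\<lambda>t. f (of_real r * cis t) * cis (- (of_int k * t))) / (2 * pi)"

lemma continuous_on_circle_integrand:
  assumes "continuous_on (sphere 0 \<bar>r\<bar>) f"
  shows "continuous_on A (\<lambda>t. f (of_real r * cis t) * cis (- (of_int k * t)))"
  by (intro continuous_intros continuous_on_compose2[OF assms]) (auto simp: norm_mult)

lemma circle_integrand_integrable:
  assumes "continuous_on (sphere 0 \<bar>r\<bar>) f"
  shows "(\<lambda>t. f (of_real r * cis t) * cis (- (of_int k * t))) integrable_on {0..2*pi}"
  using continuous_on_circle_integrand[OF assms] by (rule integrable_continuous_real)

lemma circle_coeff_cong:
  assumes "\<And>z. norm z = \<bar>r\<bar> \<Longrightarrow> f z = g z"
  shows "circle_coeff k f r = circle_coeff k g r"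
  unfolding circle_coeff_def
  by (intro arg_cong2[of _ _ _ _ "(/)"] Henstock_Kurzweil_Integration.integral_cong refl) (auto simp: assms norm_mult)

lemma circle_coeff_add:
  assumes "continuous_on (sphere 0 \<bar>r\<bar>) f" "continuous_on (sphere 0 \<bar>r\<bar>) g"
  shows "circle_coeff k (\<lambda>z. f z + g z) r = circle_coeff k f r + circle_coeff k g r"
  unfolding circle_coeff_def distrib_right
  by (subst Henstock_Kurzweil_Integration.integral_add)
     (auto intro!: circle_integrand_integrable assms simp: add_divide_distrib)

lemma circle_coeff_cmult:
  "circle_coeff k (\<lambda>z. c * f z) r = c * circle_coeff k f r"
  unfolding circle_coeff_def mult.assoc by simp

lemma circle_coeff_diff:
  assumes "continuous_on (sphere 0 \<bar>r\<bar>) f" "continuous_on (sphere 0 \<bar>r\<bar>) g"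
  shows "circle_coeff k (\<lambda>z. f z - g z) r = circle_coeff k f r - circle_coeff k g r"
  unfolding circle_coeff_def left_diff_distrib
  by (subst Henstock_Kurzweil_Integration.integral_diff)
     (auto intro!: circle_integrand_integrable assms simp: diff_divide_distrib)

lemma norm_circle_coeff_le:
  assumes "continuous_on (sphere 0 \<bar>r\<bar>) f" "\<And>z. norm z = \<bar>r\<bar> \<Longrightarrow> norm (f z) \<le> B"
  shows "norm (circle_coeff k f r) \<le> B"
proof -
  have "norm (integral {0..2*pi} (\<lambda>t. f (of_real r * cis t) * cis (- (of_int k * t)))) \<le> B * (2*pi - 0)"
    by (rule integral_bound)
       (use assms continuous_on_circle_integrand[OF assms(1)] in \<open>auto simp: norm_mult\<close>)
  then show ?thesis
    by (simp add: circle_coeff_def norm_divide field_simps)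
qed

lemma circle_coeff_shift:
  "circle_coeff k (\<lambda>z. z * f z) r = of_real r * circle_coeff (k - 1) f r"
  "circle_coeff k (\<lambda>z. cnj z * f z) r = of_real r * circle_coeff (k + 1) f r"
proof -
  have 1: "of_real r * cis t * f (of_real r * cis t) * cis (- (of_int k * t))
      = of_real r * (f (of_real r * cis t) * cis (- (of_int (k-1) * t)))" for t
  proof -
    have "cis (- (of_int (k-1) * t)) = cis t * cis (- (of_int k * t))"
      by (simp add: cis_mult algebra_simps)
    then show ?thesis by (simp only: mult_ac)
  qed
  have 2: "cnj (of_real r * cis t) * f (of_real r * cis t) * cis (- (of_int k * t))
      = of_real r * (f (of_real r * cis t) * cis (- (of_int (k+1) * t)))" for t
  proof -
    have "cis (- (of_int (k+1) * t)) = cis (- t) * cis (- (of_int k * t))"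
      by (simp add: cis_mult algebra_simps)
    moreover have "cnj (of_real r * cis t) = of_real r * cis (- t)" by (simp add: cis_cnj)
    ultimately show ?thesis by (simp only: mult_ac)
  qed
  show "circle_coeff k (\<lambda>z. z * f z) r = of_real r * circle_coeff (k - 1) f r"
    unfolding circle_coeff_def 1 by simp
  show "circle_coeff k (\<lambda>z. cnj z * f z) r = of_real r * circle_coeff (k + 1) f r"
    unfolding circle_coeff_def 2 by simp
qed

lemma continuous_on_real_polynomial_function:
  "real_polynomial_function p \<Longrightarrow> continuous_on A p"
  by (intro continuous_at_imp_continuous_on ballI continuous_real_polymonial_function)

text \<open>
  On the unit circle a real linear form is a combination of \<open>z\<close> and its conjugate, and multiplying
  by these only shifts the Fourier coefficients. Quantifying over \<open>h\<close> in the induction handles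
  products of polynomials.
\<close>

lemma circle_coeff_times_real_polynomial:
  assumes "real_polynomial_function p" "continuous_on (sphere 0 1) h" "\<And>k. circle_coeff k h 1 = 0"
  shows "circle_coeff k (\<lambda>z. h z * of_real (p z)) 1 = 0"
  using assms
proof (induction arbitrary: h k rule: real_polynomial_function.induct)
  case (linear p)
  have p: "of_real (p z) = z * ((p 1 - \<i> * p \<i>) / 2) + cnj z * ((p 1 + \<i> * p \<i>) / 2)" for z
  proof -
    interpret bounded_linear p by fact
    have "p z = p (Re z *\<^sub>R 1 + Im z *\<^sub>R \<i>)"
      by (rule arg_cong[where f=p]) (simp add: complex_eq_iff)
    also have "\<dots> = Re z * p 1 + Im z * p \<i>" by (simp only: add scaleR real_scaleR_def)
    finally show ?thesis by (simp add: complex_eq_iff field_simps)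
  qed
  define A B where "A = (p 1 - \<i> * p \<i>) / 2" and "B = (p 1 + \<i> * p \<i>) / 2"
  have "circle_coeff k (\<lambda>z. h z * of_real (p z)) 1
      = circle_coeff k (\<lambda>z. A * (z * h z) + B * (cnj z * h z)) 1"
    by (rule circle_coeff_cong, subst p) (simp add: A_def B_def algebra_simps)
  also have "\<dots> = 0"
    by (subst circle_coeff_add)
       (auto intro!: continuous_on_mult continuous_on_cnj continuous_on_const continuous_on_id linear.prems simp: circle_coeff_cmult circle_coeff_shift linear.prems)
  finally show ?case .
next
  case (const c)
  then show ?case using circle_coeff_cmult[of k "of_real c" h 1] by (simp add: mult.commute)
next
  case (add p q)
  have cp: "continuous_on (sphere 0 1) p" "continuous_on (sphere 0 1) q"
    by (rule continuous_on_real_polynomial_function, fact)+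
  have "circle_coeff k (\<lambda>z. h z * of_real (p z) + h z * of_real (q z)) 1
      = circle_coeff k (\<lambda>z. h z * of_real (p z)) 1 + circle_coeff k (\<lambda>z. h z * of_real (q z)) 1"
    by (rule circle_coeff_add) (simp_all add: continuous_on_mult continuous_on_of_real add.prems(1) cp)
  also have "\<dots> = 0"
    using add.IH(1)[OF add.prems] add.IH(2)[OF add.prems] by simp
  finally have "circle_coeff k (\<lambda>z. h z * of_real (p z) + h z * of_real (q z)) 1 = 0" .
  then show ?case by (simp add: distrib_left)
next
  case (mult p q)
  have cp: "continuous_on (sphere 0 1) p"
    by (rule continuous_on_real_polynomial_function, fact)
  have "circle_coeff k (\<lambda>z. (h z * of_real (p z)) * of_real (q z)) 1 = 0"
  proof (rule mult.IH(2))
    show "continuous_on (sphere 0 1) (\<lambda>z. h z * of_real (p z))"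
      by (simp add: continuous_on_mult continuous_on_of_real mult.prems(1) cp)
    show "circle_coeff k (\<lambda>z. h z * of_real (p z)) 1 = 0" for k
      by (rule mult.IH(1)[OF mult.prems])
  qed
  then show ?case by (simp add: mult.assoc)
qed

text \<open>
  By the Stone-Weierstrass theorem the conjugate of \<open>h\<close> is a uniform limit of polynomials, to all of
  which \<open>h\<close> is orthogonal. Hence \<open>h\<close> is orthogonal to itself.
\<close>

lemma circle_coeffs_zero_imp_zero_unit:
  assumes h: "continuous_on (sphere 0 1) h" "\<And>k. circle_coeff k h 1 = 0" and z: "norm z = 1"
  shows "h z = 0"
proof -
  have "bounded (h ` sphere 0 1)" by (intro compact_imp_bounded compact_continuous_image h) auto
  then obtain M where M: "M > 0" "\<And>z. norm z = 1 \<Longrightarrow> norm (h z) \<le> M"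
    unfolding bounded_pos by auto
  define N where "N = circle_coeff 0 (\<lambda>z. h z * cnj (h z)) 1"
  have "norm N \<le> M * e" if e: "e > 0" for e
  proof -
    obtain g where g: "polynomial_function g" "\<And>z. norm z = 1 \<Longrightarrow> norm (cnj (h z) - g z) < e"
      using Stone_Weierstrass_polynomial_function[of "sphere 0 1" "\<lambda>z. cnj (h z)" e] e h
      by (auto intro!: continuous_on_mult continuous_on_of_real continuous_on_cnj continuous_on_Re continuous_on_Im continuous_on_const)
    have cg: "continuous_on A g" for A using g(1) by (rule continuous_on_polymonial_function)
    have rg: "real_polynomial_function (\<lambda>z. Re (g z))" "real_polynomial_function (\<lambda>z. Im (g z))"
      using g(1) bounded_linear_Re bounded_linear_Im unfolding polynomial_function_def o_def by auto
    have "circle_coeff 0 (\<lambda>z. h z * g z) 1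
        = circle_coeff 0 (\<lambda>z. h z * of_real (Re (g z)) + \<i> * (h z * of_real (Im (g z)))) 1"
      by (rule circle_coeff_cong) (simp add: complex_eq_iff)
    also have "\<dots> = 0"
      by (subst circle_coeff_add)
         (auto intro!: continuous_on_mult continuous_on_add continuous_on_diff continuous_on_cnj h cg continuous_on_Re continuous_on_Im simp: circle_coeff_cmult circle_coeff_times_real_polynomial rg h)
    finally have "N = circle_coeff 0 (\<lambda>z. h z * cnj (h z) - h z * g z) 1"
      unfolding N_def by (subst circle_coeff_diff) (auto intro!: continuous_on_mult continuous_on_add continuous_on_diff continuous_on_cnj h cg)
    also have "norm \<dots> \<le> M * e"
    proof (rule norm_circle_coeff_le)
      fix z :: complex assume z: "norm z = \<bar>1\<bar>"
      then have "norm (h z) * norm (cnj (h z) - g z) \<le> M * e"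
        using M g(2)[of z] by (intro mult_mono) auto
      then show "norm (h z * cnj (h z) - h z * g z) \<le> M * e"
        by (simp flip: norm_mult add: right_diff_distrib)
    qed (auto intro!: continuous_on_mult continuous_on_add continuous_on_diff continuous_on_cnj h cg)
    finally show ?thesis .
  qed
  note N_le = this
  have "norm N \<le> 0 + e" if "e > 0" for e
  proof -
    have "norm N \<le> M * (e / M)" by (rule N_le) (use M(1) \<open>e > 0\<close> in simp)
    then show ?thesis using M(1) by simp
  qed
  then have "N = 0" using field_le_epsilon[of "norm N" 0] by auto
  then have "integral {0..2*pi} (\<lambda>t. complex_of_real ((norm (h (cis t)))\<^sup>2)) = 0"
    unfolding N_def circle_coeff_def complex_norm_square by simp
  moreover have c: "continuous_on {0..2*pi} (\<lambda>t. (norm (h (cis t)))\<^sup>2)"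
    by (intro continuous_intros continuous_on_compose2[OF h(1)]) auto
  ultimately have "integral {0..2*pi} (\<lambda>t. (norm (h (cis t)))\<^sup>2) = 0"
    using integral_linear[OF integrable_continuous_real[OF c] bounded_linear_of_real, where 'a1 = complex]
    by (simp add: o_def)
  then have "\<forall>t\<in>{0..2*pi}. (norm (h (cis t)))\<^sup>2 = 0"
    using integral_cbox_eq_0_iff[of 0 "2*pi" "\<lambda>t. (norm (h (cis t)))\<^sup>2"] c pi_gt_zero
    by (simp add: not_le)
  moreover obtain t where "t \<in> {0..2*pi}" "z = cis t"
  proof -
    have "z = cis (Arg2pi z)" using Arg2pi_eq[of z] z by (simp add: cis_conv_exp)
    with that[of "Arg2pi z"] Arg2pi_ge_0[of z] Arg2pi_lt_2pi[of z] show ?thesis by auto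
  qed
  ultimately show ?thesis by auto
qed

lemma circle_coeffs_zero_imp_zero:
  assumes h: "continuous_on (sphere 0 \<bar>r\<bar>) h" "\<And>k. circle_coeff k h r = 0" and z: "norm z = \<bar>r\<bar>"
  shows "h z = 0"
proof (cases "r = 0")
  case True
  have "circle_coeff 0 h 0 = h 0" by (simp add: circle_coeff_def scaleR_conv_of_real)
  with h(2)[of 0] z True show ?thesis by simp
next
  case False
  have "(\<lambda>w. h (of_real r * w)) (z / of_real r) = 0"
  proof (rule circle_coeffs_zero_imp_zero_unit[where h = "\<lambda>w. h (of_real r * w)"])
    show "continuous_on (sphere 0 1) (\<lambda>w. h (of_real r * w))"
      by (intro continuous_on_compose2[OF h(1)] continuous_intros) (auto simp: norm_mult)
    show "circle_coeff k (\<lambda>w. h (of_real r * w)) 1 = 0" for k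
      using h(2)[of k] by (simp add: circle_coeff_def)
    show "norm (z / of_real r) = 1" using z False by (simp add: norm_divide)
  qed
  then show ?thesis using False by simp
qed

section \<open>The radial system of a Fourier coefficient\<close>

lemma continuous_on_circle_coeff:
  assumes "continuous_on S f" "\<And>r t. r \<in> A \<Longrightarrow> of_real r * cis t \<in> S"
  shows "continuous_on A (circle_coeff k f)"
proof -
  have "continuous_on A (\<lambda>r. integral (cbox 0 (2*pi)) (\<lambda>t. f (of_real r * cis t) * cis (- (of_int k * t))))"
  proof (rule integral_continuous_on_param)
    show "continuous_on (A \<times> cbox 0 (2 * pi)) (\<lambda>(r, t). f (of_real r * cis t) * cis (- (of_int k * t)))"
      unfolding split_def
      by (intro continuous_intros continuous_on_compose2[OF assms(1)]) (auto intro!: assms(2))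
  qed
  then show ?thesis
    unfolding circle_coeff_def by (intro continuous_intros) (simp_all)
qed

lemma continuous_on_sphereI:
  "continuous_on (ball 0 1) f \<Longrightarrow> 0 \<le> r \<Longrightarrow> r < 1 \<Longrightarrow> continuous_on (sphere (0::complex) \<bar>r\<bar>) f"
  by (rule continuous_on_subset) auto

context
  fixes w a b :: "complex \<Rightarrow> complex"
  assumes deriv: "\<And>z. norm z < 1 \<Longrightarrow> (w has_derivative (\<lambda>h. a z * h + b z * cnj h)) (at z)"
    and cont: "continuous_on (ball 0 1) a" "continuous_on (ball 0 1) b"
begin

lemma wirtinger_continuous: "continuous_on (ball 0 1) w"
  by (rule continuous_at_imp_continuous_on) (auto intro: has_derivative_continuous[OF deriv])

text \<open>
  Let \<open>w\<close> have the Wirtinger derivatives \<open>a\<close> and \<open>b\<close>, and write \<open>z\<^sup>*\<close> for the conjugate of \<open>z\<close>. Then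
  \<open>r \<partial>\<^sub>r w = z a + z\<^sup>* b\<close> and \<open>\<partial>\<^sub>t w = \<i> (z a - z\<^sup>* b)\<close>. Differentiation under the integral gives this
  formula, integration by parts gives the next one. Together they express the coefficients of \<open>z a\<close>
  and of \<open>z\<^sup>* b\<close> through that of \<open>w\<close>.
\<close>

lemma circle_coeff_radial_derivative:
  assumes r: "0 < r" "r < 1"
  shows "(circle_coeff k w has_vector_derivative
      (circle_coeff k (\<lambda>z. z * a z) r + circle_coeff k (\<lambda>z. cnj z * b z) r) / of_real r) (at r)"
proof -
  define fx where "fx = (\<lambda>(x::real) t. (a (of_real x * cis t) * cis t + b (of_real x * cis t) * cnj (cis t)) * cis (- (of_int k * t)))"
  have "((\<lambda>x. integral (cbox 0 (2*pi)) (\<lambda>t. w (of_real x * cis t) * cis (- (of_int k * t))))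
      has_vector_derivative integral (cbox 0 (2*pi)) (fx r)) (at r within {0<..<1})"
  proof (rule leibniz_rule_vector_derivative)
    fix x t :: real assume x: "x \<in> {0<..<1}"
    have "((\<lambda>x. of_real x * cis t) has_derivative (\<lambda>h. of_real h * cis t)) (at x)"
      by (auto intro!: derivative_eq_intros)
    then have "((\<lambda>x. w (of_real x * cis t)) has_derivative
        (\<lambda>h. a (of_real x * cis t) * (of_real h * cis t) + b (of_real x * cis t) * cnj (of_real h * cis t))) (at x)"
      by (rule has_derivative_compose) (use x in \<open>auto intro!: deriv simp: norm_mult\<close>)
    then have "((\<lambda>x. w (of_real x * cis t)) has_vector_derivative
        (a (of_real x * cis t) * cis t + b (of_real x * cis t) * cnj (cis t))) (at x)"
      by (simp add: has_vector_derivative_def scaleR_conv_of_real algebra_simps)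
    then show "((\<lambda>x. w (of_real x * cis t) * cis (- (of_int k * t))) has_vector_derivative fx x t) (at x within {0<..<1})"
      unfolding fx_def by (intro has_vector_derivative_at_within[OF has_vector_derivative_mult_left])
  next
    fix x :: real assume x: "x \<in> {0<..<1}"
    show "(\<lambda>t. w (of_real x * cis t) * cis (- (of_int k * t))) integrable_on cbox 0 (2 * pi)"
      using circle_integrand_integrable[OF continuous_on_sphereI[OF wirtinger_continuous]] x
      by simp
  next
    show "continuous_on ({0<..<1} \<times> cbox 0 (2 * pi)) (\<lambda>(x, t). fx x t)"
      unfolding split_def fx_def
      by (intro continuous_intros continuous_on_compose2[OF cont(1)] continuous_on_compose2[OF cont(2)])
         (auto simp: norm_mult)
  qed (use r in auto)
  then have "((\<lambda>x. integral (cbox 0 (2*pi)) (\<lambda>t. w (of_real x * cis t) * cis (- (of_int k * t))))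
      has_vector_derivative integral (cbox 0 (2*pi)) (fx r)) (at r)"
    using at_within_open[of r "{0<..<1}"] r by simp
  then have "((\<lambda>x. integral (cbox 0 (2*pi)) (\<lambda>t. w (of_real x * cis t) * cis (- (of_int k * t))) / (2*pi))
      has_vector_derivative integral (cbox 0 (2*pi)) (fx r) / (2*pi)) (at r)"
    by (rule has_vector_derivative_divide)
  then have 1: "(circle_coeff k w has_vector_derivative integral (cbox 0 (2*pi)) (fx r) / (2*pi)) (at r)"
    by (simp add: circle_coeff_def[abs_def])
  have c: "continuous_on (sphere 0 \<bar>r\<bar>) a" "continuous_on (sphere 0 \<bar>r\<bar>) b"
    using r cont by (blast intro: continuous_on_sphereI less_imp_le)+
  have "circle_coeff k (\<lambda>z. z * a z) r + circle_coeff k (\<lambda>z. cnj z * b z) r =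
      circle_coeff k (\<lambda>z. z * a z + cnj z * b z) r"
    by (rule circle_coeff_add[symmetric]) (intro continuous_intros c)+
  also have "\<dots> = integral {0..2*pi} (\<lambda>t. of_real r * fx r t) / (2*pi)"
    unfolding circle_coeff_def fx_def
    by (intro arg_cong2[of _ _ _ _ "(/)"] Henstock_Kurzweil_Integration.integral_cong refl) (simp add: algebra_simps)
  also have "\<dots> = of_real r * (integral (cbox 0 (2*pi)) (fx r) / (2*pi))"
    by simp
  finally have "(circle_coeff k (\<lambda>z. z * a z) r + circle_coeff k (\<lambda>z. cnj z * b z) r) / of_real r
    = integral (cbox 0 (2*pi)) (fx r) / (2*pi)" using r by simp
  with 1 show ?thesis by simp
qed

lemma circle_coeff_angular_derivative:
  assumes r: "0 \<le> r" "r < 1"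
  shows "circle_coeff k (\<lambda>z. z * a z) r - circle_coeff k (\<lambda>z. cnj z * b z) r = of_int k * circle_coeff k w r"
proof -
  define F where "F = (\<lambda>t. \<i> * ((of_real r * cis t * a (of_real r * cis t) - cnj (of_real r * cis t) * b (of_real r * cis t))
     - of_int k * w (of_real r * cis t)) * cis (- (of_int k * t)))"
  have "(F has_integral (w (of_real r * cis (2*pi)) * cis (- (of_int k * (2*pi))) - w (of_real r * cis 0) * cis (- (of_int k * 0)))) {0..2*pi}"
  proof (rule fundamental_theorem_of_calculus)
    fix t :: real
    have "((\<lambda>x. of_real r * cis x) has_derivative (\<lambda>h. of_real h * (\<i> * of_real r * cis t))) (at t)"
      by (auto intro!: derivative_eq_intros simp: has_vector_derivative_def scaleR_conv_of_real)
    then have "((\<lambda>x. w (of_real r * cis x)) has_derivative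
        (\<lambda>h. a (of_real r * cis t) * (of_real h * (\<i> * of_real r * cis t)) + b (of_real r * cis t) * cnj (of_real h * (\<i> * of_real r * cis t)))) (at t)"
      by (rule has_derivative_compose) (use r in \<open>auto intro!: deriv simp: norm_mult\<close>)
    then have 1: "((\<lambda>x. w (of_real r * cis x)) has_vector_derivative
        (a (of_real r * cis t) * (\<i> * of_real r * cis t) + b (of_real r * cis t) * cnj (\<i> * of_real r * cis t))) (at t)"
      by (simp add: has_vector_derivative_def scaleR_conv_of_real algebra_simps)
    have 2: "((\<lambda>x. cis (- (of_int k * x))) has_vector_derivative (- \<i> * of_int k * cis (- (of_int k * t)))) (at t)"
      by (auto intro!: derivative_eq_intros simp: has_vector_derivative_def scaleR_conv_of_real)
    have "((\<lambda>x. w (of_real r * cis x) * cis (- (of_int k * x))) has_vector_derivative F t) (at t)"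
      using has_vector_derivative_mult[OF 1 2] by (simp add: F_def algebra_simps)
    then show "((\<lambda>x. w (of_real r * cis x) * cis (- (of_int k * x))) has_vector_derivative F t) (at t within {0..2*pi})"
      by (rule has_vector_derivative_at_within)
  qed auto
  moreover have "cis (- (of_int k * (2*pi))) = 1"
    using cis_multiple_2pi[of "- of_int k"] by (simp add: mult_ac)
  ultimately have "integral {0..2*pi} F = 0" by (auto dest: integral_unique)
  then have 0: "circle_coeff k (\<lambda>z. \<i> * ((z * a z - cnj z * b z) - of_int k * w z)) r = 0"
    by (simp add: circle_coeff_def F_def mult.assoc)
  have c: "continuous_on (sphere 0 \<bar>r\<bar>) a" "continuous_on (sphere 0 \<bar>r\<bar>) b" "continuous_on (sphere 0 \<bar>r\<bar>) w"
    using r cont wirtinger_continuous by (blast intro: continuous_on_sphereI)+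
  have "circle_coeff k (\<lambda>z. \<i> * ((z * a z - cnj z * b z) - of_int k * w z)) r =
     \<i> * ((circle_coeff k (\<lambda>z. z * a z) r - circle_coeff k (\<lambda>z. cnj z * b z) r) - of_int k * circle_coeff k w r)"
    unfolding circle_coeff_cmult
    by (simp add: circle_coeff_diff circle_coeff_cmult continuous_on_diff continuous_on_mult continuous_on_cnj
        continuous_on_id continuous_on_const c)
  with 0 show ?thesis by simp
qed

end

text \<open>
  The equation \<open>L f = 0\<close> for the Fourier mode \<open>k\<close> as a first order system. Here \<open>g\<close> is the coefficient
  of \<open>f\<close>, and \<open>h\<close> is that of the conjugate of \<open>z\<close> times the conjugate Wirtinger derivative of \<open>f\<close>.
  Regularity at the singular point \<open>0\<close> is the continuity there together with \<open>h 0 = 0\<close>.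
\<close>

definition radial_solution :: "complex \<Rightarrow> complex \<Rightarrow> int \<Rightarrow> (real \<Rightarrow> complex) \<Rightarrow> (real \<Rightarrow> complex) \<Rightarrow> bool" where
  "radial_solution \<alpha> \<beta> k g h \<longleftrightarrow>
     continuous_on {0..<1} g \<and> continuous_on {0..<1} h \<and> h 0 = 0 \<and>
     (\<forall>r\<in>{0<..<1}.
        (g has_vector_derivative (of_int k * g r + 2 * h r) / of_real r) (at r) \<and>
        (h has_vector_derivative (- (of_int k * h r) - 2 * of_real (r\<^sup>2) / of_real (1 - r\<^sup>2) *
            ((\<alpha> + \<beta>) * h r + (of_int k * \<alpha> - \<alpha> * \<beta>) * g r)) / of_real r) (at r))"

text \<open>
  The formulas for the radial and the angular derivative are used for \<open>f\<close> and for the function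
  \<open>cnj z * b z\<close>. As \<open>|z|\<close> is constant on a circle, the factor \<open>1 - |z|\<^sup>2\<close> of \<open>L\<close> passes through
  the integral.
\<close>

lemma circle_coeff_radial_solution:
  fixes f a b c d :: "complex \<Rightarrow> complex"
  assumes D1: "\<And>z. norm z < 1 \<Longrightarrow> (f has_derivative (\<lambda>h. a z * h + b z * cnj h)) (at z)"
    and D2: "\<And>z. norm z < 1 \<Longrightarrow> (b has_derivative (\<lambda>h. c z * h + d z * cnj h)) (at z)"
    and cont: "continuous_on (ball 0 1) a" "continuous_on (ball 0 1) c" "continuous_on (ball 0 1) d"
    and pde: "\<And>z. norm z < 1 \<Longrightarrow>
       (1 - of_real ((norm z)\<^sup>2)) * c z + \<alpha> * z * a z + \<beta> * cnj z * b z - \<alpha> * \<beta> * f z = 0"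
  shows "radial_solution \<alpha> \<beta> k (circle_coeff k f) (circle_coeff k (\<lambda>z. cnj z * b z))"
proof -
  have cb: "continuous_on (ball 0 1) b" using wirtinger_continuous[OF D2 cont(2,3)] .
  have cf: "continuous_on (ball 0 1) f" using wirtinger_continuous[OF D1 cont(1) cb] .
  have D3: "((\<lambda>z. cnj z * b z) has_derivative (\<lambda>h. cnj z * c z * h + (b z + cnj z * d z) * cnj h)) (at z)"
    if "norm z < 1" for z
    using D2[OF that] by (auto intro!: derivative_eq_intros simp: algebra_simps)
  have c3: "continuous_on (ball 0 1) (\<lambda>z. cnj z * c z)" "continuous_on (ball 0 1) (\<lambda>z. b z + cnj z * d z)"
    by (intro continuous_intros cont cb)+
  let ?g = "circle_coeff k f" and ?h = "circle_coeff k (\<lambda>z. cnj z * b z)"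
  show ?thesis
    unfolding radial_solution_def
  proof (intro conjI ballI)
    show "continuous_on {0..<1} ?g"
      by (rule continuous_on_circle_coeff[OF cf]) (auto simp: norm_mult)
    show "continuous_on {0..<1} ?h"
      by (rule continuous_on_circle_coeff[of "ball 0 1"]) (auto intro!: continuous_intros cb simp: norm_mult)
    show "?h 0 = 0" by (simp add: circle_coeff_def)
  next
    fix r :: real assume "r \<in> {0<..<1}"
    then have r: "0 < r" "r < 1" "0 \<le> r" by auto
    have za: "circle_coeff k (\<lambda>z. z * a z) r = of_int k * ?g r + ?h r"
      using circle_coeff_angular_derivative[OF D1 cont(1) cb r(3,2), of k] by (simp add: algebra_simps)
    show "(?g has_vector_derivative (of_int k * ?g r + 2 * ?h r) / of_real r) (at r)"
      using circle_coeff_radial_derivative[OF D1 cont(1) cb r(1,2), of k] unfolding za by (simp add: algebra_simps)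
    define T where "T = circle_coeff k (\<lambda>z. z * (cnj z * c z)) r"
    have zb: "circle_coeff k (\<lambda>z. cnj z * (b z + cnj z * d z)) r = T - of_int k * ?h r"
      using circle_coeff_angular_derivative[OF D3 c3 r(3,2), of k] by (simp add: algebra_simps T_def)
    have h': "(?h has_vector_derivative (2 * T - of_int k * ?h r) / of_real r) (at r)"
      using circle_coeff_radial_derivative[OF D3 c3 r(1,2), of k] unfolding zb T_def[symmetric] by (simp add: algebra_simps)
    note S = continuous_on_sphereI[OF _ r(3,2)]
    have "of_real (1 - r\<^sup>2) * T = circle_coeff k (\<lambda>z. of_real (1 - r\<^sup>2) * (z * (cnj z * c z))) r"
      by (simp add: circle_coeff_cmult T_def)
    also have "\<dots> = circle_coeff k (\<lambda>z. of_real (- (r\<^sup>2)) * ((\<alpha> * (z * a z) + \<beta> * (cnj z * b z)) - (\<alpha> * \<beta>) * f z)) r"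
    proof (rule circle_coeff_cong)
      fix z :: complex assume z: "norm z = \<bar>r\<bar>"
      then have "z * cnj z = of_real (r\<^sup>2)" by (simp add: complex_norm_square[symmetric])
      moreover have "of_real (1 - r\<^sup>2) * c z = - (\<alpha> * z * a z + \<beta> * cnj z * b z - \<alpha> * \<beta> * f z)"
        using pde[of z] z r by (simp add: algebra_simps eq_neg_iff_add_eq_0)
      moreover have "of_real (1 - r\<^sup>2) * (z * (cnj z * c z)) = (z * cnj z) * (of_real (1 - r\<^sup>2) * c z)"
        by simp
      ultimately have "of_real (1 - r\<^sup>2) * (z * (cnj z * c z)) = of_real (r\<^sup>2) * - (\<alpha> * z * a z + \<beta> * cnj z * b z - \<alpha> * \<beta> * f z)"
        by (simp only:)
      then show "of_real (1 - r\<^sup>2) * (z * (cnj z * c z)) =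
        of_real (- (r\<^sup>2)) * ((\<alpha> * (z * a z) + \<beta> * (cnj z * b z)) - (\<alpha> * \<beta>) * f z)"
        by (simp only: of_real_minus mult_minus_left mult_minus_right mult.assoc)
    qed
    also have "\<dots> = of_real (- (r\<^sup>2)) * ((\<alpha> * (of_int k * ?g r + ?h r) + \<beta> * ?h r) - (\<alpha> * \<beta>) * ?g r)"
      unfolding circle_coeff_cmult za[symmetric]
      by (simp add: circle_coeff_diff circle_coeff_add circle_coeff_cmult continuous_on_diff continuous_on_add
          continuous_on_mult continuous_on_cnj continuous_on_id continuous_on_const S cont cb cf)
    finally have T: "of_real (1 - r\<^sup>2) * T = of_real (- (r\<^sup>2)) * ((\<alpha> + \<beta>) * ?h r + (of_int k * \<alpha> - \<alpha> * \<beta>) * ?g r)"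
      by (simp add: algebra_simps)
    have "1 - r\<^sup>2 > 0" using r by (simp add: power_less_one_iff)
    then have "complex_of_real (1 - r\<^sup>2) \<noteq> 0" by (metis of_real_eq_0_iff less_irrefl)
    then have "T = - (of_real (r\<^sup>2) / of_real (1 - r\<^sup>2) * ((\<alpha> + \<beta>) * ?h r + (of_int k * \<alpha> - \<alpha> * \<beta>) * ?g r))"
      using T by (metis (no_types, lifting) divide_minus_left mult.commute mult_minus_left
          nonzero_mult_div_cancel_left of_real_minus times_divide_eq_right)
    then have "2 * T - of_int k * ?h r = - (of_int k * ?h r) - 2 * of_real (r\<^sup>2) / of_real (1 - r\<^sup>2) *
            ((\<alpha> + \<beta>) * ?h r + (of_int k * \<alpha> - \<alpha> * \<beta>) * ?g r)"
      by simp
    with h' show "(?h has_vector_derivative (- (of_int k * ?h r) - 2 * of_real (r\<^sup>2) / of_real (1 - r\<^sup>2) *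
            ((\<alpha> + \<beta>) * ?h r + (of_int k * \<alpha> - \<alpha> * \<beta>) * ?g r)) / of_real r) (at r)"
      by simp
  qed
qed

section \<open>Uniqueness of the regular radial solution\<close>

text \<open>
  In the Wronskian \<open>W = g1 h2 - g2 h1\<close> the singular terms \<open>k / r\<close> of the system cancel, leaving
  \<open>W' = - 2 r (\<alpha> + \<beta>) / (1 - r\<^sup>2) W\<close> with \<open>W(0) = 0\<close>; so \<open>W = 0\<close>. Then the combination
  \<open>g2(s) (g1, h1) - g1(s) (g2, h2)\<close> vanishes at \<open>s\<close>, and therefore everywhere, as the system is
  regular away from \<open>0\<close>. The product form of the conclusion allows \<open>g2\<close> to have zeros.
\<close>

lemma radial_solution_proportional:
  assumes 1: "radial_solution \<alpha> \<beta> k g1 h1" and 2: "radial_solution \<alpha> \<beta> k g2 h2"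
    and r: "0 \<le> r" "r < 1" and s: "0 < s" "s < 1"
  shows "g1 r * g2 s = g1 s * g2 r"
proof -
  define \<rho> where "\<rho> = (max r s + 1) / 2"
  have \<rho>: "r < \<rho>" "s < \<rho>" "0 < \<rho>" "\<rho> < 1" using r s by (auto simp: \<rho>_def)
  define D where "D = 1 - \<rho>\<^sup>2"
  have D: "D > 0" using \<rho> by (simp add: D_def power_less_one_iff)
  have le_D: "t\<^sup>2 / (1 - t\<^sup>2) \<le> 1 / D" "0 \<le> t\<^sup>2 / (1 - t\<^sup>2)" "0 < 1 - t\<^sup>2" if "t \<in> {0..\<rho>}" for t
  proof -
    have "t\<^sup>2 \<le> \<rho>\<^sup>2" "t\<^sup>2 \<le> 1" using that \<rho> by (auto intro!: power_mono power_le_one)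
    then show "t\<^sup>2 / (1 - t\<^sup>2) \<le> 1 / D" "0 < 1 - t\<^sup>2" "0 \<le> t\<^sup>2 / (1 - t\<^sup>2)" using D
      by (auto simp: D_def intro!: frac_le)
  qed
  have sub: "{0..\<rho>} \<subseteq> {0..<1}" using \<rho> by auto
  have cont: "continuous_on {0..\<rho>} g1" "continuous_on {0..\<rho>} h1" "continuous_on {0..\<rho>} g2" "continuous_on {0..\<rho>} h2"
    using 1 2 continuous_on_subset[OF _ sub] by (auto simp: radial_solution_def)
  define g' where "g' = (\<lambda>g h t. (of_int k * g t + 2 * h t) / complex_of_real t)"
  define q where "q = (\<lambda>t::real. 2 * of_real (t\<^sup>2) / of_real (1 - t\<^sup>2) :: complex)"
  define h' where "h' = (\<lambda>g h t. (- (of_int k * h t) - q t *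
            ((\<alpha> + \<beta>) * h t + (of_int k * \<alpha> - \<alpha> * \<beta>) * g t)) / complex_of_real t)"
  have der: "(g1 has_vector_derivative g' g1 h1 t) (at t)" "(h1 has_vector_derivative h' g1 h1 t) (at t)"
            "(g2 has_vector_derivative g' g2 h2 t) (at t)" "(h2 has_vector_derivative h' g2 h2 t) (at t)"
    if "t \<in> {0<..<\<rho>}" for t
    using 1 2 that \<rho> by (auto simp: radial_solution_def g'_def h'_def q_def)
  have q_le: "norm (q t) \<le> 2 / D" if "t \<in> {0..\<rho>}" for t
    using le_D[OF that] unfolding q_def norm_mult norm_divide norm_of_real by simp
  \<comment> \<open>the Wronskian solves a first order equation without singularity at \<open>0\<close>\<close>
  have W: "g1 t * h2 t - g2 t * h1 t = 0" if t: "t \<in> {0..\<rho>}" for t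
  proof (rule linear_ode_zero[where y = "\<lambda>t. g1 t * h2 t - g2 t * h1 t" and c = 0 and a = 0 and b = \<rho>
        and C = "2 / D * norm (\<alpha> + \<beta>)" and y' = "\<lambda>t. - (2 * of_real t / of_real (1 - t\<^sup>2)) * (\<alpha> + \<beta>) * (g1 t * h2 t - g2 t * h1 t)"])
    show "continuous_on {0..\<rho>} (\<lambda>t. g1 t * h2 t - g2 t * h1 t)" by (intro continuous_intros cont)
  next
    fix t assume t: "t \<in> {0<..<\<rho>}"
    then have t0: "complex_of_real t \<noteq> 0" by simp
    have q: "q t = of_real t * (2 * of_real t / of_real (1 - t\<^sup>2))" by (simp add: q_def power2_eq_square)
    have "((\<lambda>t. g1 t * h2 t - g2 t * h1 t) has_vector_derivative
        (g1 t * h' g2 h2 t + g' g1 h1 t * h2 t) - (g2 t * h' g1 h1 t + g' g2 h2 t * h1 t)) (at t)"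
      by (intro has_vector_derivative_diff has_vector_derivative_mult der t)
    also have "(g1 t * h' g2 h2 t + g' g1 h1 t * h2 t) - (g2 t * h' g1 h1 t + g' g2 h2 t * h1 t)
       = - (2 * of_real t / of_real (1 - t\<^sup>2)) * (\<alpha> + \<beta>) * (g1 t * h2 t - g2 t * h1 t)"
      unfolding g'_def h'_def q using t0
      by (simp add: divide_simps) (simp add: algebra_simps)
    finally show "((\<lambda>t. g1 t * h2 t - g2 t * h1 t) has_vector_derivative
       - (2 * of_real t / of_real (1 - t\<^sup>2)) * (\<alpha> + \<beta>) * (g1 t * h2 t - g2 t * h1 t)) (at t)" .
    have "2 * t / (1 - t\<^sup>2) \<le> 2 / D"
      using le_D[of t] t \<rho> D power_mono[of t \<rho> 2] by (intro frac_le) (auto simp: D_def)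
    moreover have "norm (2 * of_real t / of_real (1 - t\<^sup>2) :: complex) = 2 * t / (1 - t\<^sup>2)"
      using le_D(3)[of t] t unfolding norm_mult norm_divide norm_of_real by simp
    ultimately show "norm (- (2 * of_real t / of_real (1 - t\<^sup>2)) * (\<alpha> + \<beta>) * (g1 t * h2 t - g2 t * h1 t))
       \<le> 2 / D * norm (\<alpha> + \<beta>) * norm (g1 t * h2 t - g2 t * h1 t)"
      unfolding norm_mult norm_minus_cancel by (intro mult_right_mono) auto
  next
    show "g1 0 * h2 0 - g2 0 * h1 0 = 0" using 1 2 by (simp add: radial_solution_def)
  qed (use t \<rho> in auto)
  define G H where "G = (\<lambda>t. g1 t * g2 s - g2 t * g1 s)" and "H = (\<lambda>t. h1 t * g2 s - h2 t * g1 s)"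
  have contGH: "continuous_on {0..\<rho>} G" "continuous_on {0..\<rho>} H"
    unfolding G_def H_def by (intro continuous_intros cont)+
  have G0: "G t = 0" if t: "0 < t" "t < \<rho>" for t
  proof -
    define e where "e = min t s"
    have e: "0 < e" "e \<le> t" "e \<le> s" using t s by (auto simp: e_def)
    define C where "C = ((\<bar>of_int k\<bar> + 2) + (\<bar>of_int k\<bar> + 2 / D * (norm (\<alpha> + \<beta>) + norm (of_int k * \<alpha> - \<alpha> * \<beta>)))) / e"
    have "(G t, H t) = 0"
    proof (rule linear_ode_zero[where y = "\<lambda>t. (G t, H t)" and y' = "\<lambda>t. (g' G H t, h' G H t)" and c = s and a = e and b = \<rho> and C = C])
      show "continuous_on {e..\<rho>} (\<lambda>t. (G t, H t))"
        using e by (intro continuous_intros continuous_on_subset[OF contGH(1)] continuous_on_subset[OF contGH(2)]) auto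
    next
      fix x assume "x \<in> {e<..<\<rho>}"
      then have x: "e < x" "x < \<rho>" "0 < x" "x \<in> {0<..<\<rho>}" "x \<in> {0..\<rho>}" using e by auto
      have "(G has_vector_derivative (g' g1 h1 x * g2 s - g' g2 h2 x * g1 s)) (at x)"
        unfolding G_def by (intro has_vector_derivative_diff has_vector_derivative_mult_left der x)
      also have "g' g1 h1 x * g2 s - g' g2 h2 x * g1 s = g' G H x"
        using x(3) by (simp add: g'_def G_def H_def divide_simps) (simp add: algebra_simps)
      finally have dG: "(G has_vector_derivative g' G H x) (at x)" .
      have "(H has_vector_derivative (h' g1 h1 x * g2 s - h' g2 h2 x * g1 s)) (at x)"
        unfolding H_def by (intro has_vector_derivative_diff has_vector_derivative_mult_left der x)
      also have "h' g1 h1 x * g2 s - h' g2 h2 x * g1 s = h' G H x"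
        using x(3) by (simp add: h'_def G_def H_def divide_simps) (simp add: algebra_simps)
      finally have dH: "(H has_vector_derivative h' G H x) (at x)" .
      show "((\<lambda>t. (G t, H t)) has_vector_derivative (g' G H x, h' G H x)) (at x)"
        by (rule has_vector_derivative_Pair[OF dG dH])
      have N: "norm (G x) \<le> norm (G x, H x)" "norm (H x) \<le> norm (G x, H x)"
        by (auto simp: norm_Pair intro!: real_le_rsqrt)
      let ?N = "norm (G x, H x)"
      have "norm (g' G H x) \<le> (\<bar>of_int k\<bar> * ?N + 2 * ?N) / e"
        unfolding g'_def norm_divide
        by (intro frac_le order.trans[OF norm_triangle_ineq] add_mono)
           (use x e N in \<open>auto simp: norm_mult intro!: mult_left_mono\<close>)
      moreover have "norm (h' G H x) \<le> (\<bar>of_int k\<bar> * ?N + 2 / D * (norm (\<alpha> + \<beta>) * ?N + norm (of_int k * \<alpha> - \<alpha> * \<beta>) * ?N)) / e"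
        unfolding h'_def norm_divide
      proof (intro frac_le order.trans[OF norm_triangle_ineq4] add_mono)
        show "norm (- (of_int k * H x)) \<le> \<bar>of_int k\<bar> * ?N"
          using N by (auto simp: norm_mult intro!: mult_left_mono)
        have "norm ((\<alpha> + \<beta>) * H x + (of_int k * \<alpha> - \<alpha> * \<beta>) * G x) \<le> norm (\<alpha> + \<beta>) * ?N + norm (of_int k * \<alpha> - \<alpha> * \<beta>) * ?N"
          by (intro order.trans[OF norm_triangle_ineq] add_mono) (use N in \<open>auto simp: norm_mult intro!: mult_left_mono\<close>)
        then show "norm (q x * ((\<alpha> + \<beta>) * H x + (of_int k * \<alpha> - \<alpha> * \<beta>) * G x)) \<le>
           2 / D * (norm (\<alpha> + \<beta>) * ?N + norm (of_int k * \<alpha> - \<alpha> * \<beta>) * ?N)"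
          unfolding norm_mult[of "q x"] using q_le[OF x(5)] D by (intro mult_mono) auto
      qed (use x e D in auto)
      moreover have "norm (g' G H x, h' G H x) \<le> norm (g' G H x) + norm (h' G H x)"
        by (simp add: norm_Pair sqrt_sum_squares_le_sum)
      ultimately have "norm (g' G H x, h' G H x) \<le> (\<bar>of_int k\<bar> * ?N + 2 * ?N) / e
        + (\<bar>of_int k\<bar> * ?N + 2 / D * (norm (\<alpha> + \<beta>) * ?N + norm (of_int k * \<alpha> - \<alpha> * \<beta>) * ?N)) / e"
        by linarith
      also have "\<dots> = C * ?N" unfolding C_def by (simp add: algebra_simps add_divide_distrib)
      finally show "norm (g' G H x, h' G H x) \<le> C * norm (G x, H x)" .
    next
      have "H s = 0" using W[of s] s \<rho> by (simp add: H_def algebra_simps)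
      then show "(G s, H s) = 0" by (simp add: G_def zero_prod_def)
    qed (use e t \<rho> in auto)
    then show ?thesis by (simp add: zero_prod_def)
  qed
  \<comment> \<open>the radius \<open>0\<close> is reached by continuity\<close>
  have "G r = 0"
  proof (rule continuous_constant_on_closure[of "{0<..<\<rho>}"])
    show "continuous_on (closure {0<..<\<rho>}) G" using contGH \<rho> by simp
    show "r \<in> closure {0<..<\<rho>}" using r \<rho> by simp
  qed (use G0 in auto)
  then show ?thesis by (simp add: G_def algebra_simps)
qed

section \<open>The hypergeometric solution of the radial system\<close>

definition rising_ratio :: "complex \<Rightarrow> nat \<Rightarrow> nat \<Rightarrow> complex" where
  "rising_ratio b p m = pochhammer (of_nat p - b) m / pochhammer (of_nat p + 1) m"

text \<open>
  For \<open>p q = 0\<close> these are the Taylor coefficients of \<open>F(p - \<beta>, q - \<alpha>; p + q + 1; X)\<close>, because then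
  \<open>(p + 1)\<^sub>m (q + 1)\<^sub>m = (p + q + 1)\<^sub>m m!\<close>. As a product of two similar factors they are easier to
  estimate uniformly in \<open>p\<close> and \<open>q\<close>.
\<close>

definition hg_coeff :: "complex \<Rightarrow> complex \<Rightarrow> nat \<Rightarrow> nat \<Rightarrow> nat \<Rightarrow> complex" where
  "hg_coeff \<alpha> \<beta> p q m = rising_ratio \<beta> p m * rising_ratio \<alpha> q m"

definition hg_radial :: "complex \<Rightarrow> complex \<Rightarrow> nat \<Rightarrow> nat \<Rightarrow> real \<Rightarrow> complex" where
  "hg_radial \<alpha> \<beta> p q r = of_real r ^ (p + q) * (\<Sum>m. hg_coeff \<alpha> \<beta> p q m * of_real (r\<^sup>2) ^ m)"

lemma rising_ratio_0 [simp]: "rising_ratio b p 0 = 1"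
  by (simp add: rising_ratio_def)

lemma rising_ratio_Suc:
  "rising_ratio b p (Suc m) = rising_ratio b p m * ((of_nat (p + m) - b) / of_nat (p + m + 1))"
  by (simp add: rising_ratio_def pochhammer_Suc algebra_simps)

lemma hg_coeff_0 [simp]: "hg_coeff \<alpha> \<beta> p q 0 = 1"
  by (simp add: hg_coeff_def)

lemma hg_coeff_Suc:
  "of_nat (p + m + 1) * of_nat (q + m + 1) * hg_coeff \<alpha> \<beta> p q (Suc m)
     = (of_nat (p + m) - \<beta>) * (of_nat (q + m) - \<alpha>) * hg_coeff \<alpha> \<beta> p q m"
proof -
  have nz: "complex_of_nat (p + m + 1) \<noteq> 0" "complex_of_nat (q + m + 1) \<noteq> 0"
    by (simp_all only: of_nat_eq_0_iff)
  have "a * b * (x * (y / a) * (z * (w / b))) = y * w * (x * z)" if "a \<noteq> 0" "b \<noteq> 0" for a b x y z w :: complex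
    using that by simp
  from this[OF nz] show ?thesis
    unfolding hg_coeff_def rising_ratio_Suc .
qed

text \<open>
  Factor by factor, \<open>(p + i + B) / (p + i + 1)\<close> decreases in \<open>p\<close> when \<open>B \<ge> 1\<close>; so \<open>p = 0\<close> is the
  worst case.
\<close>

lemma norm_rising_ratio_le:
  assumes B: "norm b \<le> real B" "B \<ge> 1"
  shows "norm (rising_ratio b p m) \<le> pochhammer (real B) m / fact m"
proof (induction m)
  case (Suc m)
  have "norm (of_nat (p + m) - b) / real (p + m + 1) \<le> (real (p + m) + real B) / real (p + m + 1)"
    using norm_triangle_ineq4[of "of_nat (p + m)" b] B unfolding norm_of_nat
    by (intro divide_right_mono) linarith+
  also have "\<dots> \<le> (real B + real m) / (real m + 1)"
    using B mult_right_mono[of 1 "real B" "real p"] by (simp add: divide_simps) (simp add: algebra_simps)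
  finally have *: "norm ((of_nat (p + m) - b) / of_nat (p + m + 1)) \<le> (real B + real m) / (real m + 1)"
    by (simp add: norm_divide del: of_nat_Suc of_nat_add)
  have "norm (rising_ratio b p (Suc m)) \<le> (pochhammer (real B) m / fact m) * ((real B + real m) / (real m + 1))"
    unfolding rising_ratio_Suc norm_mult
    by (intro mult_mono Suc *) (use B in \<open>auto intro!: divide_nonneg_nonneg pochhammer_nonneg\<close>)
  also have "\<dots> = pochhammer (real B) (Suc m) / fact (Suc m)"
    by (simp add: pochhammer_Suc algebra_simps)
  finally show ?case .
qed simp

lemma summable_pochhammer_power:
  fixes B t :: real
  assumes "\<bar>t\<bar> < 1"
  shows "summable (\<lambda>m. pochhammer B m / fact m * t ^ m)"
proof -
  have "summable (\<lambda>m. ((- B) gchoose m) * (- t) ^ m)"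
    using gen_binomial_real[of "- t" "- B"] assms by (auto simp: sums_iff)
  also have "(\<lambda>m. ((- B) gchoose m) * (- t) ^ m) = (\<lambda>m. pochhammer B m / fact m * t ^ m)"
  proof
    fix m
    have "(- 1) ^ m * (- t) ^ m = t ^ m" by (simp flip: power_mult_distrib)
    then show "((- B) gchoose m) * (- t) ^ m = pochhammer B m / fact m * t ^ m"
      by (simp add: gbinomial_pochhammer mult.commute mult.left_commute)
  qed
  finally show ?thesis .
qed

definition hg_majorant :: "complex \<Rightarrow> complex \<Rightarrow> nat \<Rightarrow> real" where
  "hg_majorant \<alpha> \<beta> m = (pochhammer (real (nat \<lceil>max (norm \<alpha>) (norm \<beta>)\<rceil> + 1)) m / fact m)\<^sup>2"

lemma norm_hg_coeff_le: "norm (hg_coeff \<alpha> \<beta> p q m) \<le> hg_majorant \<alpha> \<beta> m"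
proof -
  \<comment> \<open>a natural number that is at least \<open>1\<close> and dominates both parameters\<close>
  define B where "B = nat \<lceil>max (norm \<alpha>) (norm \<beta>)\<rceil> + 1"
  have B: "norm \<alpha> \<le> real B" "norm \<beta> \<le> real B" "B \<ge> 1"
    unfolding B_def by linarith+
  show ?thesis
    unfolding hg_coeff_def norm_mult hg_majorant_def B_def[symmetric] power2_eq_square
    by (intro mult_mono norm_rising_ratio_le B divide_nonneg_nonneg pochhammer_nonneg norm_ge_zero) (use B in auto)
qed

lemma summable_hg_majorant:
  assumes x: "0 \<le> x" "x < 1"
  shows "summable (\<lambda>m. hg_majorant \<alpha> \<beta> m * x ^ m)"
proof -
  \<comment> \<open>each coefficient is a product of two terms of the binomial type, so \<open>x\<close> is split as
         \<open>sqrt x * sqrt x\<close>: one factor is bounded, the other summable\<close>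
  define e where "e = (\<lambda>m. pochhammer (real (nat \<lceil>max (norm \<alpha>) (norm \<beta>)\<rceil> + 1)) m / fact m * sqrt x ^ m)"
  have "summable e" unfolding e_def by (rule summable_pochhammer_power) (use x in auto)
  then have "bounded (range e)" by (intro convergent_imp_bounded) (blast dest: summable_LIMSEQ_zero)
  then obtain C where C: "\<And>m. norm (e m) \<le> C" unfolding bounded_iff by auto
  have e0: "e m \<ge> 0" for m
    unfolding e_def by (intro mult_nonneg_nonneg divide_nonneg_nonneg pochhammer_nonneg) (use x in auto)
  have eq: "hg_majorant \<alpha> \<beta> m * x ^ m = e m * e m" for m
    unfolding e_def hg_majorant_def power2_eq_square
    using x by (simp add: mult_ac flip: power_mult_distrib)
  show ?thesis
  proof (rule summable_comparison_test')
    show "summable (\<lambda>m. C * e m)" by (intro summable_mult \<open>summable e\<close>)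
    show "norm (hg_majorant \<alpha> \<beta> m * x ^ m) \<le> C * e m" if "m \<ge> 0" for m
      unfolding eq using C[of m] e0[of m] by (simp add: mult_right_mono)
  qed
qed

lemma summable_hg_coeff:
  assumes "norm X < 1"
  shows "summable (\<lambda>m. hg_coeff \<alpha> \<beta> p q m * X ^ m)"
  by (rule summable_comparison_test'[OF summable_hg_majorant[of "norm X" \<alpha> \<beta>]])
     (use assms in \<open>auto simp: norm_mult norm_power intro!: mult_right_mono norm_hg_coeff_le\<close>)

lemma abs_summable_hg_coeff:
  assumes "norm X < 1"
  shows "(\<lambda>m. norm (hg_coeff \<alpha> \<beta> p q m * X ^ m)) summable_on UNIV"
proof -
  have "summable (\<lambda>m. norm (hg_coeff \<alpha> \<beta> p q m * X ^ m))"
    by (rule summable_comparison_test'[OF summable_hg_majorant[of "norm X" \<alpha> \<beta>]])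
       (use assms in \<open>auto simp: norm_mult norm_power intro!: mult_right_mono norm_hg_coeff_le\<close>)
  then show ?thesis by (subst summable_on_UNIV_nonneg_real_iff) auto
qed

lemma hg_coeff_has_sum:
  assumes "norm X < 1"
  shows "((\<lambda>m. hg_coeff \<alpha> \<beta> p q m * X ^ m) has_sum (\<Sum>m. hg_coeff \<alpha> \<beta> p q m * X ^ m)) UNIV"
  by (rule norm_summable_imp_has_sum[OF _ summable_sums[OF summable_hg_coeff[OF assms]]])
     (rule summable_on_imp_summable[OF abs_summable_hg_coeff[OF assms]])

text \<open>
  The Euler operator \<open>X d/dX\<close> on coefficients.
\<close>

lemma sums_times_index:
  fixes c :: "nat \<Rightarrow> complex"
  assumes "(\<lambda>m. diffs c m * X ^ m) sums S"
  shows "(\<lambda>m. of_nat m * c m * X ^ m) sums (X * S)"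
proof (rule sums_Suc_imp)
  show "(\<lambda>n. of_nat (Suc n) * c (Suc n) * X ^ Suc n) sums (X * S)"
    using sums_mult[OF assms, of X] by (simp add: diffs_def mult_ac)
qed simp

text \<open>
  The recursion of the coefficients is the hypergeometric differential equation \<open>ode\<close> for
  \<open>G(X) = F(p - \<beta>, q - \<alpha>; p + q + 1; X)\<close>, and substituting \<open>X = r\<^sup>2\<close> turns it into the radial system. The
  second component is what the conjugate Euler operator gives on \<open>z\<^sup>p\<^sup>+\<^sup>m\<close> times the
  \<open>(q + m)\<close>-th power of the conjugate: each term is multiplied by \<open>q + m\<close>.
\<close>

lemma hg_coeff_radial_solution:
  assumes pq: "p * q = 0"
  obtains h where "radial_solution \<alpha> \<beta> (int p - int q) (hg_radial \<alpha> \<beta> p q) h"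
proof -
  define \<gamma> where "\<gamma> = hg_coeff \<alpha> \<beta> p q"
  define G G1 G2 where "G = (\<lambda>X. \<Sum>m. \<gamma> m * X ^ m)"
    and "G1 = (\<lambda>X. \<Sum>m. diffs \<gamma> m * X ^ m)" and "G2 = (\<lambda>X. \<Sum>m. diffs (diffs \<gamma>) m * X ^ m)"
  have s0: "summable (\<lambda>m. \<gamma> m * X ^ m)" if "norm X < 1" for X
    unfolding \<gamma>_def by (rule summable_hg_coeff[OF that])
  have s1: "summable (\<lambda>m. diffs \<gamma> m * X ^ m)" if "norm X < 1" for X
    by (rule termdiff_converges[OF that s0])
  have s2: "summable (\<lambda>m. diffs (diffs \<gamma>) m * X ^ m)" if "norm X < 1" for X
    by (rule termdiff_converges[OF that s1])
  have dG: "(G has_field_derivative G1 X) (at X)" if "norm X < 1" for X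
    unfolding G_def G1_def by (rule termdiffs_strong'[OF s0 that])
  have dG1: "(G1 has_field_derivative G2 X) (at X)" if "norm X < 1" for X
    unfolding G1_def G2_def by (rule termdiffs_strong'[OF s1 that])
  have pq0: "complex_of_nat p * of_nat q = 0" using pq by simp
  have ode: "(1 - X) * (of_nat (p + q + 1) * G1 X + X * G2 X)
      = - ((\<alpha> + \<beta>) * (X * G1 X) + (\<beta> * of_nat q + \<alpha> * of_nat p - \<alpha> * \<beta>) * G X)" if X: "norm X < 1" for X
  proof -
    have t0: "(\<lambda>m. \<gamma> m * X ^ m) sums G X"
      unfolding G_def by (rule summable_sums[OF s0[OF X]])
    have t1: "(\<lambda>m. diffs \<gamma> m * X ^ m) sums G1 X"
      unfolding G1_def by (rule summable_sums[OF s1[OF X]])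
    have t2: "(\<lambda>m. diffs (diffs \<gamma>) m * X ^ m) sums G2 X"
      unfolding G2_def by (rule summable_sums[OF s2[OF X]])
    note t3 = sums_times_index[OF t1]
    note t4 = sums_times_index[OF t2]
    have t5: "(\<lambda>m. of_nat m * (of_nat m - 1) * \<gamma> m * X ^ m) sums (X * (X * G2 X))"
    proof (rule sums_Suc_imp)
      show "(\<lambda>n. of_nat (Suc n) * (of_nat (Suc n) - 1) * \<gamma> (Suc n) * X ^ Suc n) sums (X * (X * G2 X))"
        using sums_mult[OF t4, of X] by (simp add: diffs_def mult_ac)
    qed simp
    let ?c = "of_nat (p + q + 1) :: complex"
    let ?f = "\<lambda>m. ?c * (diffs \<gamma> m * X ^ m) + of_nat m * diffs \<gamma> m * X ^ m
        - (?c * (of_nat m * \<gamma> m * X ^ m) + of_nat m * (of_nat m - 1) * \<gamma> m * X ^ m)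
        + ((\<alpha> + \<beta>) * (of_nat m * \<gamma> m * X ^ m) + (\<beta> * of_nat q + \<alpha> * of_nat p - \<alpha> * \<beta>) * (\<gamma> m * X ^ m))"
    have "?f
       sums (?c * G1 X + X * G2 X - (?c * (X * G1 X) + X * (X * G2 X))
        + ((\<alpha> + \<beta>) * (X * G1 X) + (\<beta> * of_nat q + \<alpha> * of_nat p - \<alpha> * \<beta>) * G X))"
      by (intro sums_add sums_diff sums_mult t0 t1 t2 t3 t4 t5)
    also have "?f
       = (\<lambda>m. 0)"
    proof
      fix m
      have "of_nat (p + m + 1) * of_nat (q + m + 1) = (of_nat m + 1) * (of_nat (p + q + m + 1) :: complex)"
        using pq0 by (simp add: algebra_simps)
      moreover have "(of_nat (p + m) - \<beta>) * (of_nat (q + m) - \<alpha>) =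
          of_nat m * of_nat m + of_nat m * (of_nat p + of_nat q - \<alpha> - \<beta>) - \<beta> * of_nat q - \<alpha> * of_nat p + \<alpha> * \<beta>"
        using pq0 by (simp add: algebra_simps)
      ultimately have rec: "(of_nat m + 1) * of_nat (p + q + m + 1) * \<gamma> (Suc m) =
         (of_nat m * of_nat m + of_nat m * (of_nat p + of_nat q - \<alpha> - \<beta>) - \<beta> * of_nat q - \<alpha> * of_nat p + \<alpha> * \<beta>) * \<gamma> m"
        using hg_coeff_Suc[of p m q \<alpha> \<beta>] unfolding \<gamma>_def by simp
      have "?f m
        = ((of_nat m + 1) * of_nat (p + q + m + 1) * \<gamma> (Suc m) -
         (of_nat m * of_nat m + of_nat m * (of_nat p + of_nat q - \<alpha> - \<beta>) - \<beta> * of_nat q - \<alpha> * of_nat p + \<alpha> * \<beta>) * \<gamma> m) * X ^ m"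
        by (simp add: diffs_def algebra_simps)
      then show "?f m = 0"
        unfolding rec by simp
    qed
    finally have "?c * G1 X + X * G2 X - (?c * (X * G1 X) + X * (X * G2 X))
        + ((\<alpha> + \<beta>) * (X * G1 X) + (\<beta> * of_nat q + \<alpha> * of_nat p - \<alpha> * \<beta>) * G X) = 0"
      using sums_unique2 sums_zero by blast
    then show ?thesis by (simp add: algebra_simps eq_neg_iff_add_eq_0)
  qed
  define h where "h = (\<lambda>r. of_real r ^ (p + q) * (of_nat q * G (of_real (r\<^sup>2)) + of_real (r\<^sup>2) * G1 (of_real (r\<^sup>2))))"
  have phi: "hg_radial \<alpha> \<beta> p q = (\<lambda>r. of_real r ^ (p + q) * G (of_real (r\<^sup>2)))"
    by (simp add: hg_radial_def G_def \<gamma>_def fun_eq_iff)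
  have r1: "norm (complex_of_real (r\<^sup>2)) < 1" if "0 \<le> r" "r < 1" for r
    using that by (simp add: power_less_one_iff norm_power)
  have cG: "continuous_on {0..<1} (\<lambda>r. G (of_real (r\<^sup>2)))" "continuous_on {0..<1} (\<lambda>r. G1 (of_real (r\<^sup>2)))"
  proof -
    have "continuous_on (ball 0 1) G" "continuous_on (ball 0 1) G1"
      by (auto intro!: continuous_at_imp_continuous_on DERIV_isCont[OF dG] DERIV_isCont[OF dG1])
    moreover have "continuous_on {0..<1} (\<lambda>r. complex_of_real (r\<^sup>2))" by (intro continuous_intros)
    moreover have "(\<lambda>r. complex_of_real (r\<^sup>2)) ` {0..<1} \<subseteq> ball 0 1"
      using r1 by (auto simp del: of_real_power)
    ultimately show "continuous_on {0..<1} (\<lambda>r. G (of_real (r\<^sup>2)))" "continuous_on {0..<1} (\<lambda>r. G1 (of_real (r\<^sup>2)))"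
      using continuous_on_compose2 by blast+
  qed
  have "radial_solution \<alpha> \<beta> (int p - int q) (hg_radial \<alpha> \<beta> p q) h"
    unfolding radial_solution_def
  proof (intro conjI ballI)
    show "continuous_on {0..<1} (hg_radial \<alpha> \<beta> p q)" "continuous_on {0..<1} h"
      unfolding phi h_def by (intro continuous_intros cG)+
    show "h 0 = 0" by (cases "q = 0") (auto simp: h_def)
  next
    fix r :: real assume "r \<in> {0<..<1}"
    then have r: "0 < r" "r < 1" "complex_of_real r \<noteq> 0" by auto
    define X where "X = complex_of_real (r\<^sup>2)"
    have X: "norm X < 1" unfolding X_def using r1 r by simp
    have X': "X = of_real r * of_real r" by (simp add: X_def power2_eq_square)
    have X1: "1 - X \<noteq> 0" using X by auto
    have sq: "((\<lambda>r. complex_of_real (r\<^sup>2)) has_vector_derivative 2 * of_real r) (at r)"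
      by (auto intro!: derivative_eq_intros simp: has_vector_derivative_def scaleR_conv_of_real fun_eq_iff)
    have g: "((\<lambda>r. G (of_real (r\<^sup>2))) has_vector_derivative 2 * of_real r * G1 X) (at r)"
      using field_vector_diff_chain_at[OF sq dG] X unfolding X_def by (simp add: o_def)
    have g1: "((\<lambda>r. G1 (of_real (r\<^sup>2))) has_vector_derivative 2 * of_real r * G2 X) (at r)"
      using field_vector_diff_chain_at[OF sq dG1] X unfolding X_def by (simp add: o_def)
    define P where "P = complex_of_real r ^ (p + q)"
    have "(of_real has_vector_derivative (1::complex)) (at r)"
      by (auto intro!: derivative_eq_intros simp: has_vector_derivative_def scaleR_conv_of_real)
    moreover have "((\<lambda>z::complex. z ^ (p + q)) has_field_derivative of_nat (p + q) * of_real r ^ (p + q - 1)) (at (of_real r))"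
      by (auto intro!: derivative_eq_intros)
    ultimately have "((\<lambda>z. z ^ (p + q)) \<circ> of_real has_vector_derivative 1 * (of_nat (p + q) * complex_of_real r ^ (p + q - 1))) (at r)"
      by (rule field_vector_diff_chain_at)
    then have "((\<lambda>r. complex_of_real r ^ (p + q)) has_vector_derivative of_nat (p + q) * of_real r ^ (p + q - 1)) (at r)"
      by (simp add: o_def)
    also have "of_nat (p + q) * of_real r ^ (p + q - 1) = of_nat (p + q) * P / of_real r"
      using r by (cases "p + q") (auto simp: P_def)
    finally have P: "((\<lambda>r. complex_of_real r ^ (p + q)) has_vector_derivative of_nat (p + q) * P / of_real r) (at r)" .
    have "(hg_radial \<alpha> \<beta> p q has_vector_derivative
       (P * (2 * of_real r * G1 X) + of_nat (p + q) * P / of_real r * G X)) (at r)"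
      unfolding phi using has_vector_derivative_mult[OF P g] by (simp add: P_def X_def)
    also have "P * (2 * of_real r * G1 X) + of_nat (p + q) * P / of_real r * G X
      = (of_int (int p - int q) * hg_radial \<alpha> \<beta> p q r + 2 * h r) / of_real r"
      unfolding phi h_def P_def[symmetric] X_def[symmetric] using r(3)
      by (simp add: divide_simps) (simp add: X' algebra_simps)
    finally show "(hg_radial \<alpha> \<beta> p q has_vector_derivative
      (of_int (int p - int q) * hg_radial \<alpha> \<beta> p q r + 2 * h r) / of_real r) (at r)" .
    have "(h has_vector_derivative
        P * (of_nat q * (2 * of_real r * G1 X) + (X * (2 * of_real r * G2 X) + 2 * of_real r * G1 X))
        + of_nat (p + q) * P / of_real r * (of_nat q * G X + X * G1 X)) (at r)"
      using has_vector_derivative_mult[OF P has_vector_derivative_add[OF has_vector_derivative_mult_right[OF g, of "of_nat q"] has_vector_derivative_mult[OF sq g1]]]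
      unfolding h_def P_def[symmetric] X_def[symmetric] by simp
    also have "P * (of_nat q * (2 * of_real r * G1 X) + (X * (2 * of_real r * G2 X) + 2 * of_real r * G1 X))
        + of_nat (p + q) * P / of_real r * (of_nat q * G X + X * G1 X)
        = P * (- ((of_nat p - of_nat q) * (of_nat q * G X + X * G1 X)) + 2 * X * (of_nat (p + q + 1) * G1 X + X * G2 X)
           + 2 * (of_nat p * of_nat q) * G X) / of_real r"
      using r(3) by (simp add: divide_simps) (simp add: X' algebra_simps)
    also have "\<dots> = P * (- ((of_nat p - of_nat q) * (of_nat q * G X + X * G1 X)) + 2 * X * (of_nat (p + q + 1) * G1 X + X * G2 X)) / of_real r"
      unfolding pq0 by simp
    also have "of_nat (p + q + 1) * G1 X + X * G2 X = - (((\<alpha> + \<beta>) * (of_nat q * G X + X * G1 X) + ((of_nat p - of_nat q) * \<alpha> - \<alpha> * \<beta>) * G X) / (1 - X))"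
      using ode[OF X] X1 by (simp add: divide_simps) (simp add: algebra_simps)
    also have "P * (- ((of_nat p - of_nat q) * (of_nat q * G X + X * G1 X)) + 2 * X *
        - (((\<alpha> + \<beta>) * (of_nat q * G X + X * G1 X) + ((of_nat p - of_nat q) * \<alpha> - \<alpha> * \<beta>) * G X) / (1 - X))) / of_real r
      = (- (of_int (int p - int q) * h r) - 2 * of_real (r\<^sup>2) / of_real (1 - r\<^sup>2) *
            ((\<alpha> + \<beta>) * h r + (of_int (int p - int q) * \<alpha> - \<alpha> * \<beta>) * hg_radial \<alpha> \<beta> p q r)) / of_real r"
    proof -
      have o: "complex_of_real (1 - r\<^sup>2) = 1 - X" by (simp add: X_def)
      show ?thesis
        unfolding o unfolding h_def phi P_def[symmetric] X_def[symmetric]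
        using X1 r(3) by (simp add: divide_simps) (simp add: algebra_simps)
    qed
    finally show "(h has_vector_derivative (- (of_int (int p - int q) * h r) - 2 * of_real (r\<^sup>2) / of_real (1 - r\<^sup>2) *
            ((\<alpha> + \<beta>) * h r + (of_int (int p - int q) * \<alpha> - \<alpha> * \<beta>) * hg_radial \<alpha> \<beta> p q r)) / of_real r) (at r)" .
  qed
  then show ?thesis by (rule that)
qed

section \<open>A lower bound for the hypergeometric solution\<close>

lemma rising_ratio_tendsto: "(\<lambda>p. rising_ratio b p m) \<longlonglongrightarrow> 1"
proof (induction m)
  case (Suc m)
  have "(\<lambda>p. (of_nat (p + m) - b) / of_nat (p + m + 1)) \<longlonglongrightarrow> (1 :: complex)"
  proof -
    have "(\<lambda>p. 1 - (b + 1) * inverse (of_nat (Suc (p + m)))) \<longlonglongrightarrow> 1 - (b + 1) * 0"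
      using LIMSEQ_ignore_initial_segment[OF lim_inverse_n[where 'a = complex], of "Suc m"]
      by (intro tendsto_intros) simp
    also have "(\<lambda>p. 1 - (b + 1) * inverse (of_nat (Suc (p + m)))) = (\<lambda>p. (of_nat (p + m) - b) / of_nat (p + m + 1))"
    proof
      fix p
      have "1 - (b + 1) * inverse x = (x - (b + 1)) / x" if "x \<noteq> 0" for x :: complex
        using that by (simp add: field_simps)
      moreover have "complex_of_nat (Suc (p + m)) \<noteq> 0" by (simp only: of_nat_eq_0_iff)
      moreover have "of_nat (p + m) - b = of_nat (Suc (p + m)) - (b + 1)" by simp
      ultimately show "1 - (b + 1) * inverse (of_nat (Suc (p + m))) = (of_nat (p + m) - b) / of_nat (p + m + 1)"
        by (metis Suc_eq_plus1)
    qed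
    finally show ?thesis by simp
  qed
  from tendsto_mult[OF Suc this] show ?case by (simp add: rising_ratio_Suc)
qed simp

text \<open>
  The binomial series of \<open>(1 - X)\<^sup>b\<close>.
\<close>

lemma rising_ratio_zero_sums:
  assumes "norm X < 1"
  shows "(\<lambda>m. rising_ratio b 0 m * X ^ m) sums ((1 - X) powr b)"
proof -
  have "(\<lambda>m. (b gchoose m) * (- X) ^ m) sums (1 + - X) powr b"
    by (rule gen_binomial_complex) (use assms in simp)
  also have "(\<lambda>m. (b gchoose m) * (- X) ^ m) = (\<lambda>m. rising_ratio b 0 m * X ^ m)"
  proof
    fix m
    have "(- 1) ^ m * (- X) ^ m = X ^ m" by (simp flip: power_mult_distrib)
    then show "(b gchoose m) * (- X) ^ m = rising_ratio b 0 m * X ^ m"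
      by (simp add: gbinomial_pochhammer mult.commute mult.left_commute rising_ratio_def pochhammer_fact)
  qed
  finally show ?thesis by simp
qed

text \<open>
  The factors \<open>rising_ratio b p m\<close> tend to \<open>1\<close> as \<open>p\<close> grows. By Tannery's theorem the series then tends
  to a binomial series, whose sum at \<open>X = r0\<^sup>2\<close> is a power of \<open>1 - X\<close> and thus nonzero. So \<open>s = r0\<close>
  works for all large \<open>p\<close>. For each remaining \<open>p\<close> the series is \<open>1\<close> at \<open>0\<close>, so that a small \<open>s\<close> gives a
  nonzero value, and only finitely many constants have to be compared. The radius must be allowed
  to depend on \<open>p\<close>, since the hypergeometric function may vanish at \<open>r0\<^sup>2\<close>.
\<close>

lemma hg_radial_lower_bound_aux:
  assumes r0: "0 < r0" "r0 < 1"
    and coeff: "\<And>p m. c p m = rising_ratio b p m * rising_ratio a 0 m"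
    and maj: "\<And>p m. norm (c p m) \<le> M m" "summable (\<lambda>m. M m * (r0\<^sup>2) ^ m)"
  shows "\<exists>\<delta>>0. \<forall>p. \<exists>s. 0 < s \<and> s \<le> r0 \<and>
           \<delta> * r0 ^ p \<le> norm (of_real s ^ p * (\<Sum>m. c p m * of_real (s\<^sup>2) ^ m))"
proof -
  define F where "F = (\<lambda>p X. \<Sum>m. c p m * X ^ m :: complex)"
  define X where "X = complex_of_real (r0\<^sup>2)"
  have nX: "norm X = r0\<^sup>2" by (simp add: X_def norm_power)
  have X: "norm X < 1" unfolding nX using r0 by (simp add: power_less_one_iff)
  have "(\<lambda>p. F p X) \<longlonglongrightarrow> (\<Sum>m. rising_ratio a 0 m * X ^ m)"
  proof -
    have "(\<lambda>p. c p m * X ^ m) \<longlonglongrightarrow> rising_ratio a 0 m * X ^ m" for m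
      using tendsto_mult[OF rising_ratio_tendsto[of b m] tendsto_const[of "rising_ratio a 0 m * X ^ m"]]
      by (simp add: coeff mult.assoc)
    moreover have "\<forall>\<^sub>F (m, p) in at_top \<times>\<^sub>F sequentially. norm (c p m * X ^ m) \<le> M m * (r0\<^sup>2) ^ m"
      by (intro always_eventually) (auto simp: norm_mult norm_power nX intro!: mult_right_mono maj)
    ultimately show ?thesis
      unfolding F_def using tannerys_theorem[where F = sequentially and a = "\<lambda>m p. c p m * X ^ m" and b = "\<lambda>m. rising_ratio a 0 m * X ^ m", OF _ _ maj(2)]
      by simp
  qed
  then have "(\<lambda>p. norm (F p X)) \<longlonglongrightarrow> norm ((1 - X) powr a)"
    unfolding sums_unique[OF rising_ratio_zero_sums[OF X], symmetric] by (rule tendsto_norm)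
  moreover have "norm ((1 - X) powr a) > 0" using X by auto
  ultimately have "\<forall>\<^sub>F p in sequentially. norm (F p X) > norm ((1 - X) powr a) / 2"
    by (intro order_tendstoD(1)) auto
  then obtain N where N: "\<And>p. p \<ge> N \<Longrightarrow> norm (F p X) > norm ((1 - X) powr a) / 2"
    unfolding eventually_sequentially by blast
  define P where "P = (\<lambda>\<delta> p. \<exists>s. 0 < s \<and> s \<le> r0 \<and> \<delta> * r0 ^ p \<le> norm (of_real s ^ p * F p (of_real (s\<^sup>2))))"
  have P_mono: "P \<delta>' p" if "P \<delta> p" "\<delta>' \<le> \<delta>" for \<delta> \<delta>' p
    using that r0 unfolding P_def by (meson mult_right_mono order_trans zero_le_power less_imp_le)
  have P_ex: "\<exists>\<delta>>0. P \<delta> p" for p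
  proof -
    have sm: "summable (\<lambda>m. c p m * X ^ m)"
      by (rule summable_comparison_test'[OF maj(2)]) (auto simp: norm_mult norm_power nX intro!: mult_right_mono maj)
    have "isCont (F p) 0"
      unfolding F_def by (rule isCont_powser[OF sm]) (use r0 in \<open>simp add: nX\<close>)
    moreover have "F p 0 = 1" unfolding F_def by (simp add: powser_zero coeff)
    ultimately have "(F p \<longlongrightarrow> 1) (nhds 0)" unfolding continuous_at tendsto_at_iff_tendsto_nhds by simp
    moreover have "((\<lambda>s. complex_of_real (s\<^sup>2)) \<longlongrightarrow> 0) (at_right 0)"
      by (auto intro!: tendsto_eq_intros)
    ultimately have "((\<lambda>s. F p (complex_of_real (s\<^sup>2))) \<longlongrightarrow> 1) (at_right 0)"
      by (rule filterlim_compose)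
    then have "\<forall>\<^sub>F s in at_right 0. F p (complex_of_real (s\<^sup>2)) \<noteq> 0"
      by (rule tendsto_imp_eventually_ne) simp
    moreover have "\<forall>\<^sub>F s in at_right 0. s \<in> {0<..<r0}"
      using r0(1) by (rule eventually_at_right_real)
    ultimately have "\<forall>\<^sub>F s in at_right 0. s \<in> {0<..<r0} \<and> F p (complex_of_real (s\<^sup>2)) \<noteq> 0"
      by eventually_elim auto
    then obtain s where s: "s \<in> {0<..<r0}" "F p (complex_of_real (s\<^sup>2)) \<noteq> 0"
      using eventually_happens[of _ "at_right (0::real)"] by auto
    define \<delta> where "\<delta> = norm (of_real s ^ p * F p (of_real (s\<^sup>2))) / r0 ^ p"
    have "\<delta> > 0" using s r0 by (auto simp: \<delta>_def)
    moreover have "P \<delta> p" unfolding P_def using s r0 by (intro exI[of _ s]) (auto simp: \<delta>_def)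
    ultimately show ?thesis by blast
  qed
  have "\<exists>\<delta>>0. \<forall>p<n. P \<delta> p" for n
  proof (induction n)
    case 0 show ?case by (intro exI[of _ 1]) auto
  next
    case (Suc n)
    then obtain d where "d > 0" "\<forall>p<n. P d p" by blast
    moreover obtain d' where "d' > 0" "P d' n" using P_ex by blast
    ultimately show ?case
      by (intro exI[of _ "min d d'"]) (auto simp: less_Suc_eq intro: P_mono)
  qed
  then obtain d where d: "d > 0" "\<And>p. p < N \<Longrightarrow> P d p" by blast
  define \<delta> where "\<delta> = min d (norm ((1 - X) powr a) / 2)"
  have "P \<delta> p" for p
  proof (cases "p < N")
    case True then show ?thesis using d P_mono[of d p \<delta>] by (auto simp: \<delta>_def)
  next
    case False
    have "\<delta> * r0 ^ p \<le> norm (F p X) * r0 ^ p"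
      using N[of p] False r0 by (intro mult_right_mono) (auto simp: \<delta>_def)
    then show ?thesis unfolding P_def using r0
      by (intro exI[of _ r0]) (auto simp: X_def norm_mult norm_power mult.commute)
  qed
  moreover have "\<delta> > 0" using d \<open>norm ((1 - X) powr a) > 0\<close> by (auto simp: \<delta>_def)
  ultimately show ?thesis unfolding P_def F_def by blast
qed

lemma hg_radial_lower_bound:
  assumes r0: "0 < r0" "r0 < 1"
  shows "\<exists>\<delta>>0. \<forall>p q. p * q = 0 \<longrightarrow> (\<exists>s. 0 < s \<and> s \<le> r0 \<and> \<delta> * r0 ^ (p + q) \<le> norm (hg_radial \<alpha> \<beta> p q s))"
proof -
  have r2: "0 \<le> r0\<^sup>2" "r0\<^sup>2 < 1" using r0 by (auto simp: power_less_one_iff)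
  obtain d1 where d1: "d1 > 0" "\<forall>p. \<exists>s. 0 < s \<and> s \<le> r0 \<and>
           d1 * r0 ^ p \<le> norm (of_real s ^ p * (\<Sum>m. hg_coeff \<alpha> \<beta> p 0 m * of_real (s\<^sup>2) ^ m))"
    using hg_radial_lower_bound_aux[where c = "\<lambda>p. hg_coeff \<alpha> \<beta> p 0" and b = \<beta> and a = \<alpha>, OF r0 _ norm_hg_coeff_le summable_hg_majorant[OF r2]]
    by (auto simp: hg_coeff_def)
  obtain d2 where d2: "d2 > 0" "\<forall>p. \<exists>s. 0 < s \<and> s \<le> r0 \<and>
           d2 * r0 ^ p \<le> norm (of_real s ^ p * (\<Sum>m. hg_coeff \<alpha> \<beta> 0 p m * of_real (s\<^sup>2) ^ m))"
    using hg_radial_lower_bound_aux[where c = "\<lambda>p. hg_coeff \<alpha> \<beta> 0 p" and b = \<alpha> and a = \<beta>, OF r0 _ norm_hg_coeff_le summable_hg_majorant[OF r2]]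
    by (auto simp: hg_coeff_def mult.commute)
  show ?thesis
  proof (rule exI[of _ "min d1 d2"], intro conjI allI impI)
    show "min d1 d2 > 0" using d1 d2 by simp
    fix p q :: nat assume pq: "p * q = 0"
    have le: "min d1 d2 * r0 ^ k \<le> d1 * r0 ^ k" "min d1 d2 * r0 ^ k \<le> d2 * r0 ^ k" for k
      using r0 by (auto intro!: mult_right_mono)
    from pq consider "q = 0" | "p = 0" by auto
    then show "\<exists>s>0. s \<le> r0 \<and> min d1 d2 * r0 ^ (p + q) \<le> norm (hg_radial \<alpha> \<beta> p q s)"
    proof cases
      case 1 then show ?thesis using d1(2)[rule_format, of p] le(1)[of p] unfolding hg_radial_def
        by (auto intro: order_trans)
    next
      case 2 then show ?thesis using d2(2)[rule_format, of q] le(2)[of q] unfolding hg_radial_def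
        by (auto intro: order_trans)
    qed
  qed
qed

section \<open>The expansion in one variable\<close>

text \<open>
  Uniformly convergent series may be integrated term by term over a circle.
\<close>

lemma circle_coeff_has_sum:
  assumes cont: "\<And>i. i \<in> I \<Longrightarrow> continuous_on (sphere 0 \<bar>r\<bar>) (g i)"
    and bound: "\<And>i z. i \<in> I \<Longrightarrow> norm z = \<bar>r\<bar> \<Longrightarrow> norm (g i z) \<le> M i"
    and sum: "M summable_on I"
    and v: "\<And>z. norm z = \<bar>r\<bar> \<Longrightarrow> ((\<lambda>i. g i z) has_sum v z) I"
  shows "continuous_on (sphere 0 \<bar>r\<bar>) v"
    and "((\<lambda>i. circle_coeff k (g i) r) has_sum circle_coeff k v r) I"
proof -
  let ?F = "finite_subsets_at_top I"
  have cs: "continuous_on (sphere 0 \<bar>r\<bar>) (\<lambda>z. \<Sum>i\<in>A. g i z)" if "A \<subseteq> I" for A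
    using that by (intro continuous_on_sum cont) auto
  have ev: "\<forall>\<^sub>F A in ?F. A \<subseteq> I" "\<forall>\<^sub>F A in ?F. finite A"
    by (auto simp: eventually_finite_subsets_at_top)
  have ul: "uniform_limit (sphere 0 \<bar>r\<bar>) (\<lambda>A z. \<Sum>i\<in>A. g i z) v ?F"
    by (rule Weierstrass_m_test_general'[OF _ _ sum]) (auto intro: bound v)
  show cv: "continuous_on (sphere 0 \<bar>r\<bar>) v"
    by (rule uniform_limit_theorem[OF _ ul]) (use ev(1) in \<open>auto elim!: eventually_mono intro: cs\<close>)
  have circ_sum: "circle_coeff k (\<lambda>z. \<Sum>i\<in>A. g i z) r = (\<Sum>i\<in>A. circle_coeff k (g i) r)"
    if "finite A" "A \<subseteq> I" for A
    using that
  proof (induction A rule: finite_induct)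
    case empty then show ?case by (simp add: circle_coeff_def)
  next
    case (insert i A)
    then show ?case by (simp add: circle_coeff_add cont cs)
  qed
  have "((\<lambda>A. circle_coeff k (\<lambda>z. \<Sum>i\<in>A. g i z) r) \<longlongrightarrow> circle_coeff k v r) ?F"
  proof (rule tendstoI)
    fix e :: real assume e: "e > 0"
    have "\<forall>\<^sub>F A in ?F. \<forall>z\<in>sphere 0 \<bar>r\<bar>. dist (\<Sum>i\<in>A. g i z) (v z) < e / 2"
      by (rule uniform_limitD[OF ul]) (use e in simp)
    then show "\<forall>\<^sub>F A in ?F. dist (circle_coeff k (\<lambda>z. \<Sum>i\<in>A. g i z) r) (circle_coeff k v r) < e"
      using ev(1)
    proof eventually_elim
      case (elim A)
      have "norm (circle_coeff k (\<lambda>z. (\<Sum>i\<in>A. g i z) - v z) r) \<le> e / 2"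
        by (rule norm_circle_coeff_le[OF continuous_on_diff[OF cs[OF elim(2)] cv]])
           (use elim(1) in \<open>auto intro: less_imp_le simp: dist_norm\<close>)
      then show ?case using e by (simp add: circle_coeff_diff cs cv elim dist_norm)
    qed
  qed
  moreover have "\<forall>\<^sub>F A in ?F. circle_coeff k (\<lambda>z. \<Sum>i\<in>A. g i z) r = (\<Sum>i\<in>A. circle_coeff k (g i) r)"
    using ev by eventually_elim (rule circ_sum)
  ultimately show "((\<lambda>i. circle_coeff k (g i) r) has_sum circle_coeff k v r) I"
    unfolding has_sum_def by (simp cong: tendsto_cong)
qed

lemma circle_coeff_monomial:
  "circle_coeff k (\<lambda>z. z ^ a * cnj z ^ b) r = (if k = int a - int b then of_real r ^ (a + b) else 0)"
proof -
  have one: "circle_coeff k (\<lambda>_. 1) r = (if k = 0 then 1 else 0)" for k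
  proof (cases "k = 0")
    case True then show ?thesis by (simp add: circle_coeff_def scaleR_conv_of_real)
  next
    case False
    have "((\<lambda>t. cis (- (of_int k * t))) has_integral
       (\<i> / of_int k * cis (- (of_int k * (2 * pi))) - \<i> / of_int k * cis (- (of_int k * 0)))) {0..2*pi}"
    proof (rule fundamental_theorem_of_calculus)
      fix t :: real
      have "((\<lambda>x. \<i> / of_int k * cis (- (of_int k * x))) has_vector_derivative cis (- (of_int k * t))) (at t)"
        using False by (auto intro!: derivative_eq_intros simp: has_vector_derivative_def scaleR_conv_of_real field_simps)
      then show "((\<lambda>x. \<i> / of_int k * cis (- (of_int k * x))) has_vector_derivative cis (- (of_int k * t))) (at t within {0..2*pi})"
        by (rule has_vector_derivative_at_within)
    qed simp
    moreover have "cis (- (of_int k * (2*pi))) = 1"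
      using cis_multiple_2pi[of "- of_int k"] by (simp add: mult_ac)
    ultimately have "integral {0..2*pi} (\<lambda>t. cis (- (of_int k * t))) = 0" by (auto dest: integral_unique)
    then show ?thesis using False by (simp add: circle_coeff_def)
  qed
  have pw: "circle_coeff k (\<lambda>z. cnj z ^ b) r = (if k = - int b then of_real r ^ b else 0)" for k
  proof (induction b arbitrary: k)
    case (Suc b)
    show ?case using circle_coeff_shift(2)[of k "\<lambda>z. cnj z ^ b" r] by (auto simp: Suc)
  qed (simp add: one)
  show ?thesis
  proof (induction a arbitrary: k)
    case (Suc a)
    show ?case using circle_coeff_shift(1)[of k "\<lambda>z. z ^ a * cnj z ^ b" r] by (auto simp: Suc mult.assoc)
  qed (simp add: pw)
qed

lemma summable_on_geometric_pairs:
  fixes t :: real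
  assumes "0 \<le> t" "t < 1"
  shows "(\<lambda>(a, b). t ^ (a + b)) summable_on (UNIV :: (nat \<times> nat) set)"
proof -
  have "summable (\<lambda>n. t ^ n)" using assms by simp
  then have g: "(\<lambda>n. t ^ n) summable_on UNIV"
    using assms by (subst summable_on_UNIV_nonneg_real_iff) auto
  have "(\<lambda>(a, b). t ^ a * t ^ b) summable_on UNIV \<times> UNIV"
  proof (rule summable_on_SigmaI)
    fix a :: nat
    show "((\<lambda>b. case (a, b) of (a, b) \<Rightarrow> t ^ a * t ^ b) has_sum t ^ a * (\<Sum>\<^sub>\<infinity>b. t ^ b)) UNIV"
      using has_sum_cmult_right[OF has_sum_infsum[OF g], of "t ^ a"] by simp
  qed (use summable_on_cmult_left[OF g] assms in auto)
  then show ?thesis by (simp add: power_add split_def)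
qed

text \<open>
  The functions \<open>f1\<close>, \<open>f2\<close> are the Wirtinger derivatives of \<open>f\<close>, and \<open>f3\<close>, \<open>f4\<close> those of \<open>f2\<close>. In this
  form the condition is checked at once for the restriction of a function of several variables to
  one of them.
\<close>

definition disc_harmonic :: "complex \<Rightarrow> complex \<Rightarrow> (complex \<Rightarrow> complex) \<Rightarrow> bool" where
  "disc_harmonic \<alpha> \<beta> f \<longleftrightarrow> (\<exists>f1 f2 f3 f4.
     (\<forall>z. norm z < 1 \<longrightarrow> (f has_derivative (\<lambda>h. f1 z * h + f2 z * cnj h)) (at z)) \<and>
     (\<forall>z. norm z < 1 \<longrightarrow> (f2 has_derivative (\<lambda>h. f3 z * h + f4 z * cnj h)) (at z)) \<and>
     continuous_on (ball 0 1) f1 \<and> continuous_on (ball 0 1) f3 \<and> continuous_on (ball 0 1) f4 \<and>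
     (\<forall>z. norm z < 1 \<longrightarrow>
        (1 - of_real ((norm z)\<^sup>2)) * f3 z + \<alpha> * z * f1 z + \<beta> * cnj z * f2 z - \<alpha> * \<beta> * f z = 0))"

text \<open>
  The term with exponents \<open>a = p + m\<close>, \<open>b = q + m\<close>, where \<open>m\<close> is their minimum, belongs to the Fourier
  mode \<open>k = a - b\<close>. Its coefficient is \<open>hg_coeff \<alpha> \<beta> p q m\<close> times the quotient of the \<open>k\<close>-th
  coefficients of \<open>f\<close> and of the hypergeometric solution at the radius \<open>s a b\<close>. The bound on \<open>\<kappa>\<close> makes
  the double series converge for \<open>|z| < r0\<close>; on each circle its Fourier coefficients are those of
  \<open>f\<close>, hence it equals \<open>f\<close>. Neither \<open>\<kappa>\<close> nor \<open>s\<close> depends on \<open>f\<close>, which is what permits iterating over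
  the coordinates.
\<close>

lemma one_variable_expansion:
  fixes \<alpha> \<beta> :: complex
  assumes r0: "0 < r0" "r0 < 1"
  obtains \<kappa> :: "nat \<Rightarrow> nat \<Rightarrow> complex" and s :: "nat \<Rightarrow> nat \<Rightarrow> real" and C :: real where
    "\<And>a b. 0 < s a b \<and> s a b \<le> r0"
    "\<And>a b. norm (\<kappa> a b) \<le> C / r0 ^ (a + b)"
    "\<And>a b. s (Suc a) (Suc b) = s a b"
    "\<And>a b. of_nat (Suc a) * of_nat (Suc b) * \<kappa> (Suc a) (Suc b) = (of_nat a - \<beta>) * (of_nat b - \<alpha>) * \<kappa> a b"
    "\<And>f z. disc_harmonic \<alpha> \<beta> f \<Longrightarrow> norm z < r0 \<Longrightarrow>
       ((\<lambda>(a, b). \<kappa> a b * circle_coeff (int a - int b) f (s a b) * (z ^ a * cnj z ^ b)) has_sum f z) UNIV"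
proof -
  obtain \<delta> where \<delta>: "\<delta> > 0" and ex: "\<And>p q. p * q = 0 \<Longrightarrow>
      \<exists>s. 0 < s \<and> s \<le> r0 \<and> \<delta> * r0 ^ (p + q) \<le> norm (hg_radial \<alpha> \<beta> p q s)"
    using hg_radial_lower_bound[OF r0, of \<alpha> \<beta>] by blast
  define \<sigma> where "\<sigma> = (\<lambda>p q. SOME s. 0 < s \<and> s \<le> r0 \<and> \<delta> * r0 ^ (p + q) \<le> norm (hg_radial \<alpha> \<beta> p q s))"
  have \<sigma>: "0 < \<sigma> p q" "\<sigma> p q \<le> r0" "\<delta> * r0 ^ (p + q) \<le> norm (hg_radial \<alpha> \<beta> p q (\<sigma> p q))" if "p * q = 0" for p q
    using someI_ex[OF ex[OF that]] unfolding \<sigma>_def by blast+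
  have pq0: "(a - min a b) * (b - min a b) = 0" for a b :: nat by (cases "a \<le> b") auto
  define s where "s = (\<lambda>a b. \<sigma> (a - min a b) (b - min a b))"
  define \<kappa> where "\<kappa> = (\<lambda>a b. hg_coeff \<alpha> \<beta> (a - min a b) (b - min a b) (min a b) /
      hg_radial \<alpha> \<beta> (a - min a b) (b - min a b) (s a b))"
  have r2: "0 \<le> r0\<^sup>2" "r0\<^sup>2 < 1" using r0 by (auto simp: power_less_one_iff)
  have "bounded (range (\<lambda>m. hg_majorant \<alpha> \<beta> m * (r0\<^sup>2) ^ m))"
    by (intro convergent_imp_bounded) (use summable_hg_majorant[OF r2] in \<open>blast dest: summable_LIMSEQ_zero\<close>)
  then obtain C where C: "\<And>m. norm (hg_majorant \<alpha> \<beta> m * (r0\<^sup>2) ^ m) \<le> C" unfolding bounded_iff by auto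
  have C0: "C \<ge> 0" using C[of 0] norm_ge_zero order_trans by blast
  have s: "0 < s a b" "s a b \<le> r0" "\<delta> * r0 ^ (a - min a b + (b - min a b)) \<le> norm (hg_radial \<alpha> \<beta> (a - min a b) (b - min a b) (s a b))" for a b
    unfolding s_def using \<sigma>[OF pq0] by auto
  have \<kappa>_bound: "norm (\<kappa> a b) \<le> (C / \<delta>) / r0 ^ (a + b)" for a b
  proof -
    define m where "m = min a b"
    have e: "a + b = 2 * m + (a - m + (b - m))" unfolding m_def by (cases "a \<le> b") auto
    have "hg_majorant \<alpha> \<beta> m * r0 ^ (2 * m) \<le> C"
      using C[of m] by (simp add: power_mult)
    then have "norm (hg_coeff \<alpha> \<beta> (a - m) (b - m) m) * r0 ^ (2 * m) \<le> C"
      using norm_hg_coeff_le[of \<alpha> \<beta> "a - m" "b - m" m] r0 by (meson mult_right_mono order_trans zero_le_power less_imp_le)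
    then have "norm (hg_coeff \<alpha> \<beta> (a - m) (b - m) m) \<le> C / r0 ^ (2 * m)" using r0 by (simp add: field_simps)
    moreover have "\<delta> * r0 ^ (a - m + (b - m)) \<le> norm (hg_radial \<alpha> \<beta> (a - m) (b - m) (s a b))"
      using s(3)[of a b] by (simp add: m_def)
    ultimately have "norm (\<kappa> a b) \<le> (C / r0 ^ (2 * m)) / (\<delta> * r0 ^ (a - m + (b - m)))"
      unfolding \<kappa>_def m_def[symmetric] norm_divide using \<delta> r0 C0 by (intro frac_le) auto
    also have "\<dots> = (C / \<delta>) / r0 ^ (a + b)"
      unfolding e power_add by (simp add: field_simps)
    finally show ?thesis .
  qed
  have s_Suc: "s (Suc a) (Suc b) = s a b" for a b by (simp add: s_def)
  have \<kappa>_Suc: "of_nat (Suc a) * of_nat (Suc b) * \<kappa> (Suc a) (Suc b) = (of_nat a - \<beta>) * (of_nat b - \<alpha>) * \<kappa> a b" for a b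
  proof -
    define m where "m = min a b"
    have e: "a - m + m = a" "b - m + m = b" by (auto simp: m_def)
    have 1: "\<kappa> (Suc a) (Suc b) = hg_coeff \<alpha> \<beta> (a - m) (b - m) (Suc m) / hg_radial \<alpha> \<beta> (a - m) (b - m) (s a b)"
      by (simp add: \<kappa>_def m_def s_Suc)
    have 2: "\<kappa> a b = hg_coeff \<alpha> \<beta> (a - m) (b - m) m / hg_radial \<alpha> \<beta> (a - m) (b - m) (s a b)"
      by (simp add: \<kappa>_def m_def)
    show ?thesis
      unfolding 1 2 using hg_coeff_Suc[of "a - m" m "b - m" \<alpha> \<beta>] unfolding e by (simp add: e)
  qed
  show ?thesis
  proof (rule that[of s \<kappa> "C / \<delta>"])
    fix f :: "complex \<Rightarrow> complex" and z :: complex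
    assume f: "disc_harmonic \<alpha> \<beta> f" and z: "norm z < r0"
    from f obtain f1 f2 f3 f4 where
          d1: "\<forall>z. norm z < 1 \<longrightarrow> (f has_derivative (\<lambda>h. f1 z * h + f2 z * cnj h)) (at z)"
      and d2: "\<forall>z. norm z < 1 \<longrightarrow> (f2 has_derivative (\<lambda>h. f3 z * h + f4 z * cnj h)) (at z)"
      and cont: "continuous_on (ball 0 1) f1" "continuous_on (ball 0 1) f3" "continuous_on (ball 0 1) f4"
      and eq: "\<forall>z. norm z < 1 \<longrightarrow>
         (1 - of_real ((norm z)\<^sup>2)) * f3 z + \<alpha> * z * f1 z + \<beta> * cnj z * f2 z - \<alpha> * \<beta> * f z = 0"
      unfolding disc_harmonic_def by (elim exE conjE) (rule that, assumption+)
    note D1 = d1[rule_format] and D2 = d2[rule_format] and pde = eq[rule_format]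
    have cf: "continuous_on (ball 0 1) f"
      using wirtinger_continuous[OF D1 cont(1) wirtinger_continuous[OF D2 cont(2,3)]] .
    have "bounded (f ` cball 0 r0)"
      by (intro compact_imp_bounded compact_continuous_image continuous_on_subset[OF cf]) (use r0 in auto)
    then obtain B where B: "B > 0" "\<And>z. norm z \<le> r0 \<Longrightarrow> norm (f z) \<le> B"
      unfolding bounded_pos by auto
    define r where "r = norm z"
    have r: "0 \<le> r" "r < r0" "\<bar>r\<bar> = r" "r < 1" using z r0 by (auto simp: r_def)
    have c_le: "norm (circle_coeff k f (s a b)) \<le> B" for k a b
      by (rule norm_circle_coeff_le)
         (use s[of a b] r0 in \<open>auto intro!: B continuous_on_subset[OF cf]\<close>)
    define g where "g = (\<lambda>(a, b) z. \<kappa> a b * circle_coeff (int a - int b) f (s a b) * (z ^ a * cnj z ^ b))"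
    define M where "M = (\<lambda>(a, b). (C / \<delta> * B) * (r / r0) ^ (a + b) :: real)"
    have gM: "norm (g i w) \<le> M i" if "norm w = \<bar>r\<bar>" for i w
    proof (cases i)
      case (Pair a b)
      have "norm (g i w) = norm (\<kappa> a b) * norm (circle_coeff (int a - int b) f (s a b)) * r ^ (a + b)"
        using that r by (simp add: g_def Pair norm_mult norm_power power_add)
      also have "\<dots> \<le> ((C / \<delta>) / r0 ^ (a + b)) * B * r ^ (a + b)"
        by (intro mult_right_mono mult_mono \<kappa>_bound c_le) (use r r0 C0 \<delta> in auto)
      also have "\<dots> = M i" by (simp add: M_def Pair power_divide)
      finally show ?thesis .
    qed
    have "(\<lambda>i. (C / \<delta> * B) * (case i of (a, b) \<Rightarrow> (r / r0) ^ (a + b))) summable_on UNIV"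
      by (intro summable_on_cmult_right summable_on_geometric_pairs) (use r r0 in auto)
    then have Ms: "M summable_on UNIV" by (simp add: M_def split_def)
    define v where "v = (\<lambda>z. \<Sum>\<^sub>\<infinity>i. g i z)"
    have v: "((\<lambda>i. g i w) has_sum v w) UNIV" if "norm w = \<bar>r\<bar>" for w
      unfolding v_def
      by (rule has_sum_infsum, rule abs_summable_summable, rule Infinite_Sum.abs_summable_on_comparison_test'[OF Ms])
         (rule gM[OF that])
    have cg: "continuous_on A (g i)" for A i
      unfolding g_def split_def by (intro continuous_intros)
    note V = circle_coeff_has_sum[of UNIV r g M v, OF cg gM Ms v]
    have "f z - v z = 0"
    proof (rule circle_coeffs_zero_imp_zero[where r = r and h = "\<lambda>z. f z - v z"])
      have cfr: "continuous_on (sphere 0 \<bar>r\<bar>) f"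
        by (rule continuous_on_subset[OF cf]) (use r in auto)
      show "continuous_on (sphere 0 \<bar>r\<bar>) (\<lambda>z. f z - v z)"
        using V(1) cfr by (intro continuous_intros) auto
      show "norm z = \<bar>r\<bar>" by (simp add: r_def)
      fix k
      \<comment> \<open>the pair with \<open>p q = 0\<close> that belongs to the Fourier mode \<open>k\<close>\<close>
      define p q where "p = nat k" and "q = nat (- k)"
      have pq: "p * q = 0" "int p - int q = k" by (auto simp: p_def q_def)
      obtain h where h: "radial_solution \<alpha> \<beta> k (hg_radial \<alpha> \<beta> p q) h"
        using hg_coeff_radial_solution[OF pq(1), of \<alpha> \<beta>] unfolding pq(2) by blast
      have proportional: "circle_coeff k f r * hg_radial \<alpha> \<beta> p q (\<sigma> p q) = circle_coeff k f (\<sigma> p q) * hg_radial \<alpha> \<beta> p q r"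
        by (rule radial_solution_proportional[OF circle_coeff_radial_solution[OF D1 D2 cont pde] h])
           (use r r0 \<sigma>[OF pq(1)] in auto)
      have nz: "hg_radial \<alpha> \<beta> p q (\<sigma> p q) \<noteq> 0"
        using \<sigma>(3)[OF pq(1)] \<delta> r0 by (metis linorder_not_le mult_pos_pos norm_zero zero_less_power)
      have terms: "circle_coeff k (g (a, b)) r =
          (if k = int a - int b then \<kappa> a b * circle_coeff k f (s a b) * of_real r ^ (a + b) else 0)" for a b
        unfolding g_def prod.case circle_coeff_cmult circle_coeff_monomial by simp
      let ?X = "complex_of_real (r\<^sup>2)"
      let ?t = "\<lambda>m. hg_coeff \<alpha> \<beta> p q m * ?X ^ m"
      have X: "norm ?X < 1" using r by (simp add: norm_power power_less_one_iff)
      note hs = hg_coeff_has_sum[OF X, of \<alpha> \<beta> p q]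
      define c where "c = circle_coeff k f (\<sigma> p q) / hg_radial \<alpha> \<beta> p q (\<sigma> p q)"
      have "((\<lambda>m. c * of_real r ^ (p + q) * (hg_coeff \<alpha> \<beta> p q m * ?X ^ m)) has_sum
           c * of_real r ^ (p + q) * (\<Sum>m. hg_coeff \<alpha> \<beta> p q m * ?X ^ m)) UNIV"
        by (intro has_sum_cmult_right hs)
      also have "c * of_real r ^ (p + q) * (\<Sum>m. hg_coeff \<alpha> \<beta> p q m * ?X ^ m) = c * hg_radial \<alpha> \<beta> p q r"
        by (simp add: hg_radial_def)
      also have "\<dots> = circle_coeff k f r"
        using proportional nz by (simp add: c_def field_simps)
      also have "(\<lambda>m. c * of_real r ^ (p + q) * (hg_coeff \<alpha> \<beta> p q m * ?X ^ m)) =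
         (\<lambda>m. circle_coeff k (g (p + m, q + m)) r)"
      proof
        fix m
        have mn: "min (p + m) (q + m) = m" using pq(1) by auto
        have "\<kappa> (p + m) (q + m) = hg_coeff \<alpha> \<beta> p q m / hg_radial \<alpha> \<beta> p q (\<sigma> p q)" "s (p + m) (q + m) = \<sigma> p q"
          unfolding \<kappa>_def s_def mn by auto
        moreover have "of_real r ^ (p + m + (q + m)) = complex_of_real r ^ (p + q) * ?X ^ m"
          by (simp add: power_add power2_eq_square power_mult_distrib mult_ac)
        ultimately show "c * of_real r ^ (p + q) * (hg_coeff \<alpha> \<beta> p q m * ?X ^ m) = circle_coeff k (g (p + m, q + m)) r"
          unfolding terms using pq(2) by (simp add: c_def)
      qed
      finally have "((\<lambda>m. circle_coeff k (g (p + m, q + m)) r) has_sum circle_coeff k f r) UNIV" .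
      then have "((\<lambda>i. circle_coeff k (g i) r) has_sum circle_coeff k f r) (range (\<lambda>m. (p + m, q + m)))"
        by (subst has_sum_reindex) (auto simp: inj_on_def o_def)
      then have "((\<lambda>i. circle_coeff k (g i) r) has_sum circle_coeff k f r) UNIV"
      proof (rule has_sum_cong_neutral[THEN iffD1, rotated -1])
        fix i assume i: "i \<in> UNIV - range (\<lambda>m. (p + m, q + m))"
        show "circle_coeff k (g i) r = 0"
        proof (cases i)
          case (Pair a b)
          have "k \<noteq> int a - int b"
          proof
            assume "k = int a - int b"
            then have "(a, b) = (p + min a b, q + min a b)" unfolding p_def q_def by auto
            then show False using i Pair by blast
          qed
          then show ?thesis unfolding Pair terms by simp
        qed
      qed auto
      with V(2) have "circle_coeff k v r = circle_coeff k f r" by (rule has_sum_unique)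
      then show "circle_coeff k (\<lambda>z. f z - v z) r = 0"
        using V(1) cfr by (simp add: circle_coeff_diff)
    qed
    then show "((\<lambda>(a, b). \<kappa> a b * circle_coeff (int a - int b) f (s a b) * (z ^ a * cnj z ^ b)) has_sum f z) UNIV"
      using v[of z] r by (simp add: g_def r_def split_def)
  qed (use s \<kappa>_bound s_Suc \<kappa>_Suc in auto)
qed

section \<open>The expansion in all variables\<close>

definition vupd :: "complex ^ 'n \<Rightarrow> 'n \<Rightarrow> complex \<Rightarrow> complex ^ 'n" where
  "vupd z j w = (\<chi> k. if k = j then w else z $ k)"

lemma vupd_nth [simp]: "vupd z j w $ k = (if k = j then w else z $ k)"
  by (simp add: vupd_def)

lemma vupd_vupd_same [simp]: "vupd (vupd z j v) j w = vupd z j w"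
  by (simp add: vec_eq_iff)

lemma vupd_triv [simp]: "vupd z j (z $ j) = z"
  by (simp add: vec_eq_iff)

lemma vupd_commute: "j \<noteq> k \<Longrightarrow> vupd (vupd z j v) k w = vupd (vupd z k w) j v"
  by (auto simp: vec_eq_iff)

text \<open>
  Exponents of \<open>z\<close> (at \<open>False\<close>) and of its conjugate (at \<open>True\<close>), so that both are treated as
  independent variables of one power series.
\<close>

type_synonym 'n mixed_index = "'n \<times> bool \<Rightarrow> nat"

definition real_coord :: "complex ^ 'n \<Rightarrow> 'n \<times> bool \<Rightarrow> complex" where
  "real_coord z m = (if snd m then cnj (z $ fst m) else z $ fst m)"

definition mixed_monomial :: "'n::finite mixed_index \<Rightarrow> complex ^ 'n \<Rightarrow> complex" where
  "mixed_monomial I z = (\<Prod>m\<in>UNIV. real_coord z m ^ I m)"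

definition total_degree :: "'n::finite mixed_index \<Rightarrow> nat" where
  "total_degree I = (\<Sum>m\<in>UNIV. I m)"

definition set_pair :: "'n \<Rightarrow> nat \<Rightarrow> nat \<Rightarrow> 'n mixed_index \<Rightarrow> 'n mixed_index" where
  "set_pair j a b I = I((j, False) := a, (j, True) := b)"

lemma set_pair_simps [simp]:
  "set_pair j a b I (j, False) = a" "set_pair j a b I (j, True) = b"
  "k \<noteq> j \<Longrightarrow> set_pair j a b I (k, e) = I (k, e)"
  by (auto simp: set_pair_def)

lemma set_pair_set_pair [simp]: "set_pair j a b (set_pair j c d I) = set_pair j a b I"
  by (auto simp: set_pair_def fun_eq_iff)

lemma set_pair_triv [simp]: "set_pair j (I (j, False)) (I (j, True)) I = I"
  by (auto simp: set_pair_def)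

lemma set_pair_commute: "j \<noteq> k \<Longrightarrow> set_pair j a b (set_pair k c d I) = set_pair k c d (set_pair j a b I)"
  by (auto simp: set_pair_def fun_eq_iff)

definition indices_on :: "'n set \<Rightarrow> 'n mixed_index set" where
  "indices_on S = {I. \<forall>j e. j \<notin> S \<longrightarrow> I (j, e) = 0}"

lemma norm_real_coord [simp]: "norm (real_coord z m) = norm (z $ fst m)"
  by (simp add: real_coord_def)

lemma prod_UNIV_split_pair:
  fixes F :: "'n::finite \<times> bool \<Rightarrow> 'a::comm_monoid_mult"
  shows "(\<Prod>m\<in>UNIV. F m) = F (j, False) * F (j, True) * (\<Prod>m\<in>UNIV - {(j, False), (j, True)}. F m)"
  by (subst prod.subset_diff[of "{(j, False), (j, True)}"]) (auto simp: mult_ac)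

lemma sum_UNIV_split_pair:
  fixes F :: "'n::finite \<times> bool \<Rightarrow> 'a::comm_monoid_add"
  shows "(\<Sum>m\<in>UNIV. F m) = F (j, False) + F (j, True) + (\<Sum>m\<in>UNIV - {(j, False), (j, True)}. F m)"
  by (subst sum.subset_diff[of "{(j, False), (j, True)}"]) (auto simp: add_ac)

lemma mixed_monomial_set_pair:
  assumes "I (j, False) = 0" "I (j, True) = 0"
  shows "mixed_monomial (set_pair j a b I) z = z $ j ^ a * cnj (z $ j) ^ b * mixed_monomial I z"
proof -
  have "(\<Prod>m\<in>UNIV - {(j, False), (j, True)}. real_coord z m ^ set_pair j a b I m)
      = (\<Prod>m\<in>UNIV - {(j, False), (j, True)}. real_coord z m ^ I m)"
    by (rule prod.cong) (auto simp: set_pair_def)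
  then show ?thesis
    unfolding mixed_monomial_def prod_UNIV_split_pair[where j = j] using assms by (simp add: real_coord_def)
qed

lemma total_degree_set_pair:
  assumes "I (j, False) = 0" "I (j, True) = 0"
  shows "total_degree (set_pair j a b I) = a + b + total_degree I"
proof -
  have "(\<Sum>m\<in>UNIV - {(j, False), (j, True)}. set_pair j a b I m)
      = (\<Sum>m\<in>UNIV - {(j, False), (j, True)}. I m)"
    by (rule sum.cong) (auto simp: set_pair_def)
  then show ?thesis
    unfolding total_degree_def sum_UNIV_split_pair[where j = j] using assms by simp
qed

lemma mixed_monomial_vupd:
  assumes "I (j, False) = 0" "I (j, True) = 0"
  shows "mixed_monomial I (vupd z j w) = mixed_monomial I z"
  unfolding mixed_monomial_def
proof (rule prod.cong)
  fix m :: "'a \<times> bool"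
  show "real_coord (vupd z j w) m ^ I m = real_coord z m ^ I m"
    using assms by (cases m; cases "fst m = j"; cases "snd m") (auto simp: real_coord_def)
qed simp

lemma norm_mixed_monomial_le:
  assumes "I \<in> indices_on S" "\<And>j. j \<in> S \<Longrightarrow> norm (z $ j) \<le> \<rho>"
  shows "norm (mixed_monomial I z) \<le> \<rho> ^ total_degree I"
proof -
  have "norm (mixed_monomial I z) = (\<Prod>m\<in>UNIV. norm (z $ fst m) ^ I m)"
    by (simp add: mixed_monomial_def prod_norm[symmetric] norm_power)
  also have "\<dots> \<le> (\<Prod>m\<in>UNIV. \<rho> ^ I m)"
  proof (rule prod_mono)
    fix m :: "'a \<times> bool"
    show "0 \<le> norm (z $ fst m) ^ I m \<and> norm (z $ fst m) ^ I m \<le> \<rho> ^ I m"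
    proof (cases "fst m \<in> S")
      case True
      then show ?thesis using assms(2) by (auto intro!: power_mono)
    next
      case False
      then have "I m = 0" using assms(1) by (cases m) (auto simp: indices_on_def)
      then show ?thesis by simp
    qed
  qed
  also have "\<dots> = \<rho> ^ total_degree I" by (simp add: total_degree_def power_sum)
  finally show ?thesis .
qed

text \<open>
  The product formula for infinite sums gives the value \<open>(1 - t)\<close> to a negative power. A family that is
  not summable has the sum \<open>0\<close> by convention, so a nonzero value proves summability.
\<close>

lemma summable_on_geometric_multi:
  fixes t :: real
  assumes "0 \<le> t" "t < 1"
  shows "(\<lambda>I::'n::finite \<times> bool \<Rightarrow> nat. t ^ total_degree I) summable_on UNIV"
proof -
  have g: "((\<lambda>n. t ^ n) has_sum 1 / (1 - t)) UNIV"
    by (rule norm_summable_imp_has_sum) (use assms geometric_sums[of t] in \<open>auto simp: norm_power\<close>)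
  have "infsum (\<lambda>I::'n \<times> bool \<Rightarrow> nat. \<Prod>m\<in>UNIV. t ^ I m) (PiE UNIV (\<lambda>_. UNIV)) = (\<Prod>m\<in>(UNIV :: ('n \<times> bool) set). infsum (\<lambda>n. t ^ n) UNIV)"
    by (rule infsum_prod_PiE_abs) (use g assms in \<open>auto simp: norm_power dest: has_sum_imp_summable\<close>)
  also have "\<dots> \<noteq> 0" using infsumI[OF g] assms by simp
  finally have "(\<lambda>I::'n \<times> bool \<Rightarrow> nat. \<Prod>m\<in>UNIV. t ^ I m) summable_on (PiE UNIV (\<lambda>_. UNIV))"
    using infsum_not_exists by blast
  then show ?thesis by (simp add: total_degree_def power_sum)
qed

lemma circle_coeff_section_continuous:
  fixes F :: "complex ^ 'n::finite \<Rightarrow> complex"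
  assumes F: "continuous_on {z. \<forall>k. norm (z $ k) \<le> r0} F" and s: "0 \<le> s" "s \<le> r0"
  shows "continuous_on {z. \<forall>k. norm (z $ k) \<le> r0} (\<lambda>z. circle_coeff k (\<lambda>w. F (vupd z j w)) s)"
proof -
  let ?P = "{z :: complex ^ 'n. \<forall>k. norm (z $ k) \<le> r0}"
  have "continuous_on ?P (\<lambda>z. integral (cbox 0 (2*pi)) (\<lambda>t. F (vupd z j (of_real s * cis t)) * cis (- (of_int k * t))))"
  proof (rule integral_continuous_on_param)
    have "continuous_on (?P \<times> cbox 0 (2 * pi)) (\<lambda>x. vupd (fst x) j (of_real s * cis (snd x)))"
      unfolding vupd_def
    proof (rule continuous_on_vec_lambda)
      fix k
      show "continuous_on (?P \<times> cbox 0 (2 * pi)) (\<lambda>x. if k = j then of_real s * cis (snd x) else fst x $ k)"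
        by (cases "k = j"; simp; intro continuous_intros)
    qed
    then have "continuous_on (?P \<times> cbox 0 (2 * pi)) (\<lambda>x. F (vupd (fst x) j (of_real s * cis (snd x))))"
      by (rule continuous_on_compose2[OF F]) (use s in \<open>auto simp: norm_mult\<close>)
    then show "continuous_on (?P \<times> cbox 0 (2 * pi)) (\<lambda>(z, t). F (vupd z j (of_real s * cis t)) * cis (- (of_int k * t)))"
      unfolding split_def by (intro continuous_intros)
  qed
  then show ?thesis
    unfolding circle_coeff_def by (intro continuous_intros) simp_all
qed

text \<open>
  What \<open>L\<^sub>j u = 0\<close> means for the coefficients of \<open>u\<close> at the index \<open>I\<close> and the coordinate \<open>j\<close>.
\<close>

definition harmonic_recursion ::
  "complex ^ 'n \<Rightarrow> complex ^ 'n \<Rightarrow> ('n mixed_index \<Rightarrow> complex) \<Rightarrow> 'n mixed_index \<Rightarrow> 'n \<Rightarrow> bool" where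
  "harmonic_recursion \<alpha> \<beta> a I j \<longleftrightarrow>
     of_nat (Suc (I (j, False))) * of_nat (Suc (I (j, True))) *
       a (set_pair j (Suc (I (j, False))) (Suc (I (j, True))) I)
     = (of_nat (I (j, False)) - \<beta> $ j) * (of_nat (I (j, True)) - \<alpha> $ j) * a I"

text \<open>
  Induction over the set \<open>S\<close> of coordinates already expanded. To add the coordinate \<open>j\<close>, expand \<open>u\<close> in
  \<open>z\<^sub>j\<close>; the coefficients are circle integrals of \<open>u\<close> with \<open>z\<^sub>j\<close> replaced by points of modulus at
  most \<open>r0\<close>, and there the expansion in the coordinates of \<open>S\<close> is available by the induction
  hypothesis. It may be integrated term by term, because it converges uniformly. In this order the
  coefficient functions \<open>A I\<close> need only be continuous and bounded, and no differential equation has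
  to be derived for them. The last clause says that \<open>A I\<close> no longer depends on the expanded
  coordinates.
\<close>

lemma polydisc_expansion:
  fixes u :: "complex ^ 'n::finite \<Rightarrow> complex" and \<alpha> \<beta> :: "complex ^ 'n"
    and \<kappa> :: "'n \<Rightarrow> nat \<Rightarrow> nat \<Rightarrow> complex" and s :: "'n \<Rightarrow> nat \<Rightarrow> nat \<Rightarrow> real" and K :: "'n \<Rightarrow> real" and r0 :: real
  defines "P \<equiv> {z :: complex ^ 'n. \<forall>k. norm (z $ k) \<le> r0}"
  assumes r0: "0 < r0" and u: "continuous_on P u"
    and s: "\<And>j a b. 0 < s j a b \<and> s j a b \<le> r0"
    and \<kappa>: "\<And>j a b. norm (\<kappa> j a b) \<le> K j / r0 ^ (a + b)"
    and s_Suc: "\<And>j a b. s j (Suc a) (Suc b) = s j a b"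
    and \<kappa>_Suc: "\<And>j a b. of_nat (Suc a) * of_nat (Suc b) * \<kappa> j (Suc a) (Suc b)
          = (of_nat a - \<beta> $ j) * (of_nat b - \<alpha> $ j) * \<kappa> j a b"
    and expand: "\<And>j. \<forall>z\<in>P. norm (z $ j) < r0 \<longrightarrow>
       ((\<lambda>(a, b). \<kappa> j a b * circle_coeff (int a - int b) (\<lambda>w. u (vupd z j w)) (s j a b) * (z $ j ^ a * cnj (z $ j) ^ b))
          has_sum u z) UNIV"
    and "finite S"
  shows "\<exists>A C. (\<forall>I\<in>indices_on S. continuous_on P (A I)) \<and>
      (\<forall>I\<in>indices_on S. \<forall>z\<in>P. norm (A I z) \<le> C / r0 ^ total_degree I) \<and>
      (\<forall>z\<in>P. (\<forall>j\<in>S. norm (z $ j) < r0) \<longrightarrow> ((\<lambda>I. A I z * mixed_monomial I z) has_sum u z) (indices_on S)) \<and>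
      (\<forall>I\<in>indices_on S. \<forall>j\<in>S. \<forall>z\<in>P.
         harmonic_recursion \<alpha> \<beta> (\<lambda>I. A I z) I j) \<and>
      (\<forall>I\<in>indices_on S. \<forall>j\<in>S. \<forall>z\<in>P. \<forall>w. norm w \<le> r0 \<longrightarrow> A I (vupd z j w) = A I z)"
  using \<open>finite S\<close>
proof (induction S rule: finite_induct)
  case empty
  have "indices_on ({} :: 'n set) = {\<lambda>_. 0}" by (auto simp: indices_on_def)
  moreover have "bounded (u ` P)"
  proof (intro compact_imp_bounded compact_continuous_image u)
    have "P = (\<Inter>k. {z. norm (z $ k) \<le> r0})" by (auto simp: P_def)
    moreover have "closed {z :: complex ^ 'n. norm (z $ k) \<le> r0}" for k
      by (intro closed_Collect_le continuous_intros)
    ultimately have "closed P" by auto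
    moreover have "bounded P"
    proof (rule boundedI)
      fix z assume "z \<in> P"
      have "norm z \<le> (\<Sum>k\<in>UNIV. norm (z $ k))"
        unfolding norm_vec_def by (rule L2_set_le_sum) simp
      also have "\<dots> \<le> (\<Sum>k\<in>(UNIV :: 'n set). r0)"
        using \<open>z \<in> P\<close> by (intro sum_mono) (simp add: P_def)
      finally show "norm z \<le> (\<Sum>k\<in>(UNIV :: 'n set). r0)" .
    qed
    ultimately show "compact P" by (simp add: compact_eq_bounded_closed)
  qed
  then obtain B where "\<And>z. z \<in> P \<Longrightarrow> norm (u z) \<le> B" unfolding bounded_iff by auto
  ultimately show ?case
    by (intro exI[of _ "\<lambda>_. u"] exI[of _ B]) (auto simp: u total_degree_def mixed_monomial_def intro!: has_sum_finiteI)
next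
  case (insert j S)
  then obtain A C where
    A_cont: "\<And>I. I \<in> indices_on S \<Longrightarrow> continuous_on P (A I)" and
    A_bound: "\<And>I z. I \<in> indices_on S \<Longrightarrow> z \<in> P \<Longrightarrow> norm (A I z) \<le> C / r0 ^ total_degree I" and
    A_sum: "\<And>z. z \<in> P \<Longrightarrow> (\<And>j. j \<in> S \<Longrightarrow> norm (z $ j) < r0) \<Longrightarrow> ((\<lambda>I. A I z * mixed_monomial I z) has_sum u z) (indices_on S)" and
    A_rec: "\<And>I j z. I \<in> indices_on S \<Longrightarrow> j \<in> S \<Longrightarrow> z \<in> P \<Longrightarrow>
         harmonic_recursion \<alpha> \<beta> (\<lambda>I. A I z) I j" and
    A_const: "\<And>I j z w. I \<in> indices_on S \<Longrightarrow> j \<in> S \<Longrightarrow> z \<in> P \<Longrightarrow> norm w \<le> r0 \<Longrightarrow> A I (vupd z j w) = A I z"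
    apply (elim exE conjE)
    subgoal for A C by (rule that[of A C]) simp_all
    done
  have vP: "vupd z k w \<in> P" if "z \<in> P" "norm w \<le> r0" for z k w
    using that by (auto simp: P_def)
  define A' where "A' = (\<lambda>I z. \<kappa> j (I (j, False)) (I (j, True)) *
     circle_coeff (int (I (j, False)) - int (I (j, True))) (\<lambda>w. A (set_pair j 0 0 I) (vupd z j w)) (s j (I (j, False)) (I (j, True))))"
  have zero_j: "I (j, e) = 0" if "I \<in> indices_on S" for I e
    using that insert.hyps by (auto simp: indices_on_def)
  have drop_j: "set_pair j 0 0 I \<in> indices_on S" if "I \<in> indices_on (insert j S)" for I
    using that unfolding indices_on_def set_pair_def by auto
  have set_j: "set_pair j a b I \<in> indices_on (insert j S)" if "I \<in> indices_on S" for I a b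
    using that unfolding indices_on_def set_pair_def by auto
  have drop_set: "set_pair j 0 0 I = I" if "I \<in> indices_on S" for I
    using zero_j[OF that] set_pair_triv[of j I] by simp
  have sec_cont: "continuous_on (sphere 0 \<bar>s j a b\<bar>) (\<lambda>w. A I (vupd z j w))" if "I \<in> indices_on S" "z \<in> P" for I z a b
  proof (rule continuous_on_compose2[OF A_cont[OF that(1)]])
    show "continuous_on (sphere 0 \<bar>s j a b\<bar>) (vupd z j)"
      unfolding vupd_def
    proof (rule continuous_on_vec_lambda)
      fix k
      show "continuous_on (sphere 0 \<bar>s j a b\<bar>) (\<lambda>w. if k = j then w else z $ k)"
        by (cases "k = j"; simp; intro continuous_intros)
    qed
    show "vupd z j ` sphere 0 \<bar>s j a b\<bar> \<subseteq> P"
      using s[of j a b] that(2) by (auto intro!: vP)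
  qed
  have deg: "total_degree I = I (j, False) + I (j, True) + total_degree (set_pair j 0 0 I)" for I
    using total_degree_set_pair[of "set_pair j 0 0 I" j "I (j, False)" "I (j, True)"] by simp
  have mon: "mixed_monomial I z = z $ j ^ I (j, False) * cnj (z $ j) ^ I (j, True) * mixed_monomial (set_pair j 0 0 I) z" for I z
    using mixed_monomial_set_pair[of "set_pair j 0 0 I" j "I (j, False)" "I (j, True)"] by simp
  have K0: "K j \<ge> 0" using order_trans[OF norm_ge_zero \<kappa>[of j 0 0]] by simp
  have zP: "(0 :: complex ^ 'n) \<in> P" using r0 by (simp add: P_def)
  have "(\<lambda>_. 0) \<in> indices_on S" by (simp add: indices_on_def)
  from order_trans[OF norm_ge_zero A_bound[OF this zP]] have C0: "C \<ge> 0"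
    by (simp add: total_degree_def)
  have bound: "norm (A' I z) \<le> (K j * C) / r0 ^ total_degree I" if I: "I \<in> indices_on (insert j S)" and z: "z \<in> P" for I z
  proof -
    let ?a = "I (j, False)" and ?b = "I (j, True)" and ?I = "set_pair j 0 0 I"
    have "norm (circle_coeff (int ?a - int ?b) (\<lambda>w. A ?I (vupd z j w)) (s j ?a ?b)) \<le> C / r0 ^ total_degree ?I"
      by (rule norm_circle_coeff_le[OF sec_cont[OF drop_j[OF I] z]], rule A_bound[OF drop_j[OF I] vP[OF z]])
         (use s[of j ?a ?b] in auto)
    then have "norm (A' I z) \<le> (K j / r0 ^ (?a + ?b)) * (C / r0 ^ total_degree ?I)"
      unfolding A'_def norm_mult using K0 r0 by (intro mult_mono \<kappa>) auto
    also have "\<dots> = (K j * C) / r0 ^ total_degree I"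
      unfolding deg[of I] power_add by simp
    finally show ?thesis .
  qed
  show ?case
  proof (intro exI[of _ A'] exI[of _ "K j * C"] conjI ballI allI impI)
    fix I assume "I \<in> indices_on (insert j S)"
    then show "continuous_on P (A' I)"
      unfolding A'_def P_def
      by (intro continuous_on_mult continuous_on_const circle_coeff_section_continuous)
         (use drop_j A_cont s s[THEN conjunct1, THEN less_imp_le] in \<open>auto simp: P_def\<close>)
  next
    fix I z assume "I \<in> indices_on (insert j S)" "z \<in> P"
    then show "norm (A' I z) \<le> (K j * C) / r0 ^ total_degree I" by (rule bound)
  next
    fix I k z assume I: "I \<in> indices_on (insert j S)" and k: "k \<in> insert j S" and z: "z \<in> P"
    show "harmonic_recursion \<alpha> \<beta> (\<lambda>I. A' I z) I k"
    proof (cases "k = j")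
      case True
      have index: "int (Suc a) - int (Suc b) = int a - int b" for a b by simp
      show ?thesis
        unfolding harmonic_recursion_def True A'_def using \<kappa>_Suc[of "I (j, False)" "I (j, True)" j]
        by (simp add: index s_Suc mult.assoc[symmetric] del: of_nat_Suc)
    next
      case False
      then have k: "k \<in> S" using k by simp
      let ?I = "set_pair j 0 0 I" and ?I' = "set_pair k (Suc (I (k, False))) (Suc (I (k, True))) I"
      let ?a = "I (j, False)" and ?b = "I (j, True)"
      have e: "set_pair j 0 0 ?I' = set_pair k (Suc (?I (k, False))) (Suc (?I (k, True))) ?I"
        using False by (simp add: set_pair_commute)
      have "of_nat (Suc (I (k, False))) * of_nat (Suc (I (k, True))) * circle_coeff (int ?a - int ?b) (\<lambda>w. A (set_pair j 0 0 ?I') (vupd z j w)) (s j ?a ?b)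
        = circle_coeff (int ?a - int ?b) (\<lambda>w. of_nat (Suc (I (k, False))) * of_nat (Suc (I (k, True))) * A (set_pair j 0 0 ?I') (vupd z j w)) (s j ?a ?b)"
        by (rule circle_coeff_cmult[symmetric])
      also have "\<dots> = circle_coeff (int ?a - int ?b) (\<lambda>w. (of_nat (I (k, False)) - \<beta> $ k) * (of_nat (I (k, True)) - \<alpha> $ k) * A ?I (vupd z j w)) (s j ?a ?b)"
      proof (rule circle_coeff_cong)
        fix w :: complex assume "norm w = \<bar>s j ?a ?b\<bar>"
        then have "vupd z j w \<in> P" using s[of j ?a ?b] z by (intro vP) auto
        from A_rec[OF drop_j[OF I] k this] False
        show "of_nat (Suc (I (k, False))) * of_nat (Suc (I (k, True))) * A (set_pair j 0 0 ?I') (vupd z j w)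
          = (of_nat (I (k, False)) - \<beta> $ k) * (of_nat (I (k, True)) - \<alpha> $ k) * A ?I (vupd z j w)"
          unfolding harmonic_recursion_def e by simp
      qed
      also have "\<dots> = (of_nat (I (k, False)) - \<beta> $ k) * (of_nat (I (k, True)) - \<alpha> $ k) * circle_coeff (int ?a - int ?b) (\<lambda>w. A ?I (vupd z j w)) (s j ?a ?b)"
        by (rule circle_coeff_cmult)
      finally show ?thesis
        unfolding harmonic_recursion_def A'_def using False by (simp add: mult_ac del: of_nat_Suc)
    qed
  next
    fix I k z and w :: complex
    assume I: "I \<in> indices_on (insert j S)" and k: "k \<in> insert j S" and z: "z \<in> P" and w: "norm w \<le> r0"
    show "A' I (vupd z k w) = A' I z"
    proof (cases "k = j")
      case True
      then show ?thesis by (simp add: A'_def)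
    next
      case False
      then have k: "k \<in> S" using k by simp
      let ?a = "I (j, False)" and ?b = "I (j, True)" and ?I = "set_pair j 0 0 I"
      have "circle_coeff (int ?a - int ?b) (\<lambda>v. A ?I (vupd (vupd z k w) j v)) (s j ?a ?b)
        = circle_coeff (int ?a - int ?b) (\<lambda>v. A ?I (vupd z j v)) (s j ?a ?b)"
      proof (rule circle_coeff_cong)
        fix v :: complex assume "norm v = \<bar>s j ?a ?b\<bar>"
        then have "vupd z j v \<in> P" using s[of j ?a ?b] z by (intro vP) auto
        then show "A ?I (vupd (vupd z k w) j v) = A ?I (vupd z j v)"
          using A_const[OF drop_j[OF I] k _ w] False by (simp add: vupd_commute)
      qed
      then show ?thesis by (simp add: A'_def)
    qed
  next
    fix z assume z: "z \<in> P" and zS: "\<forall>k\<in>insert j S. norm (z $ k) < r0"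
    define \<rho> where "\<rho> = Max ((\<lambda>k. norm (z $ k)) ` insert j S)"
    have \<rho>: "\<rho> < r0" "\<And>k. k \<in> insert j S \<Longrightarrow> norm (z $ k) \<le> \<rho>"
      using zS insert.hyps(1) by (auto simp: \<rho>_def)
    have \<rho>0: "0 \<le> \<rho>" using order_trans[OF norm_ge_zero \<rho>(2)[of j]] by simp
    define t where "t = \<rho> / r0"
    have t: "0 \<le> t" "t < 1" using \<rho> \<rho>0 r0 by (auto simp: t_def)
    note geo = summable_on_subset_banach[OF summable_on_geometric_multi[OF t] subset_UNIV]
    have inner: "((\<lambda>I. A' (set_pair j a b I) z * mixed_monomial (set_pair j a b I) z) has_sum
        \<kappa> j a b * circle_coeff (int a - int b) (\<lambda>w. u (vupd z j w)) (s j a b) * (z $ j ^ a * cnj (z $ j) ^ b)) (indices_on S)" for a b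
    proof -
      have sb: "\<bar>s j a b\<bar> \<le> r0" using s[of j a b] by simp
      have "((\<lambda>I. circle_coeff (int a - int b) (\<lambda>w. A I (vupd z j w) * mixed_monomial I z) (s j a b)) has_sum
         circle_coeff (int a - int b) (\<lambda>w. u (vupd z j w)) (s j a b)) (indices_on S)"
      proof (rule circle_coeff_has_sum(2)[where M = "\<lambda>I. C * t ^ total_degree I"])
        fix I assume I: "I \<in> indices_on S"
        show "continuous_on (sphere 0 \<bar>s j a b\<bar>) (\<lambda>w. A I (vupd z j w) * mixed_monomial I z)"
          by (intro continuous_on_mult continuous_on_const sec_cont I z)
        fix w :: complex assume w: "norm w = \<bar>s j a b\<bar>"
        have "norm (A I (vupd z j w) * mixed_monomial I z) \<le> (C / r0 ^ total_degree I) * \<rho> ^ total_degree I"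
          unfolding norm_mult using C0 r0 \<rho>(2) w sb
          by (intro mult_mono A_bound I vP z norm_mixed_monomial_le[OF I]) auto
        then show "norm (A I (vupd z j w) * mixed_monomial I z) \<le> C * t ^ total_degree I"
          by (simp add: t_def power_divide)
      next
        show "(\<lambda>I. C * t ^ total_degree I) summable_on indices_on S"
          by (intro summable_on_cmult_right geo)
      next
        fix w :: complex assume w: "norm w = \<bar>s j a b\<bar>"
        have "((\<lambda>I. A I (vupd z j w) * mixed_monomial I (vupd z j w)) has_sum u (vupd z j w)) (indices_on S)"
          by (rule A_sum) (use w sb z vP zS insert.hyps(2) in auto)
        also have "?this \<longleftrightarrow> ((\<lambda>I. A I (vupd z j w) * mixed_monomial I z) has_sum u (vupd z j w)) (indices_on S)"
          by (rule has_sum_cong) (simp add: mixed_monomial_vupd zero_j)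
        finally show "((\<lambda>I. A I (vupd z j w) * mixed_monomial I z) has_sum u (vupd z j w)) (indices_on S)" .
      qed
      from has_sum_cmult_left[OF has_sum_cmult_right[OF this, of "\<kappa> j a b"], of "z $ j ^ a * cnj (z $ j) ^ b"]
      show ?thesis
      proof (rule has_sum_cong[THEN iffD1, rotated])
        fix I assume I: "I \<in> indices_on S"
        have "circle_coeff (int a - int b) (\<lambda>w. A I (vupd z j w) * mixed_monomial I z) (s j a b)
            = mixed_monomial I z * circle_coeff (int a - int b) (\<lambda>w. A I (vupd z j w)) (s j a b)"
          unfolding circle_coeff_cmult[symmetric] by (simp add: mult.commute)
        then show "\<kappa> j a b * circle_coeff (int a - int b) (\<lambda>w. A I (vupd z j w) * mixed_monomial I z) (s j a b) * (z $ j ^ a * cnj (z $ j) ^ b)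
          = A' (set_pair j a b I) z * mixed_monomial (set_pair j a b I) z"
          using zero_j[OF I] by (simp add: A'_def drop_set[OF I] mixed_monomial_set_pair)
      qed
    qed
    have "(\<lambda>I. A' I z * mixed_monomial I z) summable_on indices_on (insert j S)"
    proof (rule abs_summable_summable, rule Infinite_Sum.abs_summable_on_comparison_test')
      show "(\<lambda>I. (K j * C) * t ^ total_degree I) summable_on indices_on (insert j S)"
        by (intro summable_on_cmult_right geo)
      fix I assume I: "I \<in> indices_on (insert j S)"
      have "norm (A' I z * mixed_monomial I z) \<le> ((K j * C) / r0 ^ total_degree I) * \<rho> ^ total_degree I"
        unfolding norm_mult using C0 K0 r0 \<rho>(2)
        by (intro mult_mono bound I z norm_mixed_monomial_le[OF I]) auto
      then show "norm (A' I z * mixed_monomial I z) \<le> (K j * C) * t ^ total_degree I"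
        by (simp add: t_def power_divide)
    qed
    moreover have "(\<lambda>I. A' I z * mixed_monomial I z) summable_on indices_on (insert j S) \<longleftrightarrow>
       (\<lambda>((a, b), I). A' (set_pair j a b I) z * mixed_monomial (set_pair j a b I) z) summable_on UNIV \<times> indices_on S"
      by (rule summable_on_reindex_bij_witness[of _ "\<lambda>((a, b), I). set_pair j a b I" "\<lambda>I. ((I (j, False), I (j, True)), set_pair j 0 0 I)"])
         (auto simp: drop_j set_j drop_set)
    ultimately have "(\<lambda>((a, b), I). A' (set_pair j a b I) z * mixed_monomial (set_pair j a b I) z) summable_on UNIV \<times> indices_on S"
      by simp
    then have "((\<lambda>((a, b), I). A' (set_pair j a b I) z * mixed_monomial (set_pair j a b I) z) has_sum u z) (UNIV \<times> indices_on S)"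
    proof (rule has_sum_SigmaI[rotated 2])
      show "((\<lambda>(a, b). \<kappa> j a b * circle_coeff (int a - int b) (\<lambda>w. u (vupd z j w)) (s j a b) * (z $ j ^ a * cnj (z $ j) ^ b))
          has_sum u z) UNIV"
        using expand[of j] z zS by simp
    qed (use inner in auto)
    also have "?this \<longleftrightarrow> ((\<lambda>I. A' I z * mixed_monomial I z) has_sum u z) (indices_on (insert j S))"
      by (rule has_sum_reindex_bij_witness[symmetric, of _ "\<lambda>((a, b), I). set_pair j a b I" "\<lambda>I. ((I (j, False), I (j, True)), set_pair j 0 0 I)"])
         (auto simp: drop_j set_j drop_set)
    finally show "((\<lambda>I. A' I z * mixed_monomial I z) has_sum u z) (indices_on (insert j S))" .
  qed
qed

section \<open>Termwise differentiation of power series in \<open>z\<close> and its conjugate\<close>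

definition pdisc :: "real \<Rightarrow> (complex ^ 'n::finite) set" where
  "pdisc R = {z. \<forall>j. norm (z $ j) < R}"

definition mixed_series :: "('n::finite mixed_index \<Rightarrow> complex) \<Rightarrow> complex ^ 'n \<Rightarrow> complex" where
  "mixed_series a z = (\<Sum>\<^sub>\<infinity>I. a I * mixed_monomial I z)"

definition converges_on_pdisc :: "real \<Rightarrow> ('n::finite mixed_index \<Rightarrow> complex) \<Rightarrow> bool" where
  "converges_on_pdisc R a \<longleftrightarrow> (\<forall>r. 0 \<le> r \<longrightarrow> r < R \<longrightarrow> (\<lambda>I. norm (a I) * r ^ total_degree I) summable_on UNIV)"

text \<open>
  The coefficients of the formal derivative with respect to the variable \<open>m\<close>.
\<close>

definition coeff_deriv :: "'n \<times> bool \<Rightarrow> ('n::finite mixed_index \<Rightarrow> complex) \<Rightarrow> 'n mixed_index \<Rightarrow> complex" where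
  "coeff_deriv m a I = of_nat (Suc (I m)) * a (I(m := Suc (I m)))"

lemma open_pdisc: "open (pdisc R :: (complex ^ 'n::finite) set)"
proof -
  have "pdisc R = (\<Inter>j. {z :: complex ^ 'n. norm (z $ j) < R})" by (auto simp: pdisc_def)
  moreover have "open {z :: complex ^ 'n. norm (z $ j) < R}" for j
    by (intro open_Collect_less continuous_intros)
  ultimately show ?thesis by auto
qed

lemma convex_pdisc: "convex (pdisc R :: (complex ^ 'n::finite) set)"
proof -
  have "pdisc R = (\<Inter>j. (\<lambda>z :: complex ^ 'n. z $ j) -` ball 0 R)" by (auto simp: pdisc_def)
  moreover have "convex ((\<lambda>z :: complex ^ 'n. z $ j) -` ball 0 R)" for j
    by (intro convex_linear_vimage convex_ball bounded_linear.linear bounded_linear_vec_nth)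
  ultimately show ?thesis by (auto intro: convex_INT)
qed

lemma pdisc_shrink:
  assumes "z \<in> pdisc R" "0 < R"
  obtains r where "0 < r" "r < R" "z \<in> pdisc r"
proof -
  define M where "M = Max (range (\<lambda>j. norm (z $ j)))"
  have M: "norm (z $ j) \<le> M" for j by (simp add: M_def)
  have "M < R" using assms by (simp add: M_def pdisc_def)
  moreover have "0 \<le> M" using M[of undefined] norm_ge_zero order_trans by blast
  moreover have "norm (z $ j) < (M + R) / 2" for j
    by (rule le_less_trans[OF M]) (use \<open>M < R\<close> in simp)
  ultimately have "0 < (M + R) / 2" "(M + R) / 2 < R" "z \<in> pdisc ((M + R) / 2)"
    using assms(2) by (auto simp: pdisc_def)
  then show ?thesis by (rule that)
qed

lemma norm_mixed_term_le:
  assumes "\<And>j. norm (z $ j) \<le> r"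
  shows "norm (a I * mixed_monomial I z) \<le> norm (a I) * r ^ total_degree I"
  using norm_mixed_monomial_le[of I UNIV z r] assms
  by (auto simp: norm_mult indices_on_def intro!: mult_left_mono)

lemma mixed_series_has_sum:
  assumes "converges_on_pdisc R a" "z \<in> pdisc R" "0 < R"
  shows "((\<lambda>I. a I * mixed_monomial I z) has_sum mixed_series a z) UNIV"
proof -
  obtain r where r: "0 < r" "r < R" "z \<in> pdisc r" using pdisc_shrink[OF assms(2,3)] .
  show ?thesis
    unfolding mixed_series_def
  proof (rule has_sum_infsum, rule abs_summable_summable, rule Infinite_Sum.abs_summable_on_comparison_test')
    show "(\<lambda>I. norm (a I) * r ^ total_degree I) summable_on UNIV"
      using assms(1) r by (auto simp: converges_on_pdisc_def)
    show "norm (a I * mixed_monomial I z) \<le> norm (a I) * r ^ total_degree I" for I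
      by (rule norm_mixed_term_le) (use r in \<open>auto simp: pdisc_def less_imp_le\<close>)
  qed
qed

lemma total_degree_upd:
  "total_degree (I(m := Suc (I m))) = Suc (total_degree I)"
proof -
  have "total_degree J = J m + (\<Sum>k\<in>UNIV - {m}. J k)" for J :: "'a mixed_index"
    unfolding total_degree_def by (subst sum.remove[of UNIV m]) auto
  from this[of "I(m := Suc (I m))"] this[of I] show ?thesis by simp
qed

lemma component_le_total_degree: "I m \<le> total_degree I"
  unfolding total_degree_def by (rule member_le_sum) auto

lemma power_derivative_bound:
  fixes r r' :: real
  assumes "0 \<le> r" "r < r'"
  obtains K where "0 \<le> K" "\<And>n. real n * r ^ (n - 1) \<le> K * r' ^ n"
proof -
  \<comment> \<open>a positive radius is needed to pass from \<open>x\<^sup>n\<close> to \<open>x\<^sup>n\<^sup>-\<^sup>1\<close>, and \<open>r\<close> may be \<open>0\<close>\<close>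
  define x where "x = max r (r' / 2)"
  have x: "0 < x" "x < r'" "r \<le> x" using assms by (auto simp: x_def)
  have "(\<lambda>n. real n * (x / r') ^ n) \<longlonglongrightarrow> 0"
    using x by (intro powser_times_n_limit_0) auto
  then have "bounded (range (\<lambda>n. real n * (x / r') ^ n))"
    by (intro convergent_imp_bounded) blast
  then obtain K where K: "\<And>n. norm (real n * (x / r') ^ n) \<le> K" unfolding bounded_iff by auto
  have "K \<ge> 0" using K[of 0] by simp
  show ?thesis
  proof (rule that[of "K / x"])
    show "K / x \<ge> 0" using \<open>K \<ge> 0\<close> x by simp
    fix n
    show "real n * r ^ (n - 1) \<le> K / x * r' ^ n"
    proof (cases n)
      case (Suc k)
      have "real n * (x / r') ^ n \<le> K" using K[of n] x by simp
      then have "real n * x ^ n \<le> K * r' ^ n"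
        using x by (simp add: power_divide field_simps)
      then have "real n * x ^ k \<le> K / x * r' ^ n"
        using x Suc by (simp add: field_simps)
      moreover have "real n * r ^ k \<le> real n * x ^ k"
        using x assms by (intro mult_left_mono power_mono) auto
      ultimately have "real n * r ^ k \<le> K / x * r' ^ n" by linarith
      then show ?thesis using Suc by simp
    qed (use \<open>K \<ge> 0\<close> x in simp)
  qed
qed

text \<open>
  Passing to a slightly larger radius absorbs the factor \<open>total_degree I\<close> of the derivative.
\<close>

lemma summable_derivative_majorant:
  assumes "converges_on_pdisc R a" "0 \<le> r" "r < R"
  shows "(\<lambda>I. norm (a I) * (real (total_degree I) * r ^ (total_degree I - 1))) summable_on UNIV"
proof -
  define r' where "r' = (r + R) / 2"
  have r': "r < r'" "r' < R" "0 \<le> r'" using assms by (auto simp: r'_def)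
  obtain K where K: "0 \<le> K" "\<And>n. real n * r ^ (n - 1) \<le> K * r' ^ n"
    using power_derivative_bound[OF assms(2) r'(1)] by blast
  show ?thesis
  proof (rule summable_on_comparison_test)
    show "(\<lambda>I. K * (norm (a I) * r' ^ total_degree I)) summable_on UNIV"
      using assms(1) r' by (intro summable_on_cmult_right) (auto simp: converges_on_pdisc_def)
    show "norm (a I) * (real (total_degree I) * r ^ (total_degree I - 1)) \<le> K * (norm (a I) * r' ^ total_degree I)" for I
      using mult_left_mono[OF K(2)[of "total_degree I"] norm_ge_zero[of "a I"]] by (simp add: mult_ac)
  qed (use assms(2) in auto)
qed

lemma inj_index_upd: "inj (\<lambda>I. I(m := Suc (I m)))"
proof (rule injI)
  fix I J :: "'a \<Rightarrow> nat" assume "I(m := Suc (I m)) = J(m := Suc (J m))"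
  then have "I k = J k" for k by (cases "k = m") (auto simp: fun_eq_iff split: if_splits)
  then show "I = J" by auto
qed

lemma range_index_upd: "range (\<lambda>I. I(m := Suc (I m))) = {I. I m \<noteq> 0}"
proof (intro set_eqI iffI)
  fix I :: "'a \<Rightarrow> nat" assume "I \<in> {I. I m \<noteq> 0}"
  then have "I = (\<lambda>J. J(m := Suc (J m))) (I(m := I m - 1))" by auto
  then show "I \<in> range (\<lambda>I. I(m := Suc (I m)))" by blast
qed auto

lemma converges_coeff_deriv:
  assumes "converges_on_pdisc R a"
  shows "converges_on_pdisc R (coeff_deriv m a)"
  unfolding converges_on_pdisc_def
proof (intro allI impI)
  fix r :: real assume r: "0 \<le> r" "r < R"
  have "(\<lambda>I. norm (a I) * (real (total_degree I) * r ^ (total_degree I - 1))) summable_on range (\<lambda>I. I(m := Suc (I m)))"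
    by (rule summable_on_subset_banach[OF summable_derivative_majorant[OF assms r]]) simp
  then have *: "(\<lambda>I. norm (a (I(m := Suc (I m)))) * (real (Suc (total_degree I)) * r ^ total_degree I)) summable_on UNIV"
    by (subst (asm) summable_on_reindex[OF inj_index_upd]) (simp add: o_def total_degree_upd del: of_nat_Suc)
  show "(\<lambda>I. norm (coeff_deriv m a I) * r ^ total_degree I) summable_on UNIV"
  proof (rule summable_on_comparison_test[OF *])
    fix I
    have "norm (coeff_deriv m a I) * r ^ total_degree I
        = real (Suc (I m)) * (norm (a (I(m := Suc (I m)))) * r ^ total_degree I)"
      by (simp only: coeff_deriv_def norm_mult norm_of_nat mult.assoc)
    also have "\<dots> \<le> real (Suc (total_degree I)) * (norm (a (I(m := Suc (I m)))) * r ^ total_degree I)"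
      using component_le_total_degree[of I m] r by (intro mult_right_mono) auto
    finally show "norm (coeff_deriv m a I) * r ^ total_degree I \<le>
        norm (a (I(m := Suc (I m)))) * (real (Suc (total_degree I)) * r ^ total_degree I)"
      by (simp only: mult_ac)
  qed (use r in auto)
qed

lemma bounded_linear_real_coord: "bounded_linear (\<lambda>z. real_coord z m)"
proof (cases "snd m")
  case True
  then show ?thesis unfolding real_coord_def
    using bounded_linear_compose[OF bounded_linear_cnj bounded_linear_vec_nth] by simp
next
  case False
  then show ?thesis unfolding real_coord_def using bounded_linear_vec_nth by simp
qed

definition monomial_deriv :: "'n::finite mixed_index \<Rightarrow> complex ^ 'n \<Rightarrow> complex ^ 'n \<Rightarrow> complex" where
  "monomial_deriv I z h = (\<Sum>m\<in>UNIV. of_nat (I m) * mixed_monomial (I(m := I m - 1)) z * real_coord h m)"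

lemma mixed_monomial_has_derivative:
  "(mixed_monomial I has_derivative monomial_deriv I z) (at z)"
proof -
  have *: "((\<lambda>z. real_coord z m ^ I m) has_derivative (\<lambda>h. of_nat (I m) * real_coord h m * real_coord z m ^ (I m - 1))) (at z)" for m
    by (rule has_derivative_power[OF bounded_linear_imp_has_derivative[OF bounded_linear_real_coord]])
  have "(mixed_monomial I has_derivative (\<lambda>h. \<Sum>m\<in>UNIV. of_nat (I m) * real_coord h m * real_coord z m ^ (I m - 1) *
      (\<Prod>k\<in>UNIV - {m}. real_coord z k ^ I k))) (at z)"
    unfolding mixed_monomial_def[abs_def] by (rule has_derivative_prod[OF *])
  also have "(\<lambda>h. \<Sum>m\<in>UNIV. of_nat (I m) * real_coord h m * real_coord z m ^ (I m - 1) *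
      (\<Prod>k\<in>UNIV - {m}. real_coord z k ^ I k)) = monomial_deriv I z"
  proof
    fix h
    have "mixed_monomial (I(m := I m - 1)) z = real_coord z m ^ (I m - 1) * (\<Prod>k\<in>UNIV - {m}. real_coord z k ^ I k)" for m
      unfolding mixed_monomial_def by (subst prod.remove[of UNIV m]) (auto intro!: prod.cong)
    then show "(\<Sum>m\<in>UNIV. of_nat (I m) * real_coord h m * real_coord z m ^ (I m - 1) *
      (\<Prod>k\<in>UNIV - {m}. real_coord z k ^ I k)) = monomial_deriv I z h"
      by (simp add: monomial_deriv_def mult_ac)
  qed
  finally show ?thesis .
qed

lemma norm_monomial_deriv_le:
  assumes "\<And>j. norm (z $ j) \<le> r" "0 \<le> r"
  shows "norm (monomial_deriv I z h) \<le> real (total_degree I) * r ^ (total_degree I - 1) * norm h"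
proof -
  have "norm (monomial_deriv I z h) \<le> (\<Sum>m\<in>UNIV. real (I m) * r ^ (total_degree I - 1) * norm h)"
    unfolding monomial_deriv_def
  proof (rule sum_norm_le)
    fix m
    show "norm (of_nat (I m) * mixed_monomial (I(m := I m - 1)) z * real_coord h m) \<le> real (I m) * r ^ (total_degree I - 1) * norm h"
    proof (cases "I m")
      case (Suc k)
      have "total_degree I = Suc (total_degree (I(m := k)))"
        using total_degree_upd[of "I(m := k)" m] Suc by (simp add: fun_upd_idem)
      then have "norm (mixed_monomial (I(m := I m - 1)) z) \<le> r ^ (total_degree I - 1)"
        using norm_mixed_monomial_le[of "I(m := k)" UNIV z r] assms Suc by (auto simp: indices_on_def)
      moreover have "norm (real_coord h m) \<le> norm h" by (simp add: Finite_Cartesian_Product.norm_nth_le)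
      ultimately show ?thesis
        unfolding norm_mult using assms(2) by (intro mult_mono) auto
    qed simp
  qed
  also have "\<dots> = real (total_degree I) * r ^ (total_degree I - 1) * norm h"
    by (simp add: total_degree_def sum_distrib_right)
  finally show ?thesis .
qed

lemma has_sum_finite_sum:
  fixes f :: "'i \<Rightarrow> 'j \<Rightarrow> complex"
  assumes "finite M" "\<And>m. m \<in> M \<Longrightarrow> ((\<lambda>I. f m I) has_sum s m) A"
  shows "((\<lambda>I. \<Sum>m\<in>M. f m I) has_sum (\<Sum>m\<in>M. s m)) A"
  using assms by (induction M rule: finite_induct) (auto intro: has_sum_add)

lemma monomial_deriv_has_sum:
  assumes "converges_on_pdisc R a" "z \<in> pdisc R" "0 < R"
  shows "((\<lambda>I. a I * monomial_deriv I z h) has_sum (\<Sum>m\<in>UNIV. mixed_series (coeff_deriv m a) z * real_coord h m)) UNIV"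
proof -
  have "((\<lambda>I. a I * (of_nat (I m) * mixed_monomial (I(m := I m - 1)) z * real_coord h m)) has_sum
      mixed_series (coeff_deriv m a) z * real_coord h m) UNIV" for m
  proof -
    have "((\<lambda>I. coeff_deriv m a I * mixed_monomial I z * real_coord h m) has_sum
        mixed_series (coeff_deriv m a) z * real_coord h m) UNIV"
      by (intro has_sum_cmult_left mixed_series_has_sum[OF converges_coeff_deriv[OF assms(1)] assms(2,3)])
    also have "(\<lambda>I. coeff_deriv m a I * mixed_monomial I z * real_coord h m) =
       (\<lambda>I. a I * (of_nat (I m) * mixed_monomial (I(m := I m - 1)) z * real_coord h m)) \<circ> (\<lambda>I. I(m := Suc (I m)))"
      by (simp add: fun_eq_iff coeff_deriv_def mult_ac)
    finally have "((\<lambda>I. a I * (of_nat (I m) * mixed_monomial (I(m := I m - 1)) z * real_coord h m)) has_sum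
        mixed_series (coeff_deriv m a) z * real_coord h m) (range (\<lambda>I. I(m := Suc (I m))))"
      by (subst has_sum_reindex[OF inj_index_upd])
    then show ?thesis
      by (rule has_sum_cong_neutral[THEN iffD1, rotated -1]) (auto simp: range_index_upd)
  qed
  then have "((\<lambda>I. \<Sum>m\<in>UNIV. a I * (of_nat (I m) * mixed_monomial (I(m := I m - 1)) z * real_coord h m)) has_sum
      (\<Sum>m\<in>UNIV. mixed_series (coeff_deriv m a) z * real_coord h m)) UNIV"
    by (intro has_sum_finite_sum) auto
  then show ?thesis by (simp add: monomial_deriv_def sum_distrib_left)
qed

text \<open>
  The series of derivatives converges uniformly on a smaller polydisc. The index set is enumerated,
  because the theorem on termwise differentiation is about sequences.
\<close>

lemma mixed_series_has_derivative:
  fixes a :: "'n::finite mixed_index \<Rightarrow> complex"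
  assumes conv: "converges_on_pdisc R a" and z: "z \<in> pdisc R" and R: "0 < R"
  shows "(mixed_series a has_derivative (\<lambda>h. \<Sum>m\<in>UNIV. mixed_series (coeff_deriv m a) z * real_coord h m)) (at z)"
proof -
  obtain r where r: "0 < r" "r < R" "z \<in> pdisc r" using pdisc_shrink[OF z R] .
  have sub: "x \<in> pdisc R" if "x \<in> pdisc r" for x using that r by (auto simp: pdisc_def intro: less_trans)
  have infinite: "infinite (UNIV :: 'n mixed_index set)"
    using finite_imageD[of "\<lambda>n _. n" "UNIV :: nat set"] finite_subset[OF subset_UNIV]
    by (auto simp: inj_on_def fun_eq_iff)
  define e where "e = from_nat_into (UNIV :: 'n mixed_index set)"
  have bij: "bij_betw e UNIV UNIV"
    unfolding e_def by (rule bij_betw_from_nat_into) (use infinite in auto)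
  have reindex: "(\<lambda>i. f (e i)) sums S" if "(f has_sum S) UNIV" for f :: "'n mixed_index \<Rightarrow> 'b::{t2_space,topological_comm_monoid_add}" and S
    using that has_sum_reindex_bij_betw[OF bij, of f S] by (intro has_sum_imp_sums) simp
  define M where "M = (\<lambda>I. norm (a I) * (real (total_degree I) * r ^ (total_degree I - 1)))"
  have M: "summable (\<lambda>i. M (e i))"
    using reindex[OF has_sum_infsum[OF summable_derivative_majorant[OF conv, of r]]] r by (auto simp: M_def sums_iff)
  have M_bound: "norm (a I * monomial_deriv I x h) \<le> M I * norm h" if "x \<in> pdisc r" for I x h
  proof -
    have "norm (a I * monomial_deriv I x h) \<le> norm (a I) * (real (total_degree I) * r ^ (total_degree I - 1) * norm h)"
      unfolding norm_mult
      by (intro mult_left_mono norm_monomial_deriv_le) (use that r in \<open>auto simp: pdisc_def less_imp_le\<close>)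
    then show ?thesis by (simp add: M_def mult_ac)
  qed
  let ?g' = "\<lambda>x h. \<Sum>m\<in>UNIV. mixed_series (coeff_deriv m a) x * real_coord h m"
  have "\<exists>g. \<forall>x\<in>pdisc r. (\<lambda>n. a (e n) * mixed_monomial (e n) x) sums (g x) \<and> (g has_derivative ?g' x) (at x within pdisc r)"
  proof (rule has_derivative_series[where f = "\<lambda>n x. a (e n) * mixed_monomial (e n) x" and f' = "\<lambda>n x h. a (e n) * monomial_deriv (e n) x h"])
    show "((\<lambda>x. a (e n) * mixed_monomial (e n) x) has_derivative (\<lambda>h. a (e n) * monomial_deriv (e n) x h)) (at x within pdisc r)" for n x
      by (rule has_derivative_mult_right[OF has_derivative_at_withinI[OF mixed_monomial_has_derivative]])
    show "(\<lambda>n. a (e n) * mixed_monomial (e n) z) sums mixed_series a z"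
      by (rule reindex[OF mixed_series_has_sum[OF conv z R]])
  next
    fix \<epsilon> :: real assume \<epsilon>: "\<epsilon> > 0"
    obtain N where N: "\<And>n. n \<ge> N \<Longrightarrow> norm (\<Sum>i. M (e (i + n))) < \<epsilon>"
      using suminf_exist_split[OF \<epsilon> M] by blast
    show "\<forall>\<^sub>F n in sequentially. \<forall>x\<in>pdisc r. \<forall>h. norm ((\<Sum>i<n. a (e i) * monomial_deriv (e i) x h) - ?g' x h) \<le> \<epsilon> * norm h"
      unfolding eventually_sequentially
    proof (intro exI[of _ N] allI impI ballI)
      fix n and x h :: "complex ^ 'n" assume n: "N \<le> n" and x: "x \<in> pdisc r"
      have s: "(\<lambda>i. a (e i) * monomial_deriv (e i) x h) sums ?g' x h"
        by (rule reindex[OF monomial_deriv_has_sum[OF conv sub[OF x] R]])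
      have Mn: "summable (\<lambda>i. M (e (i + n)) * norm h)"
        by (intro summable_mult2 summable_ignore_initial_segment[OF M])
      have "(\<Sum>i<n. a (e i) * monomial_deriv (e i) x h) - ?g' x h = - (\<Sum>i. a (e (i + n)) * monomial_deriv (e (i + n)) x h)"
        using suminf_minus_initial_segment[of "\<lambda>i. a (e i) * monomial_deriv (e i) x h" n] s by (simp add: sums_iff)
      also have "norm \<dots> \<le> (\<Sum>i. M (e (i + n)) * norm h)"
        unfolding norm_minus_cancel
        by (rule norm_suminf_le[OF M_bound[OF x] Mn])
      also have "\<dots> = (\<Sum>i. M (e (i + n))) * norm h"
        by (intro suminf_mult2[symmetric] summable_ignore_initial_segment[OF M])
      also have "\<dots> \<le> \<epsilon> * norm h" using N[OF n] by (intro mult_right_mono) auto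
      finally show "norm ((\<Sum>i<n. a (e i) * monomial_deriv (e i) x h) - ?g' x h) \<le> \<epsilon> * norm h" .
    qed
  qed (use r convex_pdisc in auto)
  then obtain g where g: "\<And>x. x \<in> pdisc r \<Longrightarrow> (\<lambda>n. a (e n) * mixed_monomial (e n) x) sums (g x)"
    "\<And>x. x \<in> pdisc r \<Longrightarrow> (g has_derivative ?g' x) (at x within pdisc r)" by blast
  have "g x = mixed_series a x" if "x \<in> pdisc r" for x
    using sums_unique2[OF g(1)[OF that] reindex[OF mixed_series_has_sum[OF conv sub[OF that] R]]] .
  moreover have "(g has_derivative ?g' z) (at z)"
    using g(2)[OF r(3)] at_within_open[OF r(3) open_pdisc] by simp
  ultimately show ?thesis
    by (rule has_derivative_transform_within_open[OF _ open_pdisc r(3), rotated])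
qed

section \<open>Functions given by such power series\<close>

text \<open>
  Equality is required on the polydisc only, so the notion is stable under the differential
  operators, whose values elsewhere are unrelated to the series.
\<close>

definition represented_by :: "real \<Rightarrow> (complex ^ 'n::finite \<Rightarrow> complex) \<Rightarrow> ('n mixed_index \<Rightarrow> complex) \<Rightarrow> bool" where
  "represented_by R f a \<longleftrightarrow> converges_on_pdisc R a \<and> (\<forall>z\<in>pdisc R. f z = mixed_series a z)"

lemma represented_has_derivative:
  assumes "represented_by R f a" "z \<in> pdisc R" "0 < R"
  shows "(f has_derivative (\<lambda>h. \<Sum>m\<in>UNIV. mixed_series (coeff_deriv m a) z * real_coord h m)) (at z)"
proof -
  have conv: "converges_on_pdisc R a" and eq: "\<And>x. x \<in> pdisc R \<Longrightarrow> mixed_series a x = f x"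
    using assms(1) by (auto simp: represented_by_def)
  show ?thesis
    by (rule has_derivative_transform_within_open[OF mixed_series_has_derivative[OF conv assms(2,3)] open_pdisc assms(2) eq])
qed

lemma represented_frechet_derivative:
  assumes "represented_by R f a" "z \<in> pdisc R" "0 < R"
  shows "frechet_derivative f (at z) h = (\<Sum>m\<in>UNIV. mixed_series (coeff_deriv m a) z * real_coord h m)"
  by (simp add: frechet_derivative_at[OF represented_has_derivative[OF assms], symmetric])

lemma sum_real_coord_axis:
  fixes c :: "'n::finite \<times> bool \<Rightarrow> complex"
  shows "(\<Sum>m\<in>UNIV. c m * real_coord (axis j w) m) = c (j, False) * w + c (j, True) * cnj w"
proof -
  have "(\<Sum>m\<in>UNIV - {(j, False), (j, True)}. c m * real_coord (axis j w) m) = 0"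
  proof (rule sum.neutral, rule ballI)
    fix m assume m: "m \<in> UNIV - {(j, False), (j, True)}"
    have "fst m \<noteq> j" using m by (cases m; cases "snd m") auto
    then show "c m * real_coord (axis j w) m = 0" by (simp add: real_coord_def axis_def)
  qed
  then show ?thesis
    by (subst sum_UNIV_split_pair[where j = j]) (simp add: real_coord_def axis_def)
qed

lemma represented_wirtinger:
  assumes "represented_by R f a" "0 < R"
  shows "represented_by R (wirtinger j f) (coeff_deriv (j, False) a)"
    and "represented_by R (wirtinger_bar j f) (coeff_deriv (j, True) a)"
proof -
  have "frechet_derivative f (at z) (axis j w) =
      mixed_series (coeff_deriv (j, False) a) z * w + mixed_series (coeff_deriv (j, True) a) z * cnj w"
    if "z \<in> pdisc R" for z w
    by (simp add: represented_frechet_derivative[OF assms(1) that assms(2)] sum_real_coord_axis)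
  then have "wirtinger j f z = mixed_series (coeff_deriv (j, False) a) z"
    "wirtinger_bar j f z = mixed_series (coeff_deriv (j, True) a) z" if "z \<in> pdisc R" for z
    using that by (simp_all add: wirtinger_def wirtinger_bar_def algebra_simps)
  then show "represented_by R (wirtinger j f) (coeff_deriv (j, False) a)"
    "represented_by R (wirtinger_bar j f) (coeff_deriv (j, True) a)"
    using assms(1) by (simp_all add: represented_by_def converges_coeff_deriv)
qed

lemma converges_add:
  assumes "converges_on_pdisc R a" "converges_on_pdisc R b"
  shows "converges_on_pdisc R (\<lambda>I. a I + b I)"
  unfolding converges_on_pdisc_def
proof (intro allI impI)
  fix r :: real assume r: "0 \<le> r" "r < R"
  have "(\<lambda>I. norm (a I) * r ^ total_degree I + norm (b I) * r ^ total_degree I) summable_on UNIV"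
    using assms r by (intro summable_on_add) (auto simp: converges_on_pdisc_def)
  then show "(\<lambda>I. norm (a I + b I) * r ^ total_degree I) summable_on UNIV"
    by (rule summable_on_comparison_test)
       (use r norm_triangle_ineq in \<open>auto simp: distrib_right[symmetric] intro!: mult_right_mono\<close>)
qed

lemma converges_cmult:
  assumes "converges_on_pdisc R a"
  shows "converges_on_pdisc R (\<lambda>I. c * a I)"
  using assms unfolding converges_on_pdisc_def norm_mult mult.assoc
  by (auto intro!: summable_on_cmult_right)

lemma represented_add:
  assumes "represented_by R f a" "represented_by R g b" "0 < R"
  shows "represented_by R (\<lambda>z. f z + g z) (\<lambda>I. a I + b I)"
  unfolding represented_by_def
proof (intro conjI ballI)
  show c: "converges_on_pdisc R (\<lambda>I. a I + b I)"
    using assms converges_add unfolding represented_by_def by blast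
  fix z :: "complex ^ 'a" assume z: "z \<in> pdisc R"
  have "((\<lambda>I. a I * mixed_monomial I z + b I * mixed_monomial I z) has_sum f z + g z) UNIV"
    using assms z by (intro has_sum_add) (auto simp: represented_by_def intro: mixed_series_has_sum)
  with mixed_series_has_sum[OF c z assms(3)] show "f z + g z = mixed_series (\<lambda>I. a I + b I) z"
    by (auto simp: distrib_right intro: has_sum_unique)
qed

lemma represented_cmult:
  assumes "represented_by R f a"
  shows "represented_by R (\<lambda>z. c * f z) (\<lambda>I. c * a I)"
  using assms unfolding represented_by_def
  by (auto simp: converges_cmult mixed_series_def mult.assoc infsum_cmult_right')

lemma represented_zero: "represented_by R (\<lambda>z. 0) (\<lambda>I. 0)"
  by (simp add: represented_by_def converges_on_pdisc_def mixed_series_def)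

lemma represented_sum:
  assumes "finite A" "\<And>i. i \<in> A \<Longrightarrow> represented_by R (f i) (a i)" "0 < R"
  shows "represented_by R (\<lambda>z. \<Sum>i\<in>A. f i z) (\<lambda>I. \<Sum>i\<in>A. a i I)"
  using assms(1,2)
  by (induction A rule: finite_induct) (auto intro!: represented_zero represented_add assms(3))

lemma represented_cong:
  assumes "represented_by R f a" "\<And>z. z \<in> pdisc R \<Longrightarrow> f z = g z"
  shows "represented_by R g a"
  using assms by (auto simp: represented_by_def)

lemma polydisc_eq_pdisc: "polydisc = pdisc 1"
  by (simp add: polydisc_def pdisc_def)

lemma represented_Ck_on:
  assumes "represented_by R f a" "0 < R"
  shows "Ck_on k (pdisc R) f"
  using assms(1)
proof (induction k arbitrary: f a)
  case 0
  then show ?case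
    by (auto intro!: continuous_at_imp_continuous_on has_derivative_continuous[OF represented_has_derivative] assms(2))
next
  case (Suc k)
  have "represented_by R (\<lambda>z. frechet_derivative f (at z) v) (\<lambda>I. \<Sum>m\<in>UNIV. real_coord v m * coeff_deriv m a I)" for v
  proof (rule represented_cong)
    show "represented_by R (\<lambda>z. \<Sum>m\<in>UNIV. real_coord v m * mixed_series (coeff_deriv m a) z) (\<lambda>I. \<Sum>m\<in>UNIV. real_coord v m * coeff_deriv m a I)"
      using Suc.prems by (intro represented_sum represented_cmult assms(2)) (auto simp: represented_by_def converges_coeff_deriv)
    show "(\<Sum>m\<in>UNIV. real_coord v m * mixed_series (coeff_deriv m a) z) = frechet_derivative f (at z) v" if "z \<in> pdisc R" for z
      by (simp add: represented_frechet_derivative[OF Suc.prems that assms(2)] mult.commute)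
  qed
  then show ?case
    using Suc.IH represented_has_derivative[OF Suc.prems _ assms(2)] unfolding Ck_on.simps differentiable_def by blast
qed

definition pair_index :: "nat ^ 'n \<Rightarrow> nat ^ 'n \<Rightarrow> 'n mixed_index" where
  "pair_index p q m = (if snd m then q $ fst m else p $ fst m)"

text \<open>
  The factor that the derivative of multi-order \<open>N\<close> produces at the coefficient of index \<open>I\<close>.
\<close>

definition rising_factor :: "'n::finite mixed_index \<Rightarrow> 'n mixed_index \<Rightarrow> complex" where
  "rising_factor N I = (\<Prod>m\<in>UNIV. pochhammer (of_nat (Suc (I m))) (N m))"

definition coeff_deriv_multi :: "'n::finite mixed_index \<Rightarrow> ('n mixed_index \<Rightarrow> complex) \<Rightarrow> 'n mixed_index \<Rightarrow> complex" where
  "coeff_deriv_multi N a I = rising_factor N I * a (\<lambda>m. I m + N m)"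

lemma coeff_deriv_funpow:
  "(coeff_deriv m ^^ k) a I = pochhammer (of_nat (Suc (I m))) k * a (I(m := I m + k))"
proof (induction k arbitrary: I)
  case (Suc k)
  have "(coeff_deriv m ^^ Suc k) a I = of_nat (Suc (I m)) * (coeff_deriv m ^^ k) a (I(m := Suc (I m)))"
    by (simp add: coeff_deriv_def[of m "(coeff_deriv m ^^ k) a"])
  moreover have "(I(m := Suc (I m)))(m := (I(m := Suc (I m))) m + k) = I(m := I m + Suc k)"
    by simp
  ultimately show ?case
    unfolding Suc by (simp only: pochhammer_rec, simp add: add.commute[of 1] mult.assoc) (simp add: fun_upd_def)
qed simp

lemma coeff_deriv_foldr:
  assumes "distinct ms"
  shows "foldr (\<lambda>m. coeff_deriv m ^^ N m) ms a I =
     (\<Prod>m\<in>set ms. pochhammer (of_nat (Suc (I m))) (N m)) * a (\<lambda>m. I m + (if m \<in> set ms then N m else 0))"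
  using assms
proof (induction ms arbitrary: I)
  case (Cons m ms)
  have "(\<Prod>k\<in>set ms. pochhammer (complex_of_nat (Suc ((I(m := I m + N m)) k))) (N k)) = (\<Prod>k\<in>set ms. pochhammer (of_nat (Suc (I k))) (N k))"
    using Cons.prems by (intro prod.cong) auto
  moreover have "(\<lambda>k. (I(m := I m + N m)) k + (if k \<in> set ms then N k else 0)) = (\<lambda>k. I k + (if k \<in> set (m # ms) then N k else 0))"
    using Cons.prems by (auto simp: fun_eq_iff)
  ultimately show ?case
    using Cons by (simp add: coeff_deriv_funpow del: of_nat_Suc)
qed simp

lemma represented_foldr:
  assumes D: "\<And>f a j. represented_by R f a \<Longrightarrow> represented_by R (D j f) (coeff_deriv (j, e) a)"
    and f: "represented_by R f a"
  shows "represented_by R (foldr (\<lambda>j. D j ^^ n j) js f) (foldr (\<lambda>j. coeff_deriv (j, e) ^^ n j) js a)"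
proof -
  have pow: "represented_by R ((D j ^^ k) f) ((coeff_deriv (j, e) ^^ k) a)" if "represented_by R f a" for f a j k
    using that by (induction k) (auto intro: D)
  show ?thesis by (induction js) (auto intro: f pow)
qed

lemma represented_wirtinger_multi:
  assumes f: "represented_by R f a" and R: "0 < R"
  shows "represented_by R (wirtinger_multi p q f) (coeff_deriv_multi (pair_index p q) a)"
proof -
  let ?N = "pair_index p q"
  let ?ms = "map (\<lambda>j. (j, False)) coords @ map (\<lambda>j. (j, True)) (coords :: 'a list)"
  have rep: "represented_by R (wirtinger_multi p q f)
      (foldr (\<lambda>j. coeff_deriv (j, False) ^^ (p $ j)) coords (foldr (\<lambda>j. coeff_deriv (j, True) ^^ (q $ j)) coords a))"
    unfolding wirtinger_multi_def
    by (intro represented_foldr represented_wirtinger f R)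
  have "foldr (\<lambda>j. coeff_deriv (j, False) ^^ (p $ j)) coords (foldr (\<lambda>j. coeff_deriv (j, True) ^^ (q $ j)) coords a)
     = foldr (\<lambda>m. coeff_deriv m ^^ ?N m) ?ms a"
    by (simp add: foldr_map o_def pair_index_def)
  also have "\<dots> = coeff_deriv_multi ?N a"
  proof
    fix I
    have "distinct ?ms" by (auto simp: distinct_map distinct_coords inj_on_def)
    moreover have s: "set ?ms = UNIV"
    proof (intro set_eqI iffI UNIV_I)
      fix m :: "'a \<times> bool"
      show "m \<in> set ?ms" by (cases m; cases "snd m") (auto simp: set_coords)
    qed
    ultimately show "foldr (\<lambda>m. coeff_deriv m ^^ ?N m) ?ms a I = coeff_deriv_multi ?N a I"
      unfolding coeff_deriv_multi_def rising_factor_def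
      by (subst coeff_deriv_foldr) (simp_all only: s UNIV_I if_True)
  qed
  finally show ?thesis using rep by simp
qed

lemma mixed_series_at_zero: "mixed_series a 0 = a (\<lambda>_. 0)"
proof -
  have "mixed_monomial I (0 :: complex ^ 'a) = 0" if "I \<noteq> (\<lambda>_. 0)" for I
  proof -
    obtain m where "I m \<noteq> 0" using \<open>I \<noteq> (\<lambda>_. 0)\<close> by (meson ext)
    then show ?thesis unfolding mixed_monomial_def by (intro prod_zero bexI[of _ m]) (auto simp: real_coord_def)
  qed
  then have "mixed_series a (0 :: complex ^ 'a) = (\<Sum>\<^sub>\<infinity>I\<in>{\<lambda>_. 0}. a I * mixed_monomial I (0 :: complex ^ 'a))"
    unfolding mixed_series_def by (intro infsum_cong_neutral) auto
  then show ?thesis by (simp add: mixed_monomial_def)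
qed

lemma represented_coefficient:
  fixes f :: "complex ^ 'n::finite \<Rightarrow> complex"
  assumes f: "represented_by R f a" and R: "0 < R"
  shows "wirtinger_multi p q f 0 = of_nat (multi_fact p) * of_nat (multi_fact q) * a (pair_index p q)"
proof -
  have "(0 :: complex ^ 'n) \<in> pdisc R" using R by (simp add: pdisc_def)
  with represented_wirtinger_multi[OF f R, of p q]
  have "wirtinger_multi p q f 0 = coeff_deriv_multi (pair_index p q) a (\<lambda>_. 0)"
    by (auto simp: represented_by_def mixed_series_at_zero)
  also have "\<dots> = (\<Prod>m\<in>UNIV. fact (pair_index p q m)) * a (pair_index p q)"
    by (simp add: coeff_deriv_multi_def rising_factor_def pochhammer_fact)
  also have "(\<Prod>m\<in>UNIV. fact (pair_index p q m)) = (\<Prod>j\<in>UNIV. \<Prod>e\<in>UNIV. fact (pair_index p q (j, e)) :: complex)"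
    by (simp add: prod.cartesian_product)
  also have "\<dots> = of_nat (multi_fact p) * of_nat (multi_fact q)"
    by (simp add: UNIV_bool pair_index_def multi_fact_def prod.distrib mult.commute)
  finally show ?thesis .
qed

lemma pair_index_surj: "\<exists>p q. I = pair_index p q"
  by (rule exI[of _ "\<chi> j. I (j, False)"], rule exI[of _ "\<chi> j. I (j, True)"])
     (auto simp: fun_eq_iff pair_index_def)

text \<open>
  All coefficients are determined by derivatives at \<open>0\<close>, even if the two radii differ.
\<close>

lemma represented_unique:
  fixes f :: "complex ^ 'n::finite \<Rightarrow> complex"
  assumes "represented_by R f a" "0 < R" "represented_by R' f b" "0 < R'"
  shows "a = b"
proof
  fix I :: "'n mixed_index"
  obtain p q where I: "I = pair_index p q" using pair_index_surj by blast
  have "multi_fact p \<noteq> 0" "multi_fact q \<noteq> 0" by (auto simp: multi_fact_def)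
  then show "a I = b I"
    using represented_coefficient[OF assms(1,2), of p q] represented_coefficient[OF assms(3,4), of p q]
    by (simp add: I)
qed

section \<open>Separately harmonic functions are given by power series\<close>

lemma linear_axis: "linear (axis j :: complex \<Rightarrow> complex ^ 'n::finite)"
  by (auto simp: linear_iff axis_def vec_eq_iff)

lemma frechet_derivative_axis:
  fixes f :: "complex ^ 'n::finite \<Rightarrow> complex"
  assumes "f differentiable (at x)"
  shows "frechet_derivative f (at x) (axis j h) = wirtinger j f x * h + wirtinger_bar j f x * cnj h"
proof -
  let ?L = "frechet_derivative f (at x)"
  have L: "linear ?L" using assms by (rule linear_frechet_derivative)
  have "(axis j h :: complex ^ 'n) = Re h *\<^sub>R axis j 1 + Im h *\<^sub>R axis j \<i>"
    by (auto simp: vec_eq_iff axis_def complex_eq_iff)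
  then have "?L (axis j h) = Re h *\<^sub>R ?L (axis j 1) + Im h *\<^sub>R ?L (axis j \<i>)"
    by (simp add: linear_add[OF L] linear_scale[OF L])
  also have "\<dots> = wirtinger j f x * h + wirtinger_bar j f x * cnj h"
    by (simp add: wirtinger_def wirtinger_bar_def complex_eq_iff field_simps)
  finally show ?thesis .
qed

lemma vupd_eq_axis: "vupd z j w = vupd z j 0 + axis j w"
  by (simp add: vec_eq_iff axis_def)

lemma section_has_derivative:
  fixes f :: "complex ^ 'n::finite \<Rightarrow> complex"
  assumes "f differentiable (at (vupd z j w))"
  shows "((\<lambda>w. f (vupd z j w)) has_derivative
     (\<lambda>h. wirtinger j f (vupd z j w) * h + wirtinger_bar j f (vupd z j w) * cnj h)) (at w)"
proof -
  have "((\<lambda>w. vupd z j 0 + axis j w) has_derivative (\<lambda>h. 0 + axis j h)) (at w)"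
    by (intro has_derivative_add has_derivative_const linear_imp_has_derivative linear_axis)
  then have "((\<lambda>w. vupd z j w) has_derivative axis j) (at w)"
    by (simp flip: vupd_eq_axis)
  moreover have "(f has_derivative frechet_derivative f (at (vupd z j w))) (at (vupd z j w))"
    using assms by (simp add: frechet_derivative_works)
  ultimately have "((\<lambda>w. f (vupd z j w)) has_derivative (\<lambda>h. frechet_derivative f (at (vupd z j w)) (axis j h))) (at w)"
    by (rule has_derivative_compose)
  then show ?thesis by (simp add: frechet_derivative_axis[OF assms])
qed

text \<open>
  These are the parts of the \<open>C\<^sup>2\<close> assumption that the restriction to one coordinate uses.
\<close>

lemma C2_wirtinger:
  fixes u :: "complex ^ 'n::finite \<Rightarrow> complex"
  assumes "Ck_on 2 S u"
  shows "\<And>x. x \<in> S \<Longrightarrow> u differentiable (at x)"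
    and "\<And>x. x \<in> S \<Longrightarrow> wirtinger_bar j u differentiable (at x)"
    and "continuous_on S (wirtinger j u)"
    and "continuous_on S (wirtinger j (wirtinger_bar j u))"
    and "continuous_on S (wirtinger_bar j (wirtinger_bar j u))"
proof -
  define g where "g = (\<lambda>v x. frechet_derivative u (at x) v)"
  have d1: "\<And>x. x \<in> S \<Longrightarrow> u differentiable (at x)"
    and d2: "\<And>x v. x \<in> S \<Longrightarrow> g v differentiable (at x)"
    and c2: "\<And>v w. continuous_on S (\<lambda>x. frechet_derivative (g v) (at x) w)"
    using assms by (auto simp: numeral_2_eq_2 g_def)
  have c1: "continuous_on S (g v)" for v
    by (intro continuous_at_imp_continuous_on ballI differentiable_imp_continuous_within d2)
  have wb: "wirtinger_bar j u = (\<lambda>x. (g (axis j 1) x + \<i> * g (axis j \<i>) x) / 2)"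
    by (simp add: wirtinger_bar_def g_def fun_eq_iff)
  have D: "(wirtinger_bar j u has_derivative
      (\<lambda>w. (frechet_derivative (g (axis j 1)) (at x) w + \<i> * frechet_derivative (g (axis j \<i>)) (at x) w) / 2)) (at x)"
    if "x \<in> S" for x
  proof -
    have h: "(g v has_derivative frechet_derivative (g v) (at x)) (at x)" for v
      using d2[OF that] by (simp add: frechet_derivative_works)
    show ?thesis
      unfolding wb divide_inverse
      by (intro has_derivative_mult_left has_derivative_add has_derivative_mult_right h)
  qed
  show "\<And>x. x \<in> S \<Longrightarrow> u differentiable (at x)" by (rule d1)
  show "\<And>x. x \<in> S \<Longrightarrow> wirtinger_bar j u differentiable (at x)"
    using D by (auto simp: differentiable_def)
  show "continuous_on S (wirtinger j u)"
    unfolding wirtinger_def[of j u, abs_def]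
    by (intro continuous_on_divide continuous_on_diff continuous_on_mult continuous_on_const c1[unfolded g_def]) simp
  have fd: "frechet_derivative (wirtinger_bar j u) (at x) w =
      (frechet_derivative (g (axis j 1)) (at x) w + \<i> * frechet_derivative (g (axis j \<i>)) (at x) w) / 2" if "x \<in> S" for x w
    by (simp add: frechet_derivative_at[OF D[OF that], symmetric])
  have c3: "continuous_on S (\<lambda>x. frechet_derivative (wirtinger_bar j u) (at x) w)" for w
  proof -
    have "continuous_on S (\<lambda>x. (frechet_derivative (g (axis j 1)) (at x) w + \<i> * frechet_derivative (g (axis j \<i>)) (at x) w) / 2)"
      by (intro continuous_on_divide continuous_on_add continuous_on_mult continuous_on_const c2) simp
    then show ?thesis by (rule continuous_on_cong[THEN iffD1, rotated -1]) (auto simp: fd)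
  qed
  show "continuous_on S (wirtinger j (wirtinger_bar j u))"
    unfolding wirtinger_def[of j "wirtinger_bar j u", abs_def]
    by (intro continuous_on_divide continuous_on_diff continuous_on_mult continuous_on_const c3) simp
  show "continuous_on S (wirtinger_bar j (wirtinger_bar j u))"
    unfolding wirtinger_bar_def[of j "wirtinger_bar j u", abs_def]
    by (intro continuous_on_divide continuous_on_add continuous_on_mult continuous_on_const c3) simp
qed

text \<open>
  The outcome of the expansion in one variable, for the dependence of \<open>u\<close> on the coordinate \<open>j\<close>.
\<close>

definition expands_in_coordinate ::
  "complex ^ 'n::finite \<Rightarrow> complex ^ 'n \<Rightarrow> (complex ^ 'n \<Rightarrow> complex) \<Rightarrow> real \<Rightarrow> 'n \<Rightarrow>
     (nat \<Rightarrow> nat \<Rightarrow> complex) \<Rightarrow> (nat \<Rightarrow> nat \<Rightarrow> real) \<Rightarrow> real \<Rightarrow> bool" where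
  "expands_in_coordinate \<alpha> \<beta> u r0 j \<kappa> s C \<longleftrightarrow>
    (\<forall>a b. 0 < s a b \<and> s a b \<le> r0) \<and> (\<forall>a b. norm (\<kappa> a b) \<le> C / r0 ^ (a + b)) \<and>
    (\<forall>a b. s (Suc a) (Suc b) = s a b) \<and>
    (\<forall>a b. of_nat (Suc a) * of_nat (Suc b) * \<kappa> (Suc a) (Suc b) = (of_nat a - \<beta> $ j) * (of_nat b - \<alpha> $ j) * \<kappa> a b) \<and>
    (\<forall>z. (\<forall>k. norm (z $ k) \<le> r0) \<longrightarrow> norm (z $ j) < r0 \<longrightarrow>
       ((\<lambda>(a, b). \<kappa> a b * circle_coeff (int a - int b) (\<lambda>w. u (vupd z j w)) (s a b) * (z $ j ^ a * cnj (z $ j) ^ b))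
          has_sum u z) UNIV)"

lemma harmonic_section_expansion:
  fixes u :: "complex ^ 'n::finite \<Rightarrow> complex"
  assumes harm: "separately_harmonic \<alpha> \<beta> u" and r0: "0 < r0" "r0 < 1"
  shows "\<exists>\<kappa> s C. expands_in_coordinate \<alpha> \<beta> u r0 j \<kappa> s C"
proof -
  have C2: "Ck_on 2 polydisc u" and pde: "\<And>j z. z \<in> polydisc \<Longrightarrow> L_op \<alpha> \<beta> j u z = 0"
    using harm by (auto simp: separately_harmonic_def)
  note W = C2_wirtinger[OF C2]
  obtain \<kappa> s C where K: "\<And>a b. 0 < s a b \<and> s a b \<le> r0" "\<And>a b. norm (\<kappa> a b) \<le> C / r0 ^ (a + b)"
    "\<And>a b. s (Suc a) (Suc b) = s a b"
    "\<And>a b. of_nat (Suc a) * of_nat (Suc b) * \<kappa> (Suc a) (Suc b) = (of_nat a - \<beta> $ j) * (of_nat b - \<alpha> $ j) * \<kappa> a b"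
    and E: "\<And>f z. disc_harmonic (\<alpha> $ j) (\<beta> $ j) f \<Longrightarrow> norm z < r0 \<Longrightarrow>
       ((\<lambda>(a, b). \<kappa> a b * circle_coeff (int a - int b) f (s a b) * (z ^ a * cnj z ^ b)) has_sum f z) UNIV"
    by (rule one_variable_expansion[OF r0, where \<alpha> = "\<alpha> $ j" and \<beta> = "\<beta> $ j"]) (rule that)
  have "((\<lambda>(a, b). \<kappa> a b * circle_coeff (int a - int b) (\<lambda>w. u (vupd z j w)) (s a b) * (z $ j ^ a * cnj (z $ j) ^ b))
          has_sum u z) UNIV" if z: "\<forall>k. norm (z $ k) \<le> r0" "norm (z $ j) < r0" for z
  proof -
    have v: "vupd z j w \<in> polydisc" if "norm w < 1" for w
      using z r0 that by (auto simp: polydisc_def intro: le_less_trans)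
    have cv: "continuous_on (ball 0 1) (vupd z j)"
    proof -
      have "continuous_on (ball 0 1) (\<lambda>w. vupd z j 0 + axis j w)"
        by (intro continuous_on_add continuous_on_const linear_continuous_on linear_conv_bounded_linear[THEN iffD1] linear_axis)
      then show ?thesis by (simp flip: vupd_eq_axis)
    qed
    have vi: "vupd z j ` ball 0 1 \<subseteq> polydisc" using v by auto
    have "disc_harmonic (\<alpha> $ j) (\<beta> $ j) (\<lambda>w. u (vupd z j w))"
      unfolding disc_harmonic_def
    proof (rule exI[of _ "\<lambda>w. wirtinger j u (vupd z j w)"], rule exI[of _ "\<lambda>w. wirtinger_bar j u (vupd z j w)"],
        rule exI[of _ "\<lambda>w. wirtinger j (wirtinger_bar j u) (vupd z j w)"],
        rule exI[of _ "\<lambda>w. wirtinger_bar j (wirtinger_bar j u) (vupd z j w)"], intro conjI allI impI)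
      show "((\<lambda>w. u (vupd z j w)) has_derivative (\<lambda>h. wirtinger j u (vupd z j w) * h + wirtinger_bar j u (vupd z j w) * cnj h)) (at w)"
        if "norm w < 1" for w by (rule section_has_derivative[OF W(1)[OF v[OF that]]])
      show "((\<lambda>w. wirtinger_bar j u (vupd z j w)) has_derivative (\<lambda>h. wirtinger j (wirtinger_bar j u) (vupd z j w) * h
          + wirtinger_bar j (wirtinger_bar j u) (vupd z j w) * cnj h)) (at w)"
        if "norm w < 1" for w by (rule section_has_derivative[OF W(2)[OF v[OF that]]])
      show "continuous_on (ball 0 1) (\<lambda>w. wirtinger j u (vupd z j w))"
        by (rule continuous_on_compose2[OF W(3) cv vi])
      show "continuous_on (ball 0 1) (\<lambda>w. wirtinger j (wirtinger_bar j u) (vupd z j w))"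
        by (rule continuous_on_compose2[OF W(4) cv vi])
      show "continuous_on (ball 0 1) (\<lambda>w. wirtinger_bar j (wirtinger_bar j u) (vupd z j w))"
        by (rule continuous_on_compose2[OF W(5) cv vi])
      show "(1 - of_real ((norm w)\<^sup>2)) * wirtinger j (wirtinger_bar j u) (vupd z j w) + \<alpha> $ j * w * wirtinger j u (vupd z j w)
          + \<beta> $ j * cnj w * wirtinger_bar j u (vupd z j w) - \<alpha> $ j * \<beta> $ j * u (vupd z j w) = 0" if "norm w < 1" for w
        using pde[OF v[OF that], of j] by (simp add: L_op_def)
    qed
    from E[OF this z(2)] show ?thesis by simp
  qed
  with K have "expands_in_coordinate \<alpha> \<beta> u r0 j \<kappa> s C" unfolding expands_in_coordinate_def by blast
  then show ?thesis by blast
qed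

text \<open>
  After all coordinates have been expanded the coefficients are constant in \<open>z\<close>, so they may be
  evaluated at \<open>0\<close>.
\<close>

lemma harmonic_represented_inside:
  fixes u :: "complex ^ 'n::finite \<Rightarrow> complex"
  assumes harm: "separately_harmonic \<alpha> \<beta> u" and r0: "0 < r0" "r0 < 1"
  shows "\<exists>a. represented_by r0 u a \<and>
    (\<forall>I j. harmonic_recursion \<alpha> \<beta> a I j)"
proof -
  define P where "P = {z :: complex ^ 'n. \<forall>k. norm (z $ k) \<le> r0}"
  obtain \<kappa> s K where "\<And>j. expands_in_coordinate \<alpha> \<beta> u r0 j (\<kappa> j) (s j) (K j)"
    using harmonic_section_expansion[OF harm r0] by metis
  then have K: "\<And>j a b. 0 < s j a b \<and> s j a b \<le> r0" "\<And>j a b. norm (\<kappa> j a b) \<le> K j / r0 ^ (a + b)"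
    "\<And>j a b. s j (Suc a) (Suc b) = s j a b"
    "\<And>j a b. of_nat (Suc a) * of_nat (Suc b) * \<kappa> j (Suc a) (Suc b) = (of_nat a - \<beta> $ j) * (of_nat b - \<alpha> $ j) * \<kappa> j a b"
    "\<And>j. \<forall>z\<in>P. norm (z $ j) < r0 \<longrightarrow>
       ((\<lambda>(a, b). \<kappa> j a b * circle_coeff (int a - int b) (\<lambda>w. u (vupd z j w)) (s j a b) * (z $ j ^ a * cnj (z $ j) ^ b))
          has_sum u z) UNIV"
    unfolding expands_in_coordinate_def P_def mem_Collect_eq by blast+
  have "continuous_on polydisc u"
    using C2_wirtinger(1) harm
    by (intro continuous_at_imp_continuous_on ballI differentiable_imp_continuous_within) (auto simp: separately_harmonic_def)
  then have cu: "continuous_on P u"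
    by (rule continuous_on_subset) (use r0 in \<open>auto simp: P_def polydisc_def intro: le_less_trans\<close>)
  have U: "indices_on (UNIV :: 'n set) = UNIV" by (simp add: indices_on_def)
  obtain A C where A_bound: "\<And>I z. z \<in> P \<Longrightarrow> norm (A I z) \<le> C / r0 ^ total_degree I"
    and A_sum: "\<And>z. z \<in> P \<Longrightarrow> (\<And>j. norm (z $ j) < r0) \<Longrightarrow> ((\<lambda>I. A I z * mixed_monomial I z) has_sum u z) UNIV"
    and A_rec: "\<And>I j z. z \<in> P \<Longrightarrow>
         harmonic_recursion \<alpha> \<beta> (\<lambda>I. A I z) I j"
    and A_const: "\<And>I j z w. z \<in> P \<Longrightarrow> norm w \<le> r0 \<Longrightarrow> A I (vupd z j w) = A I z"
    using polydisc_expansion[where u = u and \<kappa> = \<kappa> and s = s and K = K and \<alpha> = \<alpha> and \<beta> = \<beta> and S = "UNIV :: 'n set",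
        OF r0(1), folded P_def, OF cu K finite_class.finite_UNIV]
    unfolding U apply (elim exE conjE)
    subgoal for A C by (rule that[of A C]) (simp_all del: of_nat_Suc)
    done
  define a where "a = (\<lambda>I. A I 0)"
  have A_eq: "A I z = a I" if z: "z \<in> P" for I z
  proof -
    have "A I (\<chi> k. if k \<in> T then 0 else z $ k) = A I z \<and> (\<chi> k. if k \<in> T then 0 else z $ k) \<in> P" if "finite T" for T
      using that
    proof (induction T rule: finite_induct)
      case empty
      then show ?case using z by (simp add: vec_nth_inverse)
    next
      case (insert j T)
      have e: "(\<chi> k. if k \<in> insert j T then 0 else z $ k) = vupd (\<chi> k. if k \<in> T then 0 else z $ k) j 0"
        by (auto simp: vec_eq_iff)
      show ?case unfolding e using insert.IH A_const[of "\<chi> k. if k \<in> T then 0 else z $ k" 0 I j] r0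
        by (auto simp: P_def)
    qed
    from this[of UNIV] show ?thesis by (simp add: a_def zero_vec_def)
  qed
  have zP: "(0 :: complex ^ 'n) \<in> P" using r0 by (simp add: P_def)
  have conv: "converges_on_pdisc r0 a"
    unfolding converges_on_pdisc_def
  proof (intro allI impI)
    fix r :: real assume r: "0 \<le> r" "r < r0"
    have "(\<lambda>I::'n \<times> bool \<Rightarrow> nat. C * (r / r0) ^ total_degree I) summable_on UNIV"
      by (intro summable_on_cmult_right summable_on_geometric_multi) (use r r0 in auto)
    then show "(\<lambda>I. norm (a I) * r ^ total_degree I) summable_on UNIV"
    proof (rule summable_on_comparison_test)
      fix I
      have "norm (a I) * r ^ total_degree I \<le> (C / r0 ^ total_degree I) * r ^ total_degree I"
        unfolding a_def by (intro mult_right_mono A_bound zP) (use r in auto)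
      then show "norm (a I) * r ^ total_degree I \<le> C * (r / r0) ^ total_degree I"
        by (simp add: power_divide)
    qed (use r in auto)
  qed
  have "u z = mixed_series a z" if z: "z \<in> pdisc r0" for z
  proof -
    have "z \<in> P" using z by (auto simp: P_def pdisc_def less_imp_le)
    moreover have "norm (z $ j) < r0" for j using z by (simp add: pdisc_def)
    ultimately have "((\<lambda>I. A I z * mixed_monomial I z) has_sum u z) UNIV" by (rule A_sum)
    then show ?thesis unfolding mixed_series_def using A_eq[OF \<open>z \<in> P\<close>] by (simp add: infsumI)
  qed
  with conv A_rec[OF zP] show ?thesis
    by (intro exI[of _ a]) (simp add: represented_by_def a_def del: of_nat_Suc)
qed

text \<open>
  By uniqueness of coefficients the expansions on all polydiscs of radius below \<open>1\<close> agree.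
\<close>

lemma harmonic_represented:
  fixes u :: "complex ^ 'n::finite \<Rightarrow> complex"
  assumes harm: "separately_harmonic \<alpha> \<beta> u"
  obtains a where "represented_by 1 u a"
    "\<And>I j. harmonic_recursion \<alpha> \<beta> a I j"
proof -
  obtain a where a: "represented_by (1/2) u a"
    "\<And>I j. harmonic_recursion \<alpha> \<beta> a I j"
    using harmonic_represented_inside[OF harm, of "1/2"] by (auto simp del: of_nat_Suc)
  have rep: "represented_by r u a" if r: "0 < r" "r < 1" for r
  proof -
    obtain b where "represented_by r u b" using harmonic_represented_inside[OF harm r] by blast
    moreover from this have "a = b" using represented_unique[OF a(1)] r by simp
    ultimately show ?thesis by simp
  qed
  have "represented_by 1 u a"
    unfolding represented_by_def
  proof (intro conjI ballI)
    show "converges_on_pdisc 1 a"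
      unfolding converges_on_pdisc_def
    proof (intro allI impI)
      fix r :: real assume r: "0 \<le> r" "r < 1"
      then have "represented_by ((r + 1) / 2) u a" by (intro rep) auto
      then show "(\<lambda>I. norm (a I) * r ^ total_degree I) summable_on UNIV"
        using r by (auto simp: represented_by_def converges_on_pdisc_def)
    qed
    fix z :: "complex ^ 'n" assume z: "z \<in> pdisc 1"
    obtain r where "0 < r" "r < 1" "z \<in> pdisc r" using pdisc_shrink[OF z] by auto
    then show "u z = mixed_series a z" using rep[of r] by (auto simp: represented_by_def)
  qed
  then show ?thesis using a(2) by (rule that)
qed

section \<open>Grouping the power series into hypergeometric blocks\<close>

text \<open>
  The element of \<open>H\<close> that indexes the block of \<open>I\<close>: subtract the common part of the exponents of each
  coordinate and its conjugate. The preimages of this map are parametrized by \<open>diagonal_shift\<close>.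
\<close>

definition index_reduct :: "'n::finite mixed_index \<Rightarrow> (nat ^ 'n) \<times> (nat ^ 'n)" where
  "index_reduct I = ((\<chi> j. I (j, False) - min (I (j, False)) (I (j, True))),
                     (\<chi> j. I (j, True) - min (I (j, False)) (I (j, True))))"

lemma index_reduct_in_H: "index_reduct I \<in> index_H"
  by (auto simp: index_reduct_def index_H_def min_def)

definition diagonal_shift :: "nat ^ 'n::finite \<Rightarrow> nat ^ 'n \<Rightarrow> ('n \<Rightarrow> nat) \<Rightarrow> 'n mixed_index" where
  "diagonal_shift p q m x = pair_index p q x + m (fst x)"

lemma inj_diagonal_shift: "inj (diagonal_shift p q)"
proof (rule injI)
  fix m m' assume "diagonal_shift p q m = diagonal_shift p q m'"
  then have "diagonal_shift p q m (j, False) = diagonal_shift p q m' (j, False)" for j by simp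
  then show "m = m'" by (auto simp: diagonal_shift_def)
qed

lemma range_diagonal_shift:
  assumes "(p, q) \<in> index_H"
  shows "range (diagonal_shift p q) = {I. index_reduct I = (p, q)}"
proof (intro set_eqI iffI)
  fix I assume "I \<in> range (diagonal_shift p q)"
  then obtain m where I: "I = diagonal_shift p q m" by blast
  have "p $ j = 0 \<or> q $ j = 0" for j
    using assms by (simp add: index_H_def)
  then have "min (p $ j + m j) (q $ j + m j) = m j" for j
    using min.absorb1 min.absorb2 by (metis add_0 le_add2)
  then show "I \<in> {I. index_reduct I = (p, q)}"
    by (auto simp: I index_reduct_def diagonal_shift_def pair_index_def vec_eq_iff)
next
  fix I :: "'a mixed_index" assume "I \<in> {I. index_reduct I = (p, q)}"
  then have pq: "\<And>j. p $ j = I (j, False) - min (I (j, False)) (I (j, True))"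
    "\<And>j. q $ j = I (j, True) - min (I (j, False)) (I (j, True))"
    by (auto simp: index_reduct_def vec_eq_iff)
  have "I = diagonal_shift p q (\<lambda>j. min (I (j, False)) (I (j, True)))"
  proof
    fix x show "I x = diagonal_shift p q (\<lambda>j. min (I (j, False)) (I (j, True))) x"
      by (cases x; cases "snd x") (auto simp: diagonal_shift_def pair_index_def pq)
  qed
  then show "I \<in> range (diagonal_shift p q)" by blast
qed

text \<open>
  The recursion for the coefficients \<open>a\<close> and that for \<open>hg_coeff\<close> are the same, in each coordinate.
\<close>

lemma coefficient_along_diagonal:
  fixes a :: "'n::finite mixed_index \<Rightarrow> complex" and \<alpha> \<beta> :: "complex ^ 'n"
  assumes rec: "\<And>I j. harmonic_recursion \<alpha> \<beta> a I j"
  shows "a (diagonal_shift p q m) = a (pair_index p q) * (\<Prod>j\<in>UNIV. hg_coeff (\<alpha> $ j) (\<beta> $ j) (p $ j) (q $ j) (m j))"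
proof (induction "\<Sum>j\<in>UNIV. m j" arbitrary: m)
  case 0
  then have "m = (\<lambda>_. 0)" by auto
  then show ?case by (simp add: diagonal_shift_def[abs_def])
next
  case (Suc n)
  then obtain j where j: "m j \<noteq> 0" by (metis sum.neutral nat.distinct(1))
  then obtain k where k: "m j = Suc k" using not0_implies_Suc by blast
  define m' where "m' = m(j := k)"
  have "(\<Sum>i\<in>UNIV. m i) = m j + (\<Sum>i\<in>UNIV - {j}. m i)" "(\<Sum>i\<in>UNIV. m' i) = m' j + (\<Sum>i\<in>UNIV - {j}. m' i)"
    by (simp_all add: sum.remove)
  moreover have "(\<Sum>i\<in>UNIV - {j}. m' i) = (\<Sum>i\<in>UNIV - {j}. m i)"
    by (rule sum.cong) (auto simp: m'_def)
  ultimately have "n = (\<Sum>i\<in>UNIV. m' i)" using Suc.hyps(2) k by (simp add: m'_def)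
  from Suc.hyps(1)[OF this]
  have IH: "a (diagonal_shift p q m') = a (pair_index p q) * (\<Prod>i\<in>UNIV. hg_coeff (\<alpha> $ i) (\<beta> $ i) (p $ i) (q $ i) (m' i))" .
  let ?P = "\<Prod>i\<in>UNIV - {j}. hg_coeff (\<alpha> $ i) (\<beta> $ i) (p $ i) (q $ i) (m i)"
  let ?c = "hg_coeff (\<alpha> $ j) (\<beta> $ j) (p $ j) (q $ j)"
  have P': "(\<Prod>i\<in>UNIV. hg_coeff (\<alpha> $ i) (\<beta> $ i) (p $ i) (q $ i) (m' i)) = ?c k * ?P"
    by (subst prod.remove[of UNIV j]) (auto simp: m'_def intro!: prod.cong)
  have P: "(\<Prod>i\<in>UNIV. hg_coeff (\<alpha> $ i) (\<beta> $ i) (p $ i) (q $ i) (m i)) = ?c (Suc k) * ?P"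
    by (subst prod.remove[of UNIV j]) (auto simp: k)
  let ?I = "diagonal_shift p q m'"
  have I: "?I (j, False) = p $ j + k" "?I (j, True) = q $ j + k"
    by (auto simp: diagonal_shift_def pair_index_def m'_def)
  have shift: "set_pair j (Suc (?I (j, False))) (Suc (?I (j, True))) ?I = diagonal_shift p q m"
  proof
    fix x
    show "set_pair j (Suc (?I (j, False))) (Suc (?I (j, True))) ?I x = diagonal_shift p q m x"
      unfolding I using k
      by (cases x; cases "fst x = j"; cases "snd x") (auto simp: diagonal_shift_def pair_index_def m'_def)
  qed
  have "of_nat (p $ j + k + 1) * of_nat (q $ j + k + 1) * a (diagonal_shift p q m)
      = (of_nat (p $ j + k) - \<beta> $ j) * (of_nat (q $ j + k) - \<alpha> $ j) * a ?I"
    using rec[of ?I j] unfolding harmonic_recursion_def shift unfolding I by simp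
  also have "\<dots> = a (pair_index p q) * ?P * ((of_nat (p $ j + k) - \<beta> $ j) * (of_nat (q $ j + k) - \<alpha> $ j) * ?c k)"
    unfolding IH P' by (simp only: mult_ac)
  also have "\<dots> = of_nat (p $ j + k + 1) * of_nat (q $ j + k + 1) * (a (pair_index p q) * (?c (Suc k) * ?P))"
    unfolding hg_coeff_Suc[symmetric] by (simp only: mult_ac)
  finally have "of_nat (p $ j + k + 1) * of_nat (q $ j + k + 1) * a (diagonal_shift p q m)
      = of_nat (p $ j + k + 1) * of_nat (q $ j + k + 1) * (a (pair_index p q) * (?c (Suc k) * ?P))" .
  moreover have "complex_of_nat (p $ j + k + 1) * of_nat (q $ j + k + 1) \<noteq> 0"
    by (simp only: mult_eq_0_iff of_nat_eq_0_iff) simp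
  ultimately have "a (diagonal_shift p q m) = a (pair_index p q) * (?c (Suc k) * ?P)"
    using mult_left_cancel by blast
  then show ?case unfolding P .
qed

lemma gauss_F_infsum:
  assumes pq: "p * q = 0" and X: "norm X < 1"
  shows "(\<Sum>\<^sub>\<infinity>m. hg_coeff \<alpha> \<beta> p q m * X ^ m) = gauss_F (of_nat p - \<beta>) (of_nat q - \<alpha>) (of_nat (p + q + 1)) X"
proof -
  note eq = infsumI[OF hg_coeff_has_sum[OF X, of \<alpha> \<beta> p q]]
  have "(\<lambda>m. hg_coeff \<alpha> \<beta> p q m * X ^ m) = (\<lambda>m. pochhammer (of_nat p - \<beta>) m * pochhammer (of_nat q - \<alpha>) m /
      pochhammer (of_nat (p + q + 1)) m * (X ^ m / fact m))"
  proof
    fix m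
    have "pochhammer (of_nat p + 1) m * pochhammer (of_nat q + 1) m = pochhammer (of_nat (p + q + 1)) m * (fact m :: complex)"
      using pq by (auto simp: pochhammer_fact add.commute)
    then show "hg_coeff \<alpha> \<beta> p q m * X ^ m = pochhammer (of_nat p - \<beta>) m * pochhammer (of_nat q - \<alpha>) m /
      pochhammer (of_nat (p + q + 1)) m * (X ^ m / fact m)"
      by (simp add: hg_coeff_def rising_ratio_def)
  qed
  with eq show "(\<Sum>\<^sub>\<infinity>m. hg_coeff \<alpha> \<beta> p q m * X ^ m) = gauss_F (of_nat p - \<beta>) (of_nat q - \<alpha>) (of_nat (p + q + 1)) X"
    unfolding gauss_F_def by (simp only:)
qed

lemma prod_UNIV_bool_pairs:
  fixes F :: "'n::finite \<times> bool \<Rightarrow> 'a::comm_monoid_mult"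
  shows "(\<Prod>m\<in>UNIV. F m) = (\<Prod>j\<in>UNIV. F (j, False) * F (j, True))"
proof -
  have "(\<Prod>m\<in>UNIV. F m) = (\<Prod>j\<in>UNIV. \<Prod>e\<in>UNIV. F (j, e))"
    by (simp add: prod.cartesian_product)
  then show ?thesis by (simp add: UNIV_bool)
qed

lemma mixed_monomial_pair_index:
  "mixed_monomial (pair_index p q) z = multi_power z p * multi_power_cnj z q"
  unfolding mixed_monomial_def prod_UNIV_bool_pairs
  by (simp add: pair_index_def real_coord_def multi_power_def multi_power_cnj_def prod.distrib)

lemma mixed_monomial_diagonal_shift:
  "mixed_monomial (diagonal_shift p q m) z =
     mixed_monomial (pair_index p q) z * (\<Prod>j\<in>UNIV. of_real ((cmod (z $ j))\<^sup>2) ^ m j)"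
  unfolding mixed_monomial_def prod_UNIV_bool_pairs prod.distrib[symmetric] complex_norm_square
  by (rule prod.cong) (auto simp: diagonal_shift_def real_coord_def power_add power_mult_distrib mult_ac)

text \<open>
  On the block of \<open>(p, q)\<close> the power series factors into the leading monomial and one series in
  \<open>|z\<^sub>j|\<^sup>2\<close> for every \<open>j\<close>, which is a hypergeometric function.
\<close>

lemma represented_series_term:
  fixes a :: "'n::finite mixed_index \<Rightarrow> complex" and \<alpha> \<beta> :: "complex ^ 'n"
  assumes a: "represented_by 1 u a"
    and rec: "\<And>I j. harmonic_recursion \<alpha> \<beta> a I j"
    and i: "i \<in> index_H"
  shows "represented_by 1 (series_term \<alpha> \<beta> u i) (\<lambda>I. if index_reduct I = i then a I else 0)"
  unfolding represented_by_def
proof (intro conjI ballI)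
  have conv: "converges_on_pdisc 1 a" using a by (simp add: represented_by_def)
  show "converges_on_pdisc 1 (\<lambda>I. if index_reduct I = i then a I else 0)"
    unfolding converges_on_pdisc_def
  proof (intro allI impI)
    fix r :: real assume r: "0 \<le> r" "r < 1"
    then have "(\<lambda>I. norm (a I) * r ^ total_degree I) summable_on UNIV"
      using conv by (simp add: converges_on_pdisc_def)
    then show "(\<lambda>I. norm (if index_reduct I = i then a I else 0) * r ^ total_degree I) summable_on UNIV"
      by (rule summable_on_comparison_test) (use r in auto)
  qed
  fix z :: "complex ^ 'n" assume z: "z \<in> pdisc 1"
  obtain p q where pq: "i = (p, q)" by (cases i)
  have H: "(p, q) \<in> index_H" "\<And>j. p $ j * q $ j = 0" using i by (auto simp: pq index_H_def)
  define X where "X = (\<lambda>j. complex_of_real ((cmod (z $ j))\<^sup>2))"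
  have X: "norm (X j) < 1" for j
    using z by (auto simp: X_def pdisc_def norm_power power_less_one_iff)
  define T where "T = (\<lambda>j m. hg_coeff (\<alpha> $ j) (\<beta> $ j) (p $ j) (q $ j) m * X j ^ m)"
  have "mixed_series (\<lambda>I. if index_reduct I = i then a I else 0) z
      = (\<Sum>\<^sub>\<infinity>I\<in>range (diagonal_shift p q). a I * mixed_monomial I z)"
    unfolding mixed_series_def range_diagonal_shift[OF H(1)] by (rule infsum_cong_neutral) (auto simp: pq)
  also have "\<dots> = (\<Sum>\<^sub>\<infinity>m. a (diagonal_shift p q m) * mixed_monomial (diagonal_shift p q m) z)"
    by (subst infsum_reindex[OF inj_diagonal_shift]) (simp add: o_def)
  also have "\<dots> = (\<Sum>\<^sub>\<infinity>m. a (pair_index p q) * mixed_monomial (pair_index p q) z * (\<Prod>j\<in>UNIV. T j (m j)))"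
    by (simp add: coefficient_along_diagonal[OF rec] mixed_monomial_diagonal_shift T_def X_def prod.distrib mult_ac
        del: of_real_power)
  also have "\<dots> = a (pair_index p q) * mixed_monomial (pair_index p q) z * (\<Sum>\<^sub>\<infinity>m. \<Prod>j\<in>UNIV. T j (m j))"
    by (rule infsum_cmult_right')
  also have "(\<Sum>\<^sub>\<infinity>m. \<Prod>j\<in>UNIV. T j (m j)) = (\<Sum>\<^sub>\<infinity>m\<in>PiE UNIV (\<lambda>_. UNIV). \<Prod>j\<in>UNIV. T j (m j))"
    by simp
  also have "\<dots> = (\<Prod>j\<in>UNIV. \<Sum>\<^sub>\<infinity>m. T j m)"
    by (rule infsum_prod_PiE_abs) (auto simp: T_def intro!: abs_summable_hg_coeff X)
  also have "\<dots> = F_pq \<alpha> \<beta> p q z"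
    unfolding F_pq_def T_def using gauss_F_infsum[OF H(2) X] by (simp add: X_def)
  finally have "mixed_series (\<lambda>I. if index_reduct I = i then a I else 0) z
      = a (pair_index p q) * mixed_monomial (pair_index p q) z * F_pq \<alpha> \<beta> p q z" .
  moreover have "a (pair_index p q) = wirtinger_multi p q u 0 / (of_nat (multi_fact p) * of_nat (multi_fact q))"
  proof -
    have "multi_fact p \<noteq> 0" "multi_fact q \<noteq> 0" by (auto simp: multi_fact_def)
    then show ?thesis using represented_coefficient[OF a, of p q] by simp
  qed
  ultimately show "series_term \<alpha> \<beta> u i z = mixed_series (\<lambda>I. if index_reduct I = i then a I else 0) z"
    by (simp add: pq series_term_def mixed_monomial_pair_index mult_ac)
qed

text \<open>
  Grouping a summable family along the fibres of \<open>\<rho>\<close> keeps its sum, so the part outside finitely many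
  fibres is the tail of a convergent sum over \<open>H\<close>.
\<close>

lemma infsum_outside_finite_tendsto:
  fixes G :: "'i \<Rightarrow> real" and \<rho> :: "'i \<Rightarrow> 'h"
  assumes G: "G summable_on UNIV" and \<rho>: "\<And>I. \<rho> I \<in> H"
  shows "((\<lambda>A. \<Sum>\<^sub>\<infinity>I. if \<rho> I \<in> A then 0 else G I) \<longlongrightarrow> 0) (finite_subsets_at_top H)"
proof -
  define B where "B = (\<lambda>h. {I. \<rho> I = h})"
  have fiber: "G summable_on B h" for h by (rule summable_on_subset_banach[OF G]) simp
  have "(G has_sum infsum G UNIV) UNIV \<longleftrightarrow> ((\<lambda>(h, I). G I) has_sum infsum G UNIV) (Sigma H B)"
    by (rule has_sum_reindex_bij_witness[of _ snd "\<lambda>I. (\<rho> I, I)"]) (use \<rho> in \<open>auto simp: B_def\<close>)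
  then have "((\<lambda>(h, I). G I) has_sum infsum G UNIV) (Sigma H B)"
    using has_sum_infsum[OF G] by simp
  then have "((\<lambda>h. infsum G (B h)) has_sum infsum G UNIV) H"
    by (rule has_sum_SigmaD) (use fiber in auto)
  then have lim: "((\<lambda>A. infsum G UNIV - (\<Sum>h\<in>A. infsum G (B h))) \<longlongrightarrow> infsum G UNIV - infsum G UNIV) (finite_subsets_at_top H)"
    unfolding has_sum_def by (intro tendsto_diff tendsto_const)
  have "\<forall>\<^sub>F A in finite_subsets_at_top H. infsum G UNIV - (\<Sum>h\<in>A. infsum G (B h)) = (\<Sum>\<^sub>\<infinity>I. if \<rho> I \<in> A then 0 else G I)"
    using eventually_finite_subsets_at_top_weakI[of H "\<lambda>A. finite A"]
  proof (rule eventually_mono)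
    fix A :: "'h set" assume A: "finite A"
    have "(\<Sum>h\<in>A. infsum G (B h)) = infsum G (\<Union>h\<in>A. B h)"
      by (rule sum_infsum) (use A fiber in \<open>auto simp: B_def\<close>)
    also have "(\<Union>h\<in>A. B h) = {I. \<rho> I \<in> A}" by (auto simp: B_def)
    finally have 1: "(\<Sum>h\<in>A. infsum G (B h)) = infsum G {I. \<rho> I \<in> A}" .
    have "infsum G UNIV = infsum G ({I. \<rho> I \<in> A} \<union> {I. \<rho> I \<notin> A})" by (rule arg_cong[of _ _ "infsum G"]) auto
    also have "\<dots> = infsum G {I. \<rho> I \<in> A} + infsum G {I. \<rho> I \<notin> A}"
      by (rule infsum_Un_disjoint) (auto intro: summable_on_subset_banach[OF G])
    also have "infsum G {I. \<rho> I \<notin> A} = (\<Sum>\<^sub>\<infinity>I. if \<rho> I \<in> A then 0 else G I)"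
      by (rule infsum_cong_neutral) auto
    finally show "infsum G UNIV - (\<Sum>h\<in>A. infsum G (B h)) = (\<Sum>\<^sub>\<infinity>I. if \<rho> I \<in> A then 0 else G I)"
      using 1 by simp
  qed auto
  then show ?thesis using lim by (simp add: tendsto_cong)
qed

lemma compact_in_polydisc_bound:
  fixes K :: "(complex ^ 'n::finite) set"
  assumes "compact K" "K \<subseteq> polydisc"
  obtains r where "0 \<le> r" "r < 1" "\<And>z j. z \<in> K \<Longrightarrow> norm (z $ j) \<le> r"
proof (cases "K = {}")
  case True
  then show ?thesis by (intro that[of 0]) auto
next
  case False
  have "\<exists>x\<in>K. \<forall>z\<in>K. norm (z $ j) \<le> norm (x $ j)" for j
    by (rule continuous_attains_sup[OF assms(1) False]) (intro continuous_intros)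
  then obtain x where x: "\<And>j. x j \<in> K" "\<And>j z. z \<in> K \<Longrightarrow> norm (z $ j) \<le> norm (x j $ j)" by metis
  define r where "r = Max (range (\<lambda>j. norm (x j $ j)))"
  have le: "norm (x j $ j) \<le> r" for j by (simp add: r_def)
  show ?thesis
  proof (rule that[of r])
    show "0 \<le> r" using order_trans[OF norm_ge_zero le] .
    show "r < 1" unfolding r_def using x(1) assms(2) by (auto simp: polydisc_def)
    show "norm (z $ j) \<le> r" if "z \<in> K" for z j using x(2)[OF that] le order_trans by blast
  qed
qed

theorem theorem2p10:
  fixes \<alpha> \<beta> :: "complex ^ 'n::finite" and u :: "complex ^ 'n \<Rightarrow> complex"
  assumes "\<And>j. Re (\<alpha> $ j) + Re (\<beta> $ j) > -1"
    and "\<And>j. \<alpha> $ j \<notin> {- of_nat m | m::nat. m \<ge> 1}"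
    and "\<And>j. \<beta> $ j \<notin> {- of_nat m | m::nat. m \<ge> 1}"
    and "separately_harmonic \<alpha> \<beta> u"
  shows "(\<forall>z\<in>polydisc. ((\<lambda>i. series_term \<alpha> \<beta> u i z) has_sum u z) index_H)
    \<and> has_sum_Cinf (series_term \<alpha> \<beta> u) u index_H"
proof -
  let ?D = "\<lambda>A z. (\<Sum>i\<in>A. series_term \<alpha> \<beta> u i z) - u z"
  obtain a where a: "represented_by 1 u a"
    and rec: "\<And>I j. harmonic_recursion \<alpha> \<beta> a I j"
    using harmonic_represented[OF assms(4)] by blast
  note terms = represented_series_term[OF a rec]
  have smooth: "Cinf_on polydisc f" if "represented_by 1 f b" for f and b :: "'n mixed_index \<Rightarrow> complex"
    using represented_Ck_on[OF that] by (simp add: Cinf_on_def polydisc_eq_pdisc)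
  have lim: "((\<lambda>A. Cinf_seminorm K p q (?D A)) \<longlongrightarrow> 0) (finite_subsets_at_top index_H)"
    if K: "compact K" "K \<noteq> {}" "K \<subseteq> polydisc" for K p q
  proof -
    obtain r where r: "0 \<le> r" "r < 1" "\<And>z j. z \<in> K \<Longrightarrow> norm (z $ j) \<le> r"
      using compact_in_polydisc_bound[OF K(1,3)] by blast
    let ?N = "pair_index p q"
    \<comment> \<open>\<open>G I\<close> bounds on \<open>K\<close> the term of index \<open>I\<close> of the derivative of \<open>u\<close>; that term arises from the
           term \<open>I + ?N\<close> of \<open>u\<close>, whose block is \<open>\<rho> I\<close>\<close>
    define G where "G = (\<lambda>I. norm (coeff_deriv_multi ?N a I) * r ^ total_degree I)"
    have G: "G summable_on UNIV"
      using represented_wirtinger_multi[OF a, of p q] r by (simp add: G_def represented_by_def converges_on_pdisc_def)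
    define \<rho> where "\<rho> = (\<lambda>I. index_reduct (\<lambda>m. I m + ?N m))"
    let ?T = "\<lambda>A. \<Sum>\<^sub>\<infinity>I. if \<rho> I \<in> A then 0 else G I"
    have bound: "0 \<le> Cinf_seminorm K p q (?D A) \<and>
        Cinf_seminorm K p q (?D A) \<le> ?T A"
      if A: "finite A" "A \<subseteq> index_H" for A
    proof -
      define b where "b = (\<lambda>I. if index_reduct I \<in> A then 0 else - a I)"
      have "represented_by 1 (\<lambda>z. (\<Sum>i\<in>A. series_term \<alpha> \<beta> u i z) + (- 1) * u z)
          (\<lambda>I. (\<Sum>i\<in>A. if index_reduct I = i then a I else 0) + (- 1) * a I)"
        by (intro represented_add represented_sum represented_cmult terms A a) (use A in auto)
      also have "(\<lambda>I. (\<Sum>i\<in>A. if index_reduct I = i then a I else 0) + (- 1) * a I) = b"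
        using A by (auto simp: b_def fun_eq_iff)
      finally have b: "represented_by 1 (?D A) b" by simp
      note D = represented_wirtinger_multi[OF b, of p q]
      have Gb: "norm (coeff_deriv_multi ?N b I) * r ^ total_degree I = (if \<rho> I \<in> A then 0 else G I)" for I
        by (simp add: coeff_deriv_multi_def b_def \<rho>_def G_def norm_mult)
      have le: "norm (wirtinger_multi p q (?D A) z) \<le> ?T A"
        if z: "z \<in> K" for z
      proof -
        have zP: "z \<in> pdisc 1" using z K(3) by (auto simp: polydisc_eq_pdisc)
        then have "wirtinger_multi p q (?D A) z = mixed_series (coeff_deriv_multi ?N b) z"
          using D by (simp add: represented_by_def)
        moreover have "norm (mixed_series (coeff_deriv_multi ?N b) z) \<le> (\<Sum>\<^sub>\<infinity>I. norm (coeff_deriv_multi ?N b I) * r ^ total_degree I)"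
        proof (rule norm_infsum_le)
          have cD: "converges_on_pdisc 1 (coeff_deriv_multi ?N b)" using D by (simp add: represented_by_def)
          show "((\<lambda>I. coeff_deriv_multi ?N b I * mixed_monomial I z) has_sum mixed_series (coeff_deriv_multi ?N b) z) UNIV"
            by (rule mixed_series_has_sum[OF cD zP]) simp
          show "((\<lambda>I. norm (coeff_deriv_multi ?N b I) * r ^ total_degree I) has_sum
              (\<Sum>\<^sub>\<infinity>I. norm (coeff_deriv_multi ?N b I) * r ^ total_degree I)) UNIV"
            using cD r by (intro has_sum_infsum) (simp add: converges_on_pdisc_def)
          show "norm (coeff_deriv_multi ?N b I * mixed_monomial I z) \<le> norm (coeff_deriv_multi ?N b I) * r ^ total_degree I" for I
            by (rule norm_mixed_term_le[OF r(3)[OF z]])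
        qed
        ultimately show ?thesis by (simp add: Gb)
      qed
      obtain z0 where z0: "z0 \<in> K" using K(2) by blast
      have "0 \<le> Cinf_seminorm K p q (?D A)"
        unfolding Cinf_seminorm_def
        by (rule cSUP_upper2[OF _ z0]) (auto intro!: bdd_aboveI2 le)
      moreover have "Cinf_seminorm K p q (?D A) \<le> ?T A"
        unfolding Cinf_seminorm_def by (rule cSUP_least[OF K(2) le])
      ultimately show ?thesis by blast
    qed
    have ev: "\<forall>\<^sub>F A in finite_subsets_at_top index_H. finite A \<and> A \<subseteq> (index_H :: ((nat ^ 'n) \<times> (nat ^ 'n)) set)"
      by (rule eventually_finite_subsets_at_top_weakI) auto
    show ?thesis
    proof (rule tendsto_sandwich[OF _ _ tendsto_const infsum_outside_finite_tendsto[OF G, of \<rho> index_H]])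
      show "\<forall>\<^sub>F A in finite_subsets_at_top index_H. 0 \<le> Cinf_seminorm K p q (?D A)"
        using ev by (rule eventually_mono) (use bound in blast)
      show "\<forall>\<^sub>F A in finite_subsets_at_top index_H. Cinf_seminorm K p q (?D A)
          \<le> ?T A"
        using ev by (rule eventually_mono) (use bound in blast)
      show "\<rho> I \<in> index_H" for I by (simp add: \<rho>_def index_reduct_in_H)
    qed
  qed
  have "has_sum_Cinf (series_term \<alpha> \<beta> u) u index_H"
    unfolding has_sum_Cinf_def using smooth[OF terms] smooth[OF a] lim by blast
  moreover have "((\<lambda>i. series_term \<alpha> \<beta> u i z) has_sum u z) index_H" if z: "z \<in> polydisc" for z
  proof -
    \<comment> \<open>pointwise convergence is the case of a single point and no derivatives\<close>
    have "foldr (\<lambda>j f. f) js f = f" for js :: "'n list" and f :: "complex ^ 'n \<Rightarrow> complex" by (induction js) auto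
    then have "Cinf_seminorm {z} 0 0 f = norm (f z)" for f
      by (simp add: Cinf_seminorm_def wirtinger_multi_def id_def)
    with lim[of "{z}" 0 0] z have "((\<lambda>A. norm ((\<Sum>i\<in>A. series_term \<alpha> \<beta> u i z) - u z)) \<longlongrightarrow> 0) (finite_subsets_at_top index_H)"
      by simp
    then show ?thesis unfolding has_sum_def by (simp add: tendsto_norm_zero_iff LIM_zero_iff)
  qed
  ultimately show ?thesis by blast
qed

end
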